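(* Let $X$ be a scaling element (in some $C^*$-algebra). The $C^*$-algebra $C^*(X)$ generated by $X$ has an infinite projection if and only if $[0,1]\setminus\mathrm{sp}(|X^*|)\neq\emptyset$.
   Context: An element $X$ of a $C^*$-algebra is a scaling element if $(X^*X)X=X$ and $X^*X\neq XX^*$. $C^*(X)$ denotes the (not necessarily unital) $C^*$-algebra generated by $X$, $|X^*|=(XX^* )^{1/2}$, and $\mathrm{sp}$ denotes the spectrum (taken in the unitization if the algebra is non-unital). A projection $P$ in a $C^*$-algebra $\mathfrak{A}$ is infinite if there exists $U\in\mathfrak{A}$ with $U^*U=P$, $UU^*\leq P$ and $UU^*\neq P$. *)

theory Defs
  imports "HOL-Analysis.Analysis"
begin

(* Complex C*-algebras, not assumed to be unital. The real structure comes from the library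
   classes; the first axiom of scaleC makes the complex structure extend it. *)
class cstar_algebra = real_normed_algebra + banach +
  fixes scaleC :: "complex \<Rightarrow> 'a \<Rightarrow> 'a" (infixr "*\<^sub>C" 75)
    and star :: "'a \<Rightarrow> 'a"
  assumes scaleC_of_real: "complex_of_real r *\<^sub>C x = r *\<^sub>R x"
    and scaleC_add_right: "c *\<^sub>C (x + y) = c *\<^sub>C x + c *\<^sub>C y"
    and scaleC_add_left: "(c + d) *\<^sub>C x = c *\<^sub>C x + d *\<^sub>C x"
    and scaleC_scaleC: "c *\<^sub>C (d *\<^sub>C x) = (c * d) *\<^sub>C x"
    and mult_scaleC_left: "(c *\<^sub>C x) * y = c *\<^sub>C (x * y)"
    and mult_scaleC_right: "x * (c *\<^sub>C y) = c *\<^sub>C (x * y)"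
    and norm_scaleC: "norm (c *\<^sub>C x) = cmod c * norm x"
    and star_star: "star (star x) = x"
    and star_add: "star (x + y) = star x + star y"
    and star_scaleC: "star (c *\<^sub>C x) = cnj c *\<^sub>C star x"
    and star_mult: "star (x * y) = star y * star x"
    and cstar_identity: "norm (star x * x) = (norm x)\<^sup>2"

definition cstar_subalgebra :: "'a::cstar_algebra set \<Rightarrow> bool" where
  "cstar_subalgebra A \<longleftrightarrow>
     closed A \<and> 0 \<in> A \<and>
     (\<forall>x\<in>A. \<forall>y\<in>A. x + y \<in> A \<and> x * y \<in> A) \<and>
     (\<forall>c. \<forall>x\<in>A. c *\<^sub>C x \<in> A) \<and>
     (\<forall>x\<in>A. star x \<in> A)"

definition Cstar :: "'a::cstar_algebra \<Rightarrow> 'a set" where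
  "Cstar X = cstar_subalgebra hull {X}"

(* The notions below are relative to a C*-subalgebra A, regarded as a C*-algebra in its own right.
   A unit of A need not be a unit of the ambient algebra. *)
definition unit_of :: "'a::cstar_algebra set \<Rightarrow> 'a \<Rightarrow> bool" where
  "unit_of A e \<longleftrightarrow> e \<in> A \<and> (\<forall>x\<in>A. e * x = x \<and> x * e = x)"

(* The pair (x, c) stands for x + c1 in the unitization, whose unit is (0, 1). *)
definition unitization_mult ::
    "'a::cstar_algebra \<times> complex \<Rightarrow> 'a \<times> complex \<Rightarrow> 'a \<times> complex" where
  "unitization_mult p q =
     (fst p * fst q + snd p *\<^sub>C fst q + snd q *\<^sub>C fst p, snd p * snd q)"

definition spectrum :: "'a::cstar_algebra set \<Rightarrow> 'a \<Rightarrow> complex set" where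
  "spectrum A a =
     (if \<exists>e. unit_of A e
      then {z. \<exists>e. unit_of A e \<and>
               \<not> (\<exists>b\<in>A. (a - z *\<^sub>C e) * b = e \<and> b * (a - z *\<^sub>C e) = e)}
      else {z. \<not> (\<exists>q \<in> A \<times> UNIV. unitization_mult (a, - z) q = (0, 1) \<and>
                                   unitization_mult q (a, - z) = (0, 1))})"

definition positive :: "'a::cstar_algebra set \<Rightarrow> 'a \<Rightarrow> bool" where
  "positive A a \<longleftrightarrow> a \<in> A \<and> star a = a \<and> spectrum A a \<subseteq> complex_of_real ` {0..}"

definition cstar_le :: "'a::cstar_algebra set \<Rightarrow> 'a \<Rightarrow> 'a \<Rightarrow> bool" where
  "cstar_le A a b \<longleftrightarrow> positive A (b - a)"

(* The square root of a positive element, characterised as its unique positive square root. *)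
definition cstar_sqrt :: "'a::cstar_algebra set \<Rightarrow> 'a \<Rightarrow> 'a" where
  "cstar_sqrt A a = (THE b. positive A b \<and> b * b = a)"

definition cstar_abs :: "'a::cstar_algebra set \<Rightarrow> 'a \<Rightarrow> 'a" where
  "cstar_abs A a = cstar_sqrt A (star a * a)"

definition projection :: "'a::cstar_algebra set \<Rightarrow> 'a \<Rightarrow> bool" where
  "projection A P \<longleftrightarrow> P \<in> A \<and> P * P = P \<and> star P = P"

definition infinite_projection :: "'a::cstar_algebra set \<Rightarrow> 'a \<Rightarrow> bool" where
  "infinite_projection A P \<longleftrightarrow>
     projection A P \<and>
     (\<exists>U\<in>A. star U * U = P \<and> cstar_le A (U * star U) P \<and> U * star U \<noteq> P)"

definition scaling_element :: "'a::cstar_algebra \<Rightarrow> bool" where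
  "scaling_element X \<longleftrightarrow> (star X * X) * X = X \<and> star X * X \<noteq> X * star X"

end

theory Submission
  imports "Jordan_Normal_Form.Determinant" "HOL-Computational_Algebra.Fundamental_Theorem_Algebra" Defs
begin

text \<open>Put \<open>a = X\<^sup>*X\<close> and \<open>b = XX\<^sup>*\<close>, so that \<open>ab = b\<close>. If the spectrum of \<open>b\<close> has a gap in
  \<open>(0,1)\<close>, then the spectral projection \<open>Q\<close> of \<open>b\<close> above the gap is equivalent, through the
  partial isometry in the polar decomposition of \<open>QX\<close>, to a strictly larger projection.

  Otherwise, vectors obtained by applying powers of \<open>X\<close> to functions of \<open>b\<close> concentrated near
  \<open>t\<^sup>2\<close> show that \<open>X\<close> acts, for every \<open>t\<close> in \<open>(0,1)\<close>, like the unilateral shift with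
  first weight \<open>t\<close>. A projection \<open>P\<close> gives a norm continuous path \<open>P\<^sub>t\<close> of projections that are
  compact perturbations of Toeplitz operators with the same symbol, which is 0 or 1. Since the
  shift with first weight 0 is the direct sum of 0 and the shift with first weight 1,
  \<open>P\<^sub>0\<close> is the direct sum of 0 and \<open>P\<^sub>1\<close>; for the symbol 1 this contradicts the constancy of
  the sign of the determinant of a large corner of \<open>2P\<^sub>t - 1\<close>. So the symbol is 0, \<open>P\<close> is compact
  in every such representation, and a partial isometry from \<open>P\<close> onto a subprojection
  \<open>Q\<close> must satisfy \<open>P = Q\<close> in each of them. The projection \<open>P - Q\<close> then lies where \<open>X\<close> acts as a
  unitary commuting with it, and it vanishes because its symbol does.\<close>

section \<open>Elementary C*-algebra facts\<close>

text \<open>No representation on a Hilbert space is used. Vectors are replaced by sequences in the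
  algebra itself, acted on by left multiplication and considered up to null sequences; the inner
  product becomes the algebra-valued \<open>star x * y\<close>. Everything rests on approximate
  eigenvectors, which come from powers of a self-adjoint c of norm 1: they keep norm 1 while
  \<open>1 - c^2\<close> sends them to 0. This gives the norm of a polynomial in c by its values on
  the spectrum, and with it the functional calculus.

  Systems with first weight t are supplied for 0 < t < 1, whereas the sign change compares t = 0
  with t = 1. Polynomials in X and \<open>star X\<close> therefore get matrices with entries
  continuous in all real t, and estimates reach the end points as closed conditions. These matrices
  are banded and Toeplitz outside a finite corner, so that Fredholm arguments become statements
  about finite determinants. The price is an error \<open>\<epsilon>\<close> between the projection
  P and a polynomial; the bound 1/10 keeps it well below 1/2, the distance of the spectrum of P -
  1/2 from 0.\<close>

lemma scaleC_one [simp]: "1 *\<^sub>C (x::'a::cstar_algebra) = x"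
  using scaleC_of_real[of 1 x] by simp

lemma scaleC_scaleR: "c *\<^sub>C (r *\<^sub>R (x::'a::cstar_algebra)) = r *\<^sub>R (c *\<^sub>C x)"
  by (simp flip: scaleC_of_real add: scaleC_scaleC mult.commute)

lemma scaleR_scaleC: "(r *\<^sub>R c) *\<^sub>C (x::'a::cstar_algebra) = r *\<^sub>R (c *\<^sub>C x)"
  by (simp flip: scaleC_of_real add: scaleC_scaleC scaleR_conv_of_real)

lemma bounded_bilinear_scaleC: "bounded_bilinear (scaleC :: complex \<Rightarrow> 'a::cstar_algebra \<Rightarrow> 'a)"
  by standard
    (auto simp: scaleC_add_right scaleC_add_left scaleC_scaleR scaleR_scaleC norm_scaleC intro: exI[of _ 1])

interpretation scaleC: bounded_bilinear "scaleC :: complex \<Rightarrow> 'a::cstar_algebra \<Rightarrow> 'a"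
  by (rule bounded_bilinear_scaleC)

lemmas scaleC_simps = scaleC.zero_left scaleC.zero_right scaleC.minus_left scaleC.minus_right
  scaleC.diff_left scaleC.diff_right scaleC_add_left scaleC_add_right scaleC_scaleC
  mult_scaleC_left mult_scaleC_right

declare scaleC.zero_left [simp] scaleC.zero_right [simp]

lemmas tendsto_scaleC = scaleC.tendsto

lemma star_zero [simp]: "star (0::'a::cstar_algebra) = 0"
  using star_scaleC[of 0 "0::'a"] by simp

lemma star_scaleR: "star (r *\<^sub>R (x::'a::cstar_algebra)) = r *\<^sub>R star x"
  using star_scaleC[of "complex_of_real r" x] by (simp add: scaleC_of_real)

lemma star_minus: "star (- (x::'a::cstar_algebra)) = - star x"
  using star_scaleR[of "-1" x] by simp

lemma star_diff: "star (x - (y::'a::cstar_algebra)) = star x - star y"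
  using star_add[of x "-y"] by (simp add: star_minus)

lemma norm_star [simp]: "norm (star (x::'a::cstar_algebra)) = norm x"
proof -
  have le: "norm y \<le> norm (star y)" for y :: 'a
  proof (cases "y = 0")
    case False
    have "norm y * norm y \<le> norm (star y) * norm y"
      using cstar_identity[of y] norm_mult_ineq[of "star y" y] by (simp add: power2_eq_square)
    then show ?thesis using False by simp
  qed simp
  show ?thesis using le[of x] le[of "star x"] by (simp add: star_star)
qed

lemma bounded_linear_star: "bounded_linear (star :: 'a::cstar_algebra \<Rightarrow> 'a)"
  by (rule bounded_linear_intro[of _ 1]) (auto simp: star_add star_scaleR)

lemmas tendsto_star = bounded_linear.tendsto[OF bounded_linear_star]
lemmas star_sum = linear_sum[OF bounded_linear.linear[OF bounded_linear_star]]

lemma cstar_norm_sqrt: "norm (x::'a::cstar_algebra) = sqrt (norm (star x * x))"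
  by (simp add: cstar_identity)

lemma star_mult_zero: "star x * x = 0 \<Longrightarrow> (x::'a::cstar_algebra) = 0"
  using cstar_identity[of x] by simp

lemma tendsto_zero_of_star_mult:
  fixes x :: "nat \<Rightarrow> 'a::cstar_algebra"
  assumes "(\<lambda>n. star (x n) * x n) \<longlonglongrightarrow> 0"
  shows "x \<longlonglongrightarrow> 0"
proof -
  have "(\<lambda>n. sqrt (norm (star (x n) * x n))) \<longlonglongrightarrow> sqrt (norm (0::'a))"
    by (intro tendsto_intros assms)
  then show ?thesis
    by (auto simp: cstar_identity tendsto_norm_zero_iff)
qed

lemma null_of_bounded_below:
  fixes x :: "nat \<Rightarrow> 'a::real_normed_vector" and y :: "nat \<Rightarrow> 'b::real_normed_vector"
  assumes "y \<longlonglongrightarrow> 0" "d > 0" "\<And>n. d * norm (x n) \<le> norm (y n) "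
  shows "x \<longlonglongrightarrow> 0"
proof (rule Lim_null_comparison[of _ "\<lambda>n. norm (y n) / d"])
  show "\<forall>\<^sub>F n in sequentially. norm (x n) \<le> norm (y n) / d"
    using assms(2,3) by (simp add: field_simps)
  show "(\<lambda>n. norm (y n) / d) \<longlonglongrightarrow> 0"
    using tendsto_divide[OF tendsto_norm[OF assms(1)] tendsto_const[of d]] assms(2) by simp
qed

text \<open>\<open>b - z\<close> is normal, so \<open>(b - z) x\<close> and
  \<open>(b - cnj z) x\<close> have equal norms, and they differ by \<open>2 i Im z\<close> times x.
  Hence approximate eigenvalues of b are real.\<close>

lemma bounded_below_nonreal:
  fixes b x :: "'a::cstar_algebra"
  assumes "star b = b"
  shows "\<bar>Im z\<bar> * norm x \<le> norm (b * x - z *\<^sub>C x)"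
proof -
  let ?u = "b * x - z *\<^sub>C x" and ?v = "b * x - cnj z *\<^sub>C x"
  have "star ?u * ?u = star ?v * ?v"
    using assms
    by (simp add: star_diff star_mult star_scaleC algebra_simps scaleC_simps)
  then have eq: "norm ?u = norm ?v" by (metis cstar_norm_sqrt)
  have "?v - ?u = (z - cnj z) *\<^sub>C x" by (simp add: scaleC_simps)
  moreover have "norm ((z - cnj z) *\<^sub>C x) = 2 * \<bar>Im z\<bar> * norm x"
    by (simp add: norm_scaleC complex_diff_cnj norm_mult)
  ultimately show ?thesis using norm_triangle_ineq4[of ?v ?u] eq by simp
qed

section \<open>Polynomials of an element acting on an algebra\<close>

text \<open>No unit is available, so a polynomial \<open>p\<close> is applied to \<open>b\<close> as an operator
  \<open>y \<mapsto> p(b) y\<close>; the element of the algebra given by a polynomial \<open>s q(s)\<close> without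
  constant term is \<open>pact q b b\<close>.\<close>

definition pact :: "complex poly \<Rightarrow> 'a::cstar_algebra \<Rightarrow> 'a \<Rightarrow> 'a" where
  "pact p b = fold_coeffs (\<lambda>a f y. a *\<^sub>C y + b * f y) p (\<lambda>y. 0)"

lemma pact_0 [simp]: "pact 0 b y = 0"
  by (simp add: pact_def)

lemma pact_pCons: "pact (pCons a p) b y = a *\<^sub>C y + b * pact p b y"
  by (cases "p = 0 \<and> a = 0") (auto simp: pact_def)

lemma pact_1 [simp]: "pact 1 b y = y"
  by (simp add: one_pCons pact_pCons)

lemma pact_X: "pact [:0, 1:] b y = b * y"
  by (simp add: pact_pCons)

lemma pact_scaleC_right: "pact p b (c *\<^sub>C y) = c *\<^sub>C pact p b y"
  by (induction p) (auto simp: pact_pCons scaleC_simps mult.commute)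

lemma pact_zero_right [simp]: "pact p b 0 = 0"
  by (induction p) (auto simp: pact_pCons)

lemma pact_mult_right: "pact p b (y * z) = pact p b y * z"
  by (induction p) (auto simp: pact_pCons scaleC_simps algebra_simps)

lemma pact_add: "pact (p + q) b y = pact p b y + pact q b y"
  by (induction p q rule: poly_induct2) (auto simp: pact_pCons scaleC_simps algebra_simps)

lemma pact_smult: "pact (smult c p) b y = c *\<^sub>C pact p b y"
  by (induction p) (auto simp: pact_pCons scaleC_simps)

lemma pact_diff: "pact (p - q) b y = pact p b y - pact q b y"
  using pact_add[of p "smult (-1) q" b y] by (simp only: pact_smult) (simp add: scaleC_simps)

lemma pact_commute: "x * b = b * x \<Longrightarrow> pact p b (x * y) = x * pact p b y"
  by (induction p) (auto simp: pact_pCons scaleC_simps distrib_left simp flip: mult.assoc)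

lemma pact_mult: "pact (p * q) b y = pact p b (pact q b y)"
  by (induction p) (auto simp: pact_pCons pact_add pact_smult)

lemma pact_pact_mult: "pact p b b * pact q b y = pact p b (b * pact q b y)"
  by (simp add: pact_mult_right)

lemma pact_star:
  fixes b y :: "'a::cstar_algebra"
  assumes "star b = b" "star y = y" "y * b = b * y"
  shows "star (pact p b y) = pact (map_poly cnj p) b y"
proof (induction p)
  case (pCons a p)
  have "pact (map_poly cnj p) b y * b = b * pact (map_poly cnj p) b y"
    by (simp add: assms(3) pact_mult_right[symmetric] pact_commute)
  then show ?case
    using pCons by (simp add: pact_pCons map_poly_pCons star_add star_scaleC star_mult assms)
qed simp

lemma pact_eigen: "b * x = s *\<^sub>C x \<Longrightarrow> pact p b x = poly p s *\<^sub>C x"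
  by (induction p) (auto simp: pact_pCons scaleC_simps mult.commute)

lemma pact_approx_eigen:
  fixes x :: "nat \<Rightarrow> 'a::cstar_algebra"
  assumes "(\<lambda>j. b * x j - s *\<^sub>C x j) \<longlonglongrightarrow> 0"
  shows "(\<lambda>j. pact p b (x j) - poly p s *\<^sub>C x j) \<longlonglongrightarrow> 0"
proof (induction p)
  case (pCons a p)
  have "(\<lambda>j. b * (pact p b (x j) - poly p s *\<^sub>C x j) + poly p s *\<^sub>C (b * x j - s *\<^sub>C x j))
      \<longlonglongrightarrow> b * 0 + poly p s *\<^sub>C 0"
    by (intro tendsto_intros tendsto_scaleC pCons assms)
  then show ?case
    by (simp add: pact_pCons scaleC_simps algebra_simps)
qed simp

text \<open>Peel linear factors off Q: one of them must be the first to turn a non-null sequence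
  into a null one, and its root is then an approximate eigenvalue of b.\<close>

lemma poly_root_approx_eigen:
  fixes x :: "nat \<Rightarrow> 'a::cstar_algebra"
  assumes "Q \<noteq> 0" "(\<lambda>j. pact Q b (x j)) \<longlonglongrightarrow> 0" "\<not> x \<longlonglongrightarrow> 0"
  shows "\<exists>z q. poly Q z = 0 \<and> (\<lambda>j. b * pact q b (x j) - z *\<^sub>C pact q b (x j)) \<longlonglongrightarrow> 0
            \<and> \<not> (\<lambda>j. pact q b (x j)) \<longlonglongrightarrow> 0"
  using assms
proof (induction "degree Q" arbitrary: Q rule: less_induct)
  case less
  show ?case
  proof (cases "degree Q = 0")
    case True
    then obtain c where c: "Q = [:c:]" by (metis degree_eq_zeroE)
    with less.prems have "c \<noteq> 0" by auto
    have "(\<lambda>j. (1/c) *\<^sub>C pact Q b (x j)) \<longlonglongrightarrow> (1/c) *\<^sub>C 0"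
      by (intro tendsto_scaleC less.prems tendsto_const)
    then have "x \<longlonglongrightarrow> 0" using c \<open>c \<noteq> 0\<close> by (simp add: pact_pCons scaleC_simps)
    then show ?thesis using less.prems by simp
  next
    case False
    then obtain z where z: "poly Q z = 0"
      using fundamental_theorem_of_algebra[of Q] by (auto simp: constant_degree)
    then obtain R where R: "Q = [:-z, 1:] * R" by (metis dvdE poly_eq_0_iff_dvd)
    show ?thesis
    proof (cases "(\<lambda>j. pact R b (x j)) \<longlonglongrightarrow> 0")
      case False
      have "pact Q b (x j) = b * pact R b (x j) - z *\<^sub>C pact R b (x j)" for j
        by (simp only: R pact_mult) (simp add: pact_pCons scaleC_simps)
      then show ?thesis using False z less.prems(2) by auto
    next
      case True
      have "R \<noteq> 0" using R less.prems by auto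
      then have "degree R < degree Q" unfolding R by (subst degree_mult_eq) auto
      from less.hyps[OF this \<open>R \<noteq> 0\<close> True less.prems(3)] R show ?thesis by auto
    qed
  qed
qed

section \<open>Approximate eigenvectors of self-adjoint elements\<close>

text \<open>The second moment of a random walk with n steps of length 1, computed from the moments
  of the Bernstein polynomials at 1/2.\<close>

lemma sum_binomial_variance:
  "(\<Sum>k\<le>n. real (n choose k) * (real n - 2 * real k)\<^sup>2) = real n * 2 ^ n"
proof -
  have B: "Bernstein n k (1/2) = real (n choose k) / 2 ^ n" if "k \<le> n" for k
    using that by (simp add: Bernstein_def power_divide flip: power_add)
  have 0: "(\<Sum>k\<le>n. real (n choose k)) = 2 ^ n"
    by (simp flip: of_nat_sum add: choose_row_sum)
  have 1: "(\<Sum>k\<le>n. real k * real (n choose k)) = 2 ^ n * (real n / 2)"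
    using sum_k_Bernstein[of n "1/2"] by (simp add: B field_simps flip: sum_divide_distrib)
  have 2: "(\<Sum>k\<le>n. real k * (real k - 1) * real (n choose k)) = 2 ^ n * (real n * (real n - 1) / 4)"
    using sum_kk_Bernstein[of n "1/2"]
    by (simp add: B power2_eq_square field_simps flip: sum_divide_distrib)
  have "(\<Sum>k\<le>n. real (n choose k) * (real n - 2 * real k)\<^sup>2) =
      (\<Sum>k\<le>n. (real n)\<^sup>2 * real (n choose k) + (4 - 4 * real n) * (real k * real (n choose k))
          + 4 * (real k * (real k - 1) * real (n choose k)))"
    by (intro sum.cong) (auto simp: power2_eq_square algebra_simps)
  also have "\<dots> = (real n)\<^sup>2 * (\<Sum>k\<le>n. real (n choose k))
      + (4 - 4 * real n) * (\<Sum>k\<le>n. real k * real (n choose k))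
      + 4 * (\<Sum>k\<le>n. real k * (real k - 1) * real (n choose k))"
    by (simp only: sum.distrib sum_distrib_left)
  also have "\<dots> = real n * 2 ^ n"
    unfolding 0 1 2 by (simp add: power2_eq_square field_simps)
  finally show ?thesis .
qed

lemma sum_binomial_abs_deviation:
  assumes "n > 0"
  shows "(\<Sum>k\<le>n. real (n choose k) * \<bar>real n - 2 * real k\<bar>) \<le> sqrt n * 2 ^ n"
proof -
  \<comment> \<open>The Cauchy-Schwarz bound of the first moment by the second, linearised with the
    optimal parameter \<open>sqrt n\<close>.\<close>
  have amgm: "\<bar>u\<bar> \<le> (u\<^sup>2 / sqrt n + sqrt n) / 2" for u :: real
  proof -
    have "0 \<le> (\<bar>u\<bar> - sqrt n)\<^sup>2" by simp
    then have "2 * \<bar>u\<bar> * sqrt n \<le> u\<^sup>2 + sqrt n * sqrt n"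
      by (simp add: power2_eq_square algebra_simps)
    then show ?thesis using assms by (simp add: field_simps)
  qed
  have "(\<Sum>k\<le>n. real (n choose k) * \<bar>real n - 2 * real k\<bar>)
      \<le> (\<Sum>k\<le>n. real (n choose k) * (((real n - 2 * real k)\<^sup>2 / sqrt n + sqrt n) / 2))"
    by (intro sum_mono mult_left_mono amgm) simp
  also have "\<dots> = (\<Sum>k\<le>n. real (n choose k) * (real n - 2 * real k)\<^sup>2) / (2 * sqrt n)
      + sqrt n / 2 * (\<Sum>k\<le>n. real (n choose k))"
    by (simp add: sum_distrib_left sum.distrib[symmetric] sum_divide_distrib)
      (intro sum.cong refl, simp add: field_simps)
  also have "(\<Sum>k\<le>n. real (n choose k)) = 2 ^ n"
    by (simp flip: of_nat_sum add: choose_row_sum)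
  also have "(\<Sum>k\<le>n. real (n choose k) * (real n - 2 * real k)\<^sup>2) = sqrt n * sqrt n * 2 ^ n"
    by (simp add: sum_binomial_variance)
  also have "sqrt n * sqrt n * 2 ^ n / (2 * sqrt n) + sqrt n / 2 * 2 ^ n = sqrt n * 2 ^ n"
    using assms by (simp add: field_simps)
  finally show ?thesis .
qed

lemma funpow_one_plus:
  fixes T :: "'a::real_vector \<Rightarrow> 'a"
  assumes "linear T"
  shows "((\<lambda>u. u + T u) ^^ m) y = (\<Sum>k\<le>m. real (m choose k) *\<^sub>R (T ^^ k) y)"
proof (induction m)
  case (Suc m)
  have "((\<lambda>u. u + T u) ^^ Suc m) y =
      (\<Sum>k\<le>m. real (m choose k) *\<^sub>R (T ^^ k) y) + (\<Sum>k\<le>m. real (m choose k) *\<^sub>R (T ^^ Suc k) y)"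
    using assms by (simp add: Suc linear_sum linear_scale)
  also have "(\<Sum>k\<le>m. real (m choose k) *\<^sub>R (T ^^ k) y) = (\<Sum>k\<le>Suc m. real (m choose k) *\<^sub>R (T ^^ k) y)"
    by simp
  also have "\<dots> = y + (\<Sum>k\<le>m. real (m choose Suc k) *\<^sub>R (T ^^ Suc k) y)"
    by (subst sum.atMost_Suc_shift) simp
  also have "\<dots> + (\<Sum>k\<le>m. real (m choose k) *\<^sub>R (T ^^ Suc k) y)
      = y + (\<Sum>k\<le>m. real (Suc m choose Suc k) *\<^sub>R (T ^^ Suc k) y)"
    by (simp add: sum.distrib[symmetric] scaleR_add_left[symmetric] add.assoc add.commute)
  also have "\<dots> = (\<Sum>k\<le>Suc m. real (Suc m choose k) *\<^sub>R (T ^^ k) y)"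
    by (simp add: sum.atMost_Suc_shift del: sum.atMost_Suc binomial_Suc_Suc)
  finally show ?case .
qed simp

text \<open>Put n = m + 1. After multiplication by n, the coefficient of T^k in (1 + T)^m (1 - T) is
  \<open>(n choose k) * (n - 2 k)\<close>, so the norm is controlled by the mean absolute deviation
  of the binomial distribution, which gains a factor \<open>1 / sqrt n\<close>.\<close>

lemma contraction_averages:
  fixes T :: "'a::real_normed_vector \<Rightarrow> 'a"
  assumes "linear T" and contr: "\<And>u. norm (T u) \<le> norm u"
  shows "norm (((\<lambda>u. u + T u) ^^ m) (x - T x)) \<le> 2 ^ Suc m / sqrt (Suc m) * norm x"
proof -
  define n where "n = Suc m"
  define f where "f k = (T ^^ k) x" for k
  have fT: "(T ^^ k) (T x) = f (Suc k)" for k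
    by (simp add: f_def funpow_swap1)
  have lin: "linear (T ^^ k)" for k
  proof (induction k)
    case (Suc k)
    then show ?case using linear_compose[OF Suc assms(1)] by (simp add: comp_def)
  qed (simp add: linear_id[unfolded id_def] id_def)
  have nf: "norm (f k) \<le> norm x" for k
    by (induction k) (auto simp: f_def intro: order_trans[OF contr])
  have c1: "real n * real (m choose k) = real (n choose k) * (real n - real k)" if "k \<le> m" for k
  proof -
    have "(n - k) * (n choose k) = n * (m choose k)"
      using binomial_absorb_comp[of n k] by (simp add: n_def)
    then have "real n * real (m choose k) = real (n - k) * real (n choose k)"
      by (simp only: of_nat_mult[symmetric])
    also have "real (n - k) = real n - real k" using that by (simp add: n_def of_nat_diff)
    finally show ?thesis by (simp only: mult.commute)
  qed
  have c2: "real n * real (m choose k) = real (n choose Suc k) * real (Suc k)" for k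
  proof -
    have "n * (m choose k) = (n choose Suc k) * Suc k"
      using Suc_times_binomial_eq[of m k] by (simp only: n_def)
    then show ?thesis by (simp only: of_nat_mult[symmetric])
  qed
  have "real n *\<^sub>R ((\<lambda>u. u + T u) ^^ m) (x - T x)
      = (\<Sum>k\<le>m. (real n * real (m choose k)) *\<^sub>R f k) - (\<Sum>k\<le>m. (real n * real (m choose k)) *\<^sub>R f (Suc k))"
    by (simp add: funpow_one_plus[OF assms(1)] linear_diff[OF lin] fT f_def[symmetric] scaleR_sum_right
        sum_subtractf[symmetric] algebra_simps)
  also have "(\<Sum>k\<le>m. (real n * real (m choose k)) *\<^sub>R f k)
      = (\<Sum>k\<le>m. (real (n choose k) * (real n - real k)) *\<^sub>R f k)"
    by (intro sum.cong refl) (simp add: c1)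
  also have "\<dots> = (\<Sum>k\<le>n. (real (n choose k) * (real n - real k)) *\<^sub>R f k)"
    by (simp add: n_def)
  also have "(\<Sum>k\<le>m. (real n * real (m choose k)) *\<^sub>R f (Suc k))
      = (\<Sum>k\<le>m. (real (n choose Suc k) * real (Suc k)) *\<^sub>R f (Suc k))"
    by (intro sum.cong refl) (simp only: c2)
  also have "\<dots> = (\<Sum>k\<le>n. (real (n choose k) * real k) *\<^sub>R f k)"
    by (simp add: n_def sum.atMost_Suc_shift del: sum.atMost_Suc binomial_Suc_Suc)
  also have "(\<Sum>k\<le>n. (real (n choose k) * (real n - real k)) *\<^sub>R f k) - \<dots>
      = (\<Sum>k\<le>n. (real (n choose k) * (real n - 2 * real k)) *\<^sub>R f k)"
    unfolding sum_subtractf[symmetric] by (intro sum.cong refl) (subst scaleR_diff_left[symmetric], simp add: algebra_simps)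
  finally have eq: "real n *\<^sub>R ((\<lambda>u. u + T u) ^^ m) (x - T x) = \<dots>" .
  have "real n * norm (((\<lambda>u. u + T u) ^^ m) (x - T x)) = norm (real n *\<^sub>R ((\<lambda>u. u + T u) ^^ m) (x - T x))"
    by simp
  also have "\<dots> \<le> (\<Sum>k\<le>n. norm ((real (n choose k) * (real n - 2 * real k)) *\<^sub>R f k))"
    unfolding eq by (rule norm_sum)
  also have "\<dots> \<le> (\<Sum>k\<le>n. real (n choose k) * \<bar>real n - 2 * real k\<bar> * norm x)"
    by (intro sum_mono) (auto simp: abs_mult intro!: mult_left_mono nf)
  also have "\<dots> \<le> sqrt n * 2 ^ n * norm x"
    unfolding sum_distrib_right[symmetric]
    by (intro mult_right_mono sum_binomial_abs_deviation) (auto simp: n_def)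
  also have "\<dots> = (real n / sqrt n) * 2 ^ n * norm x"
    by (simp only: real_div_sqrt of_nat_0_le_iff)
  also have "\<dots> = real n * (2 ^ n / sqrt n * norm x)" by simp
  finally show ?thesis
    by (subst (asm) mult_le_cancel_left_pos) (simp_all add: n_def)
qed

section \<open>Decay of c^m (1 - c^2) for a self-adjoint contraction c\<close>

text \<open>The element w is 1 - sqrt(1 - d), the fixed point of
  \<open>w \<mapsto> (d + w^2) / 2\<close>. Iterating inside a closed set of self-adjoint elements
  that commute with c makes the limit inherit these properties.\<close>

lemma sqrt_one_minus:
  fixes c d :: "'a::cstar_algebra"
  assumes "star d = d" "norm d < 1" "d * c = c * d"
  obtains w where "star w = w" "w * c = c * w" "norm w \<le> 1" "w + w = d + w * w"
proof -
  \<comment> \<open>The smaller root of \<open>2 r = norm d + r^2\<close>: the ball of radius r is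
    mapped into itself, and r < 1 is also a Lipschitz constant there.\<close>
  define r where "r = 1 - sqrt (1 - norm d)"
  have r: "0 \<le> r" "r < 1" using assms(2) by (auto simp: r_def)
  have r2: "norm d + r * r = 2 * r"
    using assms(2) by (simp add: r_def algebra_simps)
  define S where "S = {w. norm w \<le> r} \<inter> {w. star w = w} \<inter> {w. w * c = c * w}"
  define f where "f w = (1/2) *\<^sub>R (d + w * w)" for w
  have "closed S"
    unfolding S_def
    by (intro closed_Int closed_Collect_le closed_Collect_eq continuous_intros
        linear_continuous_on bounded_linear_star)
  then have "complete S" by (simp add: complete_eq_closed)
  moreover have "0 \<in> S" using r by (simp add: S_def)
  then have "S \<noteq> {}" by blast
  moreover have "f ` S \<subseteq> S"
  proof safe
    fix w assume w: "w \<in> S"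
    have "norm (d + w * w) \<le> norm d + r * r"
      using w by (auto simp: S_def intro!: norm_triangle_le add_left_mono order_trans[OF norm_mult_ineq] mult_mono r)
    moreover have "w * w * c = c * (w * w)" using w by (simp add: S_def) (metis mult.assoc)
    moreover have "norm (f w) = norm (d + w * w) / 2" by (simp add: f_def)
    ultimately show "f w \<in> S"
      using w r2 assms by (auto simp: S_def f_def star_scaleR star_add star_mult algebra_simps simp del: scaleR_right_distrib)
  qed
  moreover have "dist (f x) (f y) \<le> r * dist x y" if "x \<in> S" "y \<in> S" for x y
  proof -
    have "f x - f y = (1/2) *\<^sub>R (x * (x - y) + (x - y) * y)"
      by (simp add: f_def algebra_simps)
    also have "norm \<dots> = norm (x * (x - y) + (x - y) * y) / 2" by (simp del: scaleR_right_distrib)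
    also have "norm (x * (x - y) + (x - y) * y) \<le> norm x * norm (x - y) + norm (x - y) * norm y"
      by (intro norm_triangle_le add_mono norm_mult_ineq)
    also have "\<dots> \<le> r * norm (x - y) + norm (x - y) * r"
      using that by (intro add_mono mult_right_mono mult_left_mono) (auto simp: S_def)
    finally have "norm (f x - f y) \<le> r * norm (x - y)" by simp
    then show ?thesis by (simp add: dist_norm)
  qed
  ultimately obtain w where w: "w \<in> S" "f w = w"
    using Banach_fix[of S r f] r by blast
  have "w + w = 2 *\<^sub>R f w" by (simp add: w scaleR_2)
  then have "w + w = d + w * w" by (simp add: f_def)
  then show thesis using that w r by (auto simp: S_def)
qed

text \<open>With \<open>(1 - w)\<^sup>2 = 1 - c\<^sup>2\<close>, the operators \<open>c \<plusminus> i (1 - w)\<close> are mutually inverse isometries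
  with mean \<open>c\<close>, which turns powers of \<open>c\<close> into binomial averages.\<close>

lemma power_times_one_minus_square_less:
  fixes c x :: "'a::cstar_algebra"
  assumes sa: "star c = c" and "norm c < 1"
  shows "norm (((*) c ^^ m) (x - c * (c * x))) \<le> 2 / sqrt (Suc m) * norm x"
proof -
  have "norm (c * c) < 1"
    using assms(2) norm_mult_ineq[of c c] mult_strict_mono[of "norm c" 1 "norm c" 1] by simp
  then obtain w where w: "star w = w" "w * c = c * w" "norm w \<le> 1" "w + w = c * c + w * w"
    using sqrt_one_minus[of "c * c" c] sa by (auto simp: star_mult mult.assoc)
  have cw: "c * (w * u) = w * (c * u)" for u by (metis w(2) mult.assoc)
  have ww: "w * (w * u) = w * u + w * u - c * (c * u)" for u
  proof -
    have "w * u + w * u = c * (c * u) + w * (w * u)"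
      by (simp only: mult.assoc[symmetric] distrib_right[symmetric] w(4))
    then show ?thesis by simp
  qed
  define V where "V u = c * u + \<i> *\<^sub>C (u - w * u)" for u
  define V' where "V' u = c * u - \<i> *\<^sub>C (u - w * u)" for u
  have linV: "linear V"
    by (rule linearI) (auto simp: V_def scaleC_simps algebra_simps scaleC_scaleR)
  have VV': "V (V' u) = u" for u
    by (simp add: V_def V'_def scaleC_simps algebra_simps cw ww)
  have Vc: "V (c * u) = c * V u" for u
    by (simp add: V_def scaleC_simps algebra_simps cw)
  have iso: "norm (V u) = norm u" for u
  proof -
    have "star (V u) * V u = star u * u"
      by (simp add: V_def star_add star_diff star_mult star_scaleC sa w(1) scaleC_simps algebra_simps cw ww)
    then show ?thesis by (metis cstar_norm_sqrt)
  qed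
  \<comment> \<open>Apply the averaging bound to T = V^2. From V + V' = 2 c and V' = V^-1 follow 1 +
    T = 2 c V and 1 - T = -2 i V (1 - w); the isometries V drop out of the norms and leave c^m (1 -
    w).\<close>
  have key: "norm (((*) c ^^ m) (u - w * u)) \<le> norm u / sqrt (Suc m)" for u
  proof -
    define T where "T u = V (V u)" for u
    have 1: "u + T u = 2 *\<^sub>R V (c * u)" for u
    proof -
      have "V u + V' u = 2 *\<^sub>R (c * u)" by (simp add: V_def V'_def scaleR_2)
      then have "2 *\<^sub>R V (c * u) = V (V u + V' u)" by (simp add: linear_scale[OF linV])
      then show ?thesis by (simp add: linear_add[OF linV] VV' T_def)
    qed
    have Vcm: "V (((*) c ^^ k) u) = ((*) c ^^ k) (V u)" for k u
      by (induction k) (auto simp: Vc)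
    have 2: "((\<lambda>u. u + T u) ^^ k) u = 2 ^ k *\<^sub>R (V ^^ k) (((*) c ^^ k) u)" for k u
    proof (induction k)
      case (Suc k)
      have "c * (V ^^ k) v = (V ^^ k) (c * v)" for v
        by (induction k) (simp_all flip: Vc)
      then show ?case
        by (simp only: funpow.simps comp_apply Suc) (simp add: 1 linear_scale[OF linV])
    qed simp
    have iso': "norm ((V ^^ k) u) = norm u" for k u
      by (induction k) (auto simp: iso)
    have 3: "u - T u = V (- (2 * \<i>) *\<^sub>C (u - w * u))" for u
    proof -
      have "V' u - V u = - (2 * \<i>) *\<^sub>C (u - w * u)"
        unfolding V_def V'_def scaleC.minus_left mult_2 scaleC_add_left by simp
      then have "V (- (2 * \<i>) *\<^sub>C (u - w * u)) = V (V' u) - V (V u)"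
        by (simp only: linear_diff[OF linV, symmetric])
      then show ?thesis by (simp only: VV' T_def)
    qed
    have lin_c: "((*) c ^^ k) (z *\<^sub>C u) = z *\<^sub>C ((*) c ^^ k) u" for k z u
      by (induction k) (auto simp: scaleC_simps)
    have "norm (((\<lambda>u. u + T u) ^^ m) (u - T u)) = 2 ^ m * (2 * norm (((*) c ^^ m) (u - w * u)))"
      unfolding 2 3 by (simp add: iso' Vcm[symmetric] iso lin_c norm_scaleC norm_mult del: mult_minus_left)
    moreover have "norm (((\<lambda>u. u + T u) ^^ m) (u - T u)) \<le> 2 ^ Suc m / sqrt (Suc m) * norm u"
      by (rule contraction_averages) (auto simp: T_def iso intro: linear_compose[OF linV linV, unfolded o_def] )
    ultimately have "2 ^ Suc m * norm (((*) c ^^ m) (u - w * u)) \<le> 2 ^ Suc m * (norm u / sqrt (Suc m))"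
      by simp
    then show ?thesis by (subst (asm) mult_le_cancel_left_pos) auto
  qed
  \<comment> \<open>This is 1 - c^2 = (1 - w)^2: one factor 1 - w supplies the decay, the other has
    norm at most 2.\<close>
  have "x - c * (c * x) = (x - w * x) - w * (x - w * x)"
    by (simp add: algebra_simps ww)
  then have "norm (((*) c ^^ m) (x - c * (c * x))) \<le> norm (x - w * x) / sqrt (Suc m)"
    using key[of "x - w * x"] by (simp only:)
  also have "norm (x - w * x) \<le> norm x + norm w * norm x"
    by (intro order_trans[OF norm_triangle_ineq4] add_left_mono norm_mult_ineq)
  also have "\<dots> \<le> 2 * norm x" using w(3) mult_right_mono[of "norm w" 1 "norm x"] by simp
  finally show ?thesis by (simp add: divide_right_mono)
qed

lemma funpow_mult_scaleR:
  fixes c :: "'a::real_algebra"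
  shows "((*) (r *\<^sub>R c) ^^ m) x = r ^ m *\<^sub>R ((*) c ^^ m) x"
  by (induction m) auto

lemma bounded_linear_funpow_mult:
  "bounded_linear ((*) (c::'a::real_normed_algebra) ^^ m)"
proof (induction m)
  case 0
  then show ?case by (simp add: id_def bounded_linear_ident)
next
  case (Suc m)
  then show ?case
    using bounded_linear_compose[OF bounded_linear_mult_right[of c] Suc] by (simp add: o_def)
qed

text \<open>The square root in the previous lemma is built for norm below 1; norm 1 is reached as
  the limit of \<open>r k *\<^sub>R c\<close> with \<open>r k\<close> tending to 1.\<close>

lemma power_times_one_minus_square:
  fixes c x :: "'a::cstar_algebra"
  assumes sa: "star c = c" and "norm c \<le> 1"
  shows "norm (((*) c ^^ m) (x - c * (c * x))) \<le> 2 / sqrt (Suc m) * norm x"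
proof -
  define r where "r k = 1 - 1 / real (Suc k)" for k
  have r: "r \<longlonglongrightarrow> 1"
    unfolding r_def using tendsto_diff[OF tendsto_const LIMSEQ_Suc[OF lim_1_over_n]] by simp
  let ?g = "\<lambda>k. norm (r k ^ m *\<^sub>R ((*) c ^^ m) (x - (r k * r k) *\<^sub>R (c * (c * x))))"
  have le: "?g k \<le> 2 / sqrt (Suc m) * norm x" for k
  proof -
    have rk: "0 \<le> r k" "r k < 1" by (auto simp: r_def)
    have "norm (r k *\<^sub>R c) < 1"
      using rk assms(2) mult_left_mono[of "norm c" 1 "r k"] by (simp add: abs_of_nonneg)
    from power_times_one_minus_square_less[OF _ this, of m x] sa
    show ?thesis by (simp add: star_scaleR funpow_mult_scaleR)
  qed
  have lim: "?g \<longlonglongrightarrow> norm (1 ^ m *\<^sub>R ((*) c ^^ m) (x - (1 * 1) *\<^sub>R (c * (c * x))))"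
    by (intro tendsto_intros bounded_linear.tendsto[OF bounded_linear_funpow_mult] r)
  have "norm (1 ^ m *\<^sub>R ((*) c ^^ m) (x - (1 * 1) *\<^sub>R (c * (c * x)))) \<le> 2 / sqrt (Suc m) * norm x"
    by (rule LIMSEQ_le_const2[OF lim]) (use le in blast)
  then show ?thesis by simp
qed

section \<open>Continuous functional calculus\<close>

text \<open>The iterate is the power of exponent m + 1. By the C*-identity, squaring a self-adjoint
  power squares its norm, so arbitrarily high powers have norm 1; since the norms of the powers
  decrease, all of them equal 1.\<close>

lemma norm_funpow_self_adjoint:
  fixes c :: "'a::cstar_algebra"
  assumes sa: "star c = c" and n1: "norm c = 1"
  shows "norm (((*) c ^^ m) c) = 1"
proof -
  have mono: "norm (((*) c ^^ (k + j)) c) \<le> norm (((*) c ^^ k) c)" for k j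
  proof (induction j)
    case (Suc j)
    have "norm (((*) c ^^ (k + Suc j)) c) \<le> norm c * norm (((*) c ^^ (k + j)) c)"
      by (simp add: norm_mult_ineq)
    then show ?case using Suc n1 by simp
  qed simp
  have saf: "star (((*) c ^^ k) c) = ((*) c ^^ k) c" for k
  proof (induction k)
    case (Suc k)
    have "((*) c ^^ k) c * c = c * ((*) c ^^ k) c"
      by (induction k) (simp_all add: mult.assoc)
    then show ?case using Suc sa by (simp add: star_mult)
  qed (simp add: sa)
  have add: "((*) c ^^ j) c * ((*) c ^^ k) c = ((*) c ^^ (Suc (j + k))) c" for j k
    by (induction j) (simp_all add: mult.assoc)
  have sq: "norm (((*) c ^^ (Suc (k + k))) c) = (norm (((*) c ^^ k) c))\<^sup>2" for k
    using cstar_identity[of "((*) c ^^ k) c"] by (simp only: saf add)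
  have "\<exists>k\<ge>m. norm (((*) c ^^ k) c) = 1"
  proof (induction m)
    case (Suc m)
    then obtain k where "k \<ge> m" "norm (((*) c ^^ k) c) = 1" by blast
    then show ?case using sq[of k] by (intro exI[of _ "Suc (k + k)"]) simp
  qed (use n1 in \<open>auto intro!: exI[of _ 0]\<close>)
  then obtain k where "k \<ge> m" "norm (((*) c ^^ k) c) = 1" by blast
  then have "1 \<le> norm (((*) c ^^ m) c)" using mono[of m "k - m"] by simp
  moreover have "norm (((*) c ^^ m) c) \<le> 1" using mono[of 0 m] n1 by simp
  ultimately show ?thesis by simp
qed

text \<open>The real points bounded by the polynomial norms of \<open>b\<close>: the spectrum of \<open>b\<close>
  together with \<open>0\<close>.\<close>

definition sig :: "'a::cstar_algebra \<Rightarrow> real set" where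
  "sig b = {s. \<forall>q. cmod (of_real s * poly q (of_real s)) \<le> norm (pact q b b)}"

lemma sig_0 [simp]: "0 \<in> sig b"
  by (simp add: sig_def)

lemma sig_norm: "s \<in> sig b \<Longrightarrow> \<bar>s\<bar> \<le> norm b"
  unfolding sig_def by (auto dest: spec[of _ 1])

lemma closed_sig: "closed (sig b)"
  unfolding sig_def Collect_all_eq
  by (intro closed_INT ballI closed_Collect_le continuous_intros)

text \<open>On x the element \<open>pact q b b\<close> acts nearly as the scalar
  \<open>s q(s)\<close>; were its norm smaller than the modulus of that scalar, x would be
  null.\<close>

lemma sigI_approx_eigen:
  fixes x :: "nat \<Rightarrow> 'a::cstar_algebra"
  assumes "(\<lambda>j. b * x j - of_real s *\<^sub>C x j) \<longlonglongrightarrow> 0" "\<not> x \<longlonglongrightarrow> 0"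
  shows "s \<in> sig b"
proof (rule ccontr)
  assume "s \<notin> sig b"
  then obtain q where q: "norm (pact q b b) < cmod (of_real s * poly q (of_real s))"
    by (auto simp: sig_def not_le)
  let ?z = "of_real s * poly q (of_real s)" and ?p = "q * [:0, 1:]"
  have "(\<lambda>j. pact ?p b (x j) - ?z *\<^sub>C x j) \<longlonglongrightarrow> 0"
    using pact_approx_eigen[OF assms(1), of ?p] by (simp add: mult.commute)
  then have "x \<longlonglongrightarrow> 0"
  proof (rule null_of_bounded_below)
    fix j
    have "pact ?p b (x j) = pact q b b * x j"
      by (simp only: pact_mult pact_X pact_mult_right)
    then have "norm (pact ?p b (x j)) \<le> norm (pact q b b) * norm (x j)"
      by (simp add: norm_mult_ineq)
    then show "(cmod ?z - norm (pact q b b)) * norm (x j) \<le> norm (pact ?p b (x j) - ?z *\<^sub>C x j)"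
      using norm_triangle_ineq2[of "?z *\<^sub>C x j" "pact ?p b (x j)"]
      by (simp add: norm_scaleC norm_minus_commute left_diff_distrib)
  qed (use q in simp)
  with assms(2) show False by simp
qed

text \<open>This takes the place of the spectral radius formula. With z = q(b) b of norm r, the
  element \<open>c = star z * z / r^2\<close> has norm 1, so its powers have norm 1 while 1 - c^2
  sends them to 0. Since c is a polynomial Q in b, a linear factor of 1 - Q^2 turns these powers
  into approximate eigenvectors of b. The root s is real because b is self-adjoint, and Q(s)^2 = 1
  says that \<open>s q(s)\<close> has modulus r.\<close>

lemma norm_pact_attained:
  fixes b :: "'a::cstar_algebra"
  assumes sa: "star b = b"
  shows "\<exists>s\<in>sig b. norm (pact q b b) = cmod (of_real s * poly q (of_real s))"
proof (cases "pact q b b = 0")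
  case True
  then show ?thesis by (intro bexI[of _ 0]) auto
next
  case False
  define z where "z = pact q b b"
  define r where "r = norm z"
  have "r > 0" using False by (simp add: r_def z_def)
  define Q where "Q = smult (1 / of_real (r\<^sup>2)) (map_poly cnj q * [:0, 1:] * q * [:0, 1:])"
  define c where "c = (1 / r\<^sup>2) *\<^sub>R (star z * z)"
  have cQ: "c * y = pact Q b y" for y
    unfolding Q_def pact_smult c_def z_def pact_star[OF sa sa refl] pact_mult pact_X
    by (simp add: pact_mult_right mult.assoc mult_scaleC_left flip: scaleC_of_real)
  have "star c = c" by (simp add: c_def star_scaleR star_mult star_star)
  moreover have "norm c = 1"
    using \<open>r > 0\<close> by (simp add: c_def cstar_identity r_def)
  ultimately have c: "star c = c" "norm c = 1" .
  define x where "x m = ((*) c ^^ m) c" for m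
  have Qx: "pact (1 - Q * Q) b (x m) = ((*) c ^^ m) (c - c * (c * c))" for m
  proof -
    have *: "((*) c ^^ m) (u - v) = ((*) c ^^ m) u - ((*) c ^^ m) v" for u v
      by (induction m) (auto simp: right_diff_distrib)
    have "c * (c * x m) = ((*) c ^^ m) (c * (c * c))"
      unfolding x_def by (simp add: funpow_swap1)
    then show ?thesis by (simp add: pact_diff pact_mult cQ[symmetric] * x_def)
  qed
  have "(\<lambda>m. pact (1 - Q * Q) b (x m)) \<longlonglongrightarrow> 0"
  proof (rule Lim_null_comparison)
    show "\<forall>\<^sub>F m in sequentially. norm (pact (1 - Q * Q) b (x m)) \<le> 2 / sqrt (Suc m)"
      using power_times_one_minus_square[of c _ c] c by (auto simp: Qx)
    show "(\<lambda>m. 2 / sqrt (Suc m)) \<longlonglongrightarrow> 0" by real_asymp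
  qed
  moreover have "\<not> x \<longlonglongrightarrow> 0"
  proof
    assume "x \<longlonglongrightarrow> 0"
    then have "(\<lambda>m. norm (x m)) \<longlonglongrightarrow> 0" by (rule tendsto_norm_zero)
    then show False by (simp add: x_def norm_funpow_self_adjoint c LIMSEQ_const_iff)
  qed
  \<comment> \<open>Q has no constant term, so 1 - Q^2 takes the value 1 at 0.\<close>
  moreover have "1 - Q * Q \<noteq> 0"
  proof
    assume "1 - Q * Q = 0"
    then have "poly (1 - Q * Q) 0 = 0" by simp
    then show False by (simp add: Q_def)
  qed
  ultimately obtain w p where w: "poly (1 - Q * Q) w = 0"
    and lim: "(\<lambda>j. b * pact p b (x j) - w *\<^sub>C pact p b (x j)) \<longlonglongrightarrow> 0"
    and nz: "\<not> (\<lambda>j. pact p b (x j)) \<longlonglongrightarrow> 0"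
    using poly_root_approx_eigen[of "1 - Q * Q" b x] by blast
  have "Im w = 0"
  proof (rule ccontr)
    assume "Im w \<noteq> 0"
    then have "(\<lambda>j. pact p b (x j)) \<longlonglongrightarrow> 0"
      by (intro null_of_bounded_below[OF lim, of "\<bar>Im w\<bar>"] bounded_below_nonreal[OF sa]) simp
    with nz show False ..
  qed
  then have ws: "w = of_real (Re w)" by (simp add: complex_eq_iff)
  then obtain s where s: "w = of_real s" by blast
  have "s \<in> sig b" by (rule sigI_approx_eigen[OF lim[unfolded s] nz])
  moreover have "r = cmod (of_real s * poly q (of_real s))"
  proof -
    define u where "u = of_real s * poly q (of_real s)"
    have "poly Q w = of_real ((cmod u / r)\<^sup>2)"
    proof -
      have "poly Q w = (cnj u * u) / of_real (r\<^sup>2)"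
        by (simp add: Q_def s u_def)
      also have "cnj u * u = of_real ((cmod u)\<^sup>2)"
        by (metis complex_norm_square mult.commute)
      finally show ?thesis by (simp add: power_divide)
    qed
    moreover have "poly Q w * poly Q w = 1" using w by simp
    ultimately have "complex_of_real ((cmod u / r)\<^sup>2 * (cmod u / r)\<^sup>2) = of_real 1"
      by (simp only: of_real_mult of_real_1)
    then have "((cmod u / r)\<^sup>2)\<^sup>2 = 1\<^sup>2"
      by (simp only: of_real_eq_iff power2_eq_square[of "(cmod u / r)\<^sup>2"]) simp
    then have "(cmod u / r)\<^sup>2 = 1\<^sup>2"
      by (subst (asm) power2_eq_iff_nonneg) auto
    then have "cmod u / r = 1"
      using \<open>r > 0\<close> by (subst (asm) power2_eq_iff_nonneg) auto
    then show ?thesis using \<open>r > 0\<close> by (simp add: u_def)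
  qed
  ultimately show ?thesis unfolding r_def z_def by auto
qed

lemma norm_pact_le:
  fixes b :: "'a::cstar_algebra"
  assumes "star b = b" "\<And>s. s \<in> sig b \<Longrightarrow> cmod (of_real s * poly q (of_real s)) \<le> d"
  shows "norm (pact q b b) \<le> d"
  using norm_pact_attained[OF assms(1), of q] assms(2) by auto

lemma polynomial_approximation:
  fixes f :: "real \<Rightarrow> complex"
  assumes cont: "continuous_on UNIV f" and f0: "f 0 = 0" and "e > 0"
  shows "\<exists>q. \<forall>s. \<bar>s\<bar> \<le> R \<longrightarrow> cmod (of_real s * poly q (of_real s) - f s) \<le> e"
proof -
  have "compact {-R..R}" by simp
  moreover have "continuous_on {-R..R} f" using cont continuous_on_subset by blast
  ultimately obtain g where g: "polynomial_function g" "\<And>x. x \<in> {-R..R} \<Longrightarrow> norm (f x - g x) < e / 2"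
    using Stone_Weierstrass_polynomial_function[of "{-R..R}" f "e / 2"] \<open>e > 0\<close> by auto
  have "\<exists>p. \<forall>x. h x = Re (poly p (of_real x)) \<and> Im (poly p (of_real x)) = 0"
    if h: "real_polynomial_function h" for h :: "real \<Rightarrow> real"
  proof -
    from h obtain a n where h: "h = (\<lambda>x. \<Sum>i\<le>n. a i * x ^ i)"
      unfolding real_polynomial_function_iff_sum by blast
    have *: "complex_of_real (h x) = poly (\<Sum>i\<le>n. monom (of_real (a i)) i) (of_real x)" for x
      by (simp add: h poly_sum poly_monom)
    have "h x = Re (poly (\<Sum>i\<le>n. monom (of_real (a i)) i) (of_real x)) \<and>
        Im (poly (\<Sum>i\<le>n. monom (of_real (a i)) i) (of_real x)) = 0" for x
      by (simp flip: *)
    then show ?thesis by blast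
  qed
  moreover have "real_polynomial_function (Re \<circ> g)" "real_polynomial_function (Im \<circ> g)"
    using g(1) bounded_linear_Re bounded_linear_Im by (auto simp: polynomial_function_def)
  ultimately have "\<exists>p. \<forall>x. (Re \<circ> g) x = Re (poly p (of_real x)) \<and> Im (poly p (of_real x)) = 0"
      "\<exists>p. \<forall>x. (Im \<circ> g) x = Re (poly p (of_real x)) \<and> Im (poly p (of_real x)) = 0"
    by blast+
  then obtain p1 p2 where
      p1: "\<And>x. Re (g x) = Re (poly p1 (of_real x)) \<and> Im (poly p1 (of_real x)) = 0"
    and p2: "\<And>x. Im (g x) = Re (poly p2 (of_real x)) \<and> Im (poly p2 (of_real x)) = 0"
    unfolding comp_apply by blast
  define p where "p = p1 + smult \<i> p2"
  have p: "g x = poly p (of_real x)" for x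
    using p1[of x] p2[of x] by (simp add: p_def complex_eq_iff)
  \<comment> \<open>The constant term a is the value of g at 0, hence within e/2 of f 0 = 0;
    dropping it costs no more than the approximation itself.\<close>
  obtain a q where aq: "p = pCons a q" by (cases p)
  have ap: "poly p z = a + z * poly q z" for z by (simp add: aq)
  have "cmod (of_real s * poly q (of_real s) - f s) \<le> e" if "\<bar>s\<bar> \<le> R" for s
  proof -
    have s: "s \<in> {-R..R}" "0 \<in> {-R..R}" using that by auto
    have "of_real s * poly q (of_real s) - f s = (g s - f s) - (g 0 - f 0)"
      by (simp add: p ap f0)
    also have "cmod \<dots> \<le> cmod (f s - g s) + cmod (f 0 - g 0)"
      by (metis norm_triangle_ineq4 norm_minus_commute)
    also have "\<dots> \<le> e" using g(2)[OF s(1)] g(2)[OF s(2)] by linarith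
    finally show ?thesis .
  qed
  then show ?thesis by blast
qed

section \<open>Functions of a self-adjoint element as limits of polynomials\<close>

definition approximates :: "(nat \<Rightarrow> complex poly) \<Rightarrow> 'a::cstar_algebra \<Rightarrow> (real \<Rightarrow> complex) \<Rightarrow> bool" where
  "approximates q b f \<longleftrightarrow>
     (\<exists>d. d \<longlonglongrightarrow> 0 \<and> (\<forall>n. \<forall>s\<in>sig b. cmod (of_real s * poly (q n) (of_real s) - f s) \<le> d n))"

text \<open>The element f(b), meant for continuous f with f 0 = 0. The choice is then determined,
  since two approximating sequences of polynomials differ by a null sequence in norm, and it depends
  only on the values of f on \<open>sig b\<close>.\<close>

definition cfc :: "'a::cstar_algebra \<Rightarrow> (real \<Rightarrow> complex) \<Rightarrow> 'a" where
  "cfc b f = (SOME y. \<exists>q. approximates q b f \<and> (\<lambda>n. pact (q n) b b) \<longlonglongrightarrow> y)"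

lemma approximates_unique:
  fixes b :: "'a::cstar_algebra"
  assumes sa: "star b = b" and "approximates p b f" "approximates q b f"
    and "(\<lambda>n. pact (p n) b b) \<longlonglongrightarrow> y"
  shows "(\<lambda>n. pact (q n) b b) \<longlonglongrightarrow> y"
proof -
  from assms(2,3) obtain d e where d: "d \<longlonglongrightarrow> 0" "e \<longlonglongrightarrow> 0"
    and dp: "\<And>n s. s \<in> sig b \<Longrightarrow> cmod (of_real s * poly (p n) (of_real s) - f s) \<le> d n"
    and ep: "\<And>n s. s \<in> sig b \<Longrightarrow> cmod (of_real s * poly (q n) (of_real s) - f s) \<le> e n"
    unfolding approximates_def by metis
  have "(\<lambda>n. pact (q n) b b - pact (p n) b b) \<longlonglongrightarrow> 0"
  proof (rule Lim_null_comparison)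
    show "(\<lambda>n. d n + e n) \<longlonglongrightarrow> 0" using tendsto_add[OF d] by simp
    have "norm (pact (q n) b b - pact (p n) b b) \<le> d n + e n" for n
      unfolding pact_diff[symmetric]
    proof (rule norm_pact_le[OF sa])
      fix s assume s: "s \<in> sig b"
      have "of_real s * poly (q n - p n) (of_real s) =
          (of_real s * poly (q n) (of_real s) - f s) - (of_real s * poly (p n) (of_real s) - f s)"
        by (simp add: algebra_simps)
      also have "cmod \<dots> \<le> e n + d n"
        by (rule order_trans[OF norm_triangle_ineq4]) (intro add_mono dp ep s)
      finally show "cmod (of_real s * poly (q n - p n) (of_real s)) \<le> d n + e n" by simp
    qed
    then show "\<forall>\<^sub>F n in sequentially. norm (pact (q n) b b - pact (p n) b b) \<le> d n + e n" by simp
  qed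
  from tendsto_add[OF this assms(4)] show ?thesis by simp
qed

lemma cfc_eqI:
  fixes b :: "'a::cstar_algebra"
  assumes "star b = b" "approximates q b f" "(\<lambda>n. pact (q n) b b) \<longlonglongrightarrow> y"
  shows "cfc b f = y"
  unfolding cfc_def
proof (rule some_equality)
  show "\<exists>q. approximates q b f \<and> (\<lambda>n. pact (q n) b b) \<longlonglongrightarrow> y" using assms by blast
  show "z = y" if "\<exists>q. approximates q b f \<and> (\<lambda>n. pact (q n) b b) \<longlonglongrightarrow> z" for z
    using that approximates_unique[OF assms(1)] assms(2,3) LIMSEQ_unique by blast
qed

lemma cfc_approx:
  fixes b :: "'a::cstar_algebra"
  assumes sa: "star b = b" and "continuous_on UNIV f" "f 0 = 0"
  obtains q where "approximates q b f" "(\<lambda>n. pact (q n) b b) \<longlonglongrightarrow> cfc b f"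
proof -
  have "\<forall>n. \<exists>q. \<forall>s. \<bar>s\<bar> \<le> norm b \<longrightarrow> cmod (of_real s * poly q (of_real s) - f s) \<le> 1 / real (Suc n)"
    by (intro allI polynomial_approximation assms) simp
  then obtain q where q: "\<And>n s. \<bar>s\<bar> \<le> norm b \<Longrightarrow> cmod (of_real s * poly (q n) (of_real s) - f s) \<le> 1 / real (Suc n)"
    by metis
  have ap: "approximates q b f"
    unfolding approximates_def using q sig_norm LIMSEQ_Suc[OF lim_1_over_n]
    by (intro exI[of _ "\<lambda>n. 1 / real (Suc n)"]) auto
  have "Cauchy (\<lambda>n. pact (q n) b b)"
  proof (rule metric_CauchyI)
    fix e :: real assume "e > 0"
    then obtain N where N: "1 / real (Suc N) < e / 2" using nat_approx_posE[of "e / 2"] by auto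
    have "dist (pact (q m) b b) (pact (q n) b b) < e" if mn: "m \<ge> N" "n \<ge> N" for m n
    proof -
      have le: "1 / real (Suc k) \<le> 1 / real (Suc N)" if "k \<ge> N" for k
        using that by (simp add: frac_le)
      have "norm (pact (q m - q n) b b) \<le> 1 / real (Suc N) + 1 / real (Suc N)"
      proof (rule norm_pact_le[OF sa])
        fix s assume s: "s \<in> sig b"
        have "of_real s * poly (q m - q n) (of_real s) =
            (of_real s * poly (q m) (of_real s) - f s) - (of_real s * poly (q n) (of_real s) - f s)"
          by (simp add: algebra_simps)
        also have "cmod \<dots> \<le> 1 / real (Suc N) + 1 / real (Suc N)"
          by (rule order_trans[OF norm_triangle_ineq4])
            (intro add_mono order_trans[OF q le] sig_norm s mn)
        finally show "cmod (of_real s * poly (q m - q n) (of_real s)) \<le> 1 / real (Suc N) + 1 / real (Suc N)" .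
      qed
      then show ?thesis using N by (simp add: dist_norm pact_diff)
    qed
    then show "\<exists>M. \<forall>m\<ge>M. \<forall>n\<ge>M. dist (pact (q m) b b) (pact (q n) b b) < e" by blast
  qed
  then obtain y where "(\<lambda>n. pact (q n) b b) \<longlonglongrightarrow> y"
    using Cauchy_convergent_iff convergent_def by blast
  then show thesis using that cfc_eqI[OF sa ap] ap by blast
qed

lemma approximates_pointwise:
  assumes "approximates q b f" "s \<in> sig b"
  shows "(\<lambda>n. of_real s * poly (q n) (of_real s)) \<longlonglongrightarrow> f s"
proof -
  obtain d where d: "d \<longlonglongrightarrow> 0" "\<And>n. cmod (of_real s * poly (q n) (of_real s) - f s) \<le> d n"
    using assms unfolding approximates_def by blast
  have "(\<lambda>n. of_real s * poly (q n) (of_real s) - f s) \<longlonglongrightarrow> 0"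
    by (rule Lim_null_comparison[OF _ d(1)]) (use d(2) in simp)
  then show ?thesis by (simp add: LIM_zero_iff)
qed

context
  fixes b :: "'a::cstar_algebra"
  assumes sa: "star b = b"
begin

lemma cfc_poly: "cfc b (\<lambda>s. of_real s * poly q (of_real s)) = pact q b b"
  by (rule cfc_eqI[OF sa, of "\<lambda>_. q"]) (auto simp: approximates_def)

lemma cfc_id: "cfc b of_real = b"
  using cfc_poly[of 1] by simp

lemma cfc_cong:
  assumes "\<And>s. s \<in> sig b \<Longrightarrow> f s = g s"
  shows "cfc b f = cfc b g"
proof -
  have "approximates q b f \<longleftrightarrow> approximates q b g" for q
    using assms by (simp add: approximates_def)
  then show ?thesis by (simp add: cfc_def)
qed

lemma norm_cfc_le:
  assumes f: "continuous_on UNIV f" "f 0 = 0" and le: "\<And>s. s \<in> sig b \<Longrightarrow> cmod (f s) \<le> k"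
  shows "norm (cfc b f) \<le> k"
proof -
  obtain q where q: "approximates q b f" "(\<lambda>n. pact (q n) b b) \<longlonglongrightarrow> cfc b f"
    using cfc_approx[OF sa f] .
  obtain d where d: "d \<longlonglongrightarrow> 0" "\<And>n s. s \<in> sig b \<Longrightarrow> cmod (of_real s * poly (q n) (of_real s) - f s) \<le> d n"
    using q(1) unfolding approximates_def by blast
  have "norm (pact (q n) b b) \<le> k + d n" for n
  proof (rule norm_pact_le[OF sa])
    fix s assume s: "s \<in> sig b"
    show "cmod (of_real s * poly (q n) (of_real s)) \<le> k + d n"
      using norm_triangle_sub[of "of_real s * poly (q n) (of_real s)" "f s"] d(2)[OF s, of n] le[OF s]
      by linarith
  qed
  then have "norm (cfc b f) \<le> k + 0"
    by (intro LIMSEQ_le[OF tendsto_norm[OF q(2)] tendsto_add[OF tendsto_const d(1)]]) auto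
  then show ?thesis by simp
qed

lemma cfc_norm_ge:
  assumes f: "continuous_on UNIV f" "f 0 = 0" and s: "s \<in> sig b"
  shows "cmod (f s) \<le> norm (cfc b f)"
proof -
  obtain q where q: "approximates q b f" "(\<lambda>n. pact (q n) b b) \<longlonglongrightarrow> cfc b f"
    using cfc_approx[OF sa f] .
  show ?thesis
    by (rule LIMSEQ_le[OF tendsto_norm[OF approximates_pointwise[OF q(1) s]] tendsto_norm[OF q(2)]])
      (use s in \<open>auto simp: sig_def\<close>)
qed

lemma cfc_add:
  assumes f: "continuous_on UNIV f" "f 0 = 0" and g: "continuous_on UNIV g" "g 0 = 0"
  shows "cfc b (\<lambda>s. f s + g s) = cfc b f + cfc b g"
proof -
  obtain p where p: "approximates p b f" "(\<lambda>n. pact (p n) b b) \<longlonglongrightarrow> cfc b f"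
    using cfc_approx[OF sa f] .
  obtain q where q: "approximates q b g" "(\<lambda>n. pact (q n) b b) \<longlonglongrightarrow> cfc b g"
    using cfc_approx[OF sa g] .
  obtain d e where d: "d \<longlonglongrightarrow> 0" "e \<longlonglongrightarrow> 0"
    and dp: "\<And>n s. s \<in> sig b \<Longrightarrow> cmod (of_real s * poly (p n) (of_real s) - f s) \<le> d n"
    and ep: "\<And>n s. s \<in> sig b \<Longrightarrow> cmod (of_real s * poly (q n) (of_real s) - g s) \<le> e n"
    using p(1) q(1) unfolding approximates_def by metis
  have "approximates (\<lambda>n. p n + q n) b (\<lambda>s. f s + g s)"
    unfolding approximates_def
  proof (intro exI[of _ "\<lambda>n. d n + e n"] conjI allI ballI)
    show "(\<lambda>n. d n + e n) \<longlonglongrightarrow> 0" using tendsto_add[OF d] by simp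
    fix n s assume s: "s \<in> sig b"
    have "of_real s * poly (p n + q n) (of_real s) - (f s + g s) =
        (of_real s * poly (p n) (of_real s) - f s) + (of_real s * poly (q n) (of_real s) - g s)"
      by (simp add: algebra_simps)
    also have "cmod \<dots> \<le> d n + e n"
      by (rule order_trans[OF norm_triangle_ineq]) (intro add_mono dp ep s)
    finally show "cmod (of_real s * poly (p n + q n) (of_real s) - (f s + g s)) \<le> d n + e n" .
  qed
  then show ?thesis
    by (rule cfc_eqI[OF sa]) (simp add: pact_add tendsto_add p q)
qed

lemma cfc_mult:
  assumes f: "continuous_on UNIV f" "f 0 = 0" and g: "continuous_on UNIV g" "g 0 = 0"
  shows "cfc b (\<lambda>s. f s * g s) = cfc b f * cfc b g"
proof -
  obtain p where p: "approximates p b f" "(\<lambda>n. pact (p n) b b) \<longlonglongrightarrow> cfc b f"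
    using cfc_approx[OF sa f] .
  obtain q where q: "approximates q b g" "(\<lambda>n. pact (q n) b b) \<longlonglongrightarrow> cfc b g"
    using cfc_approx[OF sa g] .
  obtain d e where d: "d \<longlonglongrightarrow> 0" "e \<longlonglongrightarrow> 0"
    and dp: "\<And>n s. s \<in> sig b \<Longrightarrow> cmod (of_real s * poly (p n) (of_real s) - f s) \<le> d n"
    and ep: "\<And>n s. s \<in> sig b \<Longrightarrow> cmod (of_real s * poly (q n) (of_real s) - g s) \<le> e n"
    using p(1) q(1) unfolding approximates_def by metis
  let ?K = "\<lambda>n. d n * norm (pact (q n) b b) + norm (cfc b f) * e n"
  \<comment> \<open>The middle factor arises because the elements stand for \<open>s p(s)\<close>
    and \<open>s q(s)\<close>, whose product is s times the value of p X q at s.\<close>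
  have "approximates (\<lambda>n. p n * [:0, 1:] * q n) b (\<lambda>s. f s * g s)"
    unfolding approximates_def
  proof (intro exI[of _ ?K] conjI allI ballI)
    have "?K \<longlonglongrightarrow> 0 * norm (cfc b g) + norm (cfc b f) * 0"
      by (intro tendsto_intros d q)
    then show "?K \<longlonglongrightarrow> 0" by simp
    fix n s assume s: "s \<in> sig b"
    have d0: "0 \<le> d n" using dp[OF s, of n] norm_ge_zero order_trans by blast
    have sq: "cmod (of_real s * poly (q n) (of_real s)) \<le> norm (pact (q n) b b)"
      using s unfolding sig_def by blast
    have "of_real s * poly (p n * [:0, 1:] * q n) (of_real s) - f s * g s =
        (of_real s * poly (p n) (of_real s) - f s) * (of_real s * poly (q n) (of_real s))
        + f s * (of_real s * poly (q n) (of_real s) - g s)"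
      by (simp add: algebra_simps)
    also have "cmod \<dots> \<le> ?K n"
      by (intro norm_triangle_le add_mono norm_mult[THEN eq_refl, THEN order_trans] mult_mono dp ep
          cfc_norm_ge f s sq d0 norm_ge_zero)
    finally show "cmod (of_real s * poly (p n * [:0, 1:] * q n) (of_real s) - f s * g s) \<le> ?K n" .
  qed
  moreover have "(\<lambda>n. pact (p n * [:0, 1:] * q n) b b) \<longlonglongrightarrow> cfc b f * cfc b g"
    using tendsto_mult[OF p(2) q(2)]
    by (simp only: pact_mult pact_X pact_pact_mult)
  ultimately show ?thesis by (rule cfc_eqI[OF sa])
qed

lemma cfc_scaleC:
  assumes f: "continuous_on UNIV f" "f 0 = 0"
  shows "cfc b (\<lambda>s. c * f s) = c *\<^sub>C cfc b f"
proof -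
  obtain p where p: "approximates p b f" "(\<lambda>n. pact (p n) b b) \<longlonglongrightarrow> cfc b f"
    using cfc_approx[OF sa f] .
  obtain d where d: "d \<longlonglongrightarrow> 0"
    and dp: "\<And>n s. s \<in> sig b \<Longrightarrow> cmod (of_real s * poly (p n) (of_real s) - f s) \<le> d n"
    using p(1) unfolding approximates_def by metis
  have "approximates (\<lambda>n. smult c (p n)) b (\<lambda>s. c * f s)"
    unfolding approximates_def
  proof (intro exI[of _ "\<lambda>n. cmod c * d n"] conjI allI ballI)
    show "(\<lambda>n. cmod c * d n) \<longlonglongrightarrow> 0" using tendsto_mult_left[OF d, of "cmod c"] by simp
    fix n s assume s: "s \<in> sig b"
    have "of_real s * poly (smult c (p n)) (of_real s) - c * f s = c * (of_real s * poly (p n) (of_real s) - f s)"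
      by (simp add: algebra_simps)
    then show "cmod (of_real s * poly (smult c (p n)) (of_real s) - c * f s) \<le> cmod c * d n"
      using dp[OF s, of n] by (simp add: norm_mult mult_left_mono)
  qed
  then show ?thesis
    by (rule cfc_eqI[OF sa]) (simp add: pact_smult tendsto_scaleC p)
qed

lemma cfc_star:
  assumes f: "continuous_on UNIV f" "f 0 = 0"
  shows "cfc b (\<lambda>s. cnj (f s)) = star (cfc b f)"
proof -
  obtain p where p: "approximates p b f" "(\<lambda>n. pact (p n) b b) \<longlonglongrightarrow> cfc b f"
    using cfc_approx[OF sa f] .
  have "cmod (of_real s * poly (map_poly cnj (p n)) (of_real s) - cnj (f s))
      = cmod (of_real s * poly (p n) (of_real s) - f s)" for n s
  proof -
    have "of_real s * poly (map_poly cnj (p n)) (of_real s) - cnj (f s)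
        = cnj (of_real s * poly (p n) (of_real s) - f s)" by simp
    then show ?thesis by (simp only: complex_mod_cnj)
  qed
  then have "approximates (\<lambda>n. map_poly cnj (p n)) b (\<lambda>s. cnj (f s))"
    using p(1) by (simp add: approximates_def)
  then show ?thesis
    by (rule cfc_eqI[OF sa]) (simp add: pact_star[OF sa sa refl, symmetric] tendsto_star p)
qed

lemma cfc_diff:
  assumes f: "continuous_on UNIV f" "f 0 = 0" and g: "continuous_on UNIV g" "g 0 = 0"
  shows "cfc b (\<lambda>s. f s - g s) = cfc b f - cfc b g"
proof -
  have "cfc b (\<lambda>s. (-1) * g s) = (-1) *\<^sub>C cfc b g" by (rule cfc_scaleC[OF g])
  moreover have "cfc b (\<lambda>s. f s + (-1) * g s) = cfc b f + cfc b (\<lambda>s. (-1) * g s)"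
    by (rule cfc_add[OF f]) (use g in \<open>auto intro!: continuous_intros\<close>)
  ultimately show ?thesis by (simp add: scaleC.minus_left)
qed

lemma cfc_eigen:
  assumes f: "continuous_on UNIV f" "f 0 = 0" and x: "b * x = of_real s *\<^sub>C x"
  shows "cfc b f * x = f s *\<^sub>C x"
proof (cases "x = 0")
  case False
  have s: "s \<in> sig b"
    using x False by (intro sigI_approx_eigen[of b "\<lambda>_. x"]) (auto simp: LIMSEQ_const_iff)
  obtain q where q: "approximates q b f" "(\<lambda>n. pact (q n) b b) \<longlonglongrightarrow> cfc b f"
    using cfc_approx[OF sa f] .
  have "pact (q n) b b * x = (of_real s * poly (q n) (of_real s)) *\<^sub>C x" for n
    by (simp add: pact_mult_right[symmetric] x pact_scaleC_right pact_eigen[OF x] scaleC_simps)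
  moreover have "(\<lambda>n. (of_real s * poly (q n) (of_real s)) *\<^sub>C x) \<longlonglongrightarrow> f s *\<^sub>C x"
    by (rule tendsto_scaleC[OF approximates_pointwise[OF q(1) s] tendsto_const])
  moreover have "(\<lambda>n. pact (q n) b b * x) \<longlonglongrightarrow> cfc b f * x"
    by (intro tendsto_intros q)
  ultimately show ?thesis using LIMSEQ_unique by simp
qed simp

lemma cfc_closed_property:
  assumes f: "continuous_on UNIV f" "f 0 = 0"
    and "closed S" "\<And>q. pact q b b \<in> S"
  shows "cfc b f \<in> S"
  using cfc_approx[OF sa f] assms(3,4) by (metis closed_sequentially)

text \<open>A tent function of height 1 and half-width d around s: f(b) itself serves as the
  approximate eigenvector, having norm 1 because s lies in \<open>sig b\<close>. A wide tent may
  cover 0, where f(b) would need a unit, hence the condition on \<open>f 0\<close>.\<close>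

lemma approx_eigenvectors:
  assumes s: "s \<in> sig b" "s \<noteq> 0" and "d > 0"
  shows "\<exists>f. continuous_on UNIV f \<and> (\<forall>u. \<bar>u - s\<bar> \<ge> d \<longrightarrow> f u = 0) \<and> (\<forall>u. cnj (f u) = f u) \<and>
    (f 0 = 0 \<longrightarrow> norm (cfc b f) = 1 \<and> norm (b * cfc b f - of_real s *\<^sub>C cfc b f) \<le> d)"
proof -
  define f where "f u = complex_of_real (max 0 (1 - \<bar>u - s\<bar> / d))" for u
  have cont: "continuous_on UNIV f"
    unfolding f_def using \<open>d > 0\<close> by (intro continuous_intros) auto
  have le: "cmod (f u) \<le> 1" for u
    using \<open>d > 0\<close> by (simp add: f_def)
  have z: "f u = 0" if "\<bar>u - s\<bar> \<ge> d" for u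
    using that \<open>d > 0\<close> by (simp add: f_def field_simps)
  have fs: "f s = 1" by (simp add: f_def)
  have "norm (cfc b f) = 1 \<and> norm (b * cfc b f - of_real s *\<^sub>C cfc b f) \<le> d" if f0: "f 0 = 0"
  proof
    show "norm (cfc b f) = 1"
      using norm_cfc_le[OF cont f0 le] cfc_norm_ge[OF cont f0 s(1)] fs by simp
    have "b * cfc b f - of_real s *\<^sub>C cfc b f = cfc b (\<lambda>u. of_real u * f u - of_real s * f u)"
      using cont f0
      by (subst cfc_diff) (auto intro!: continuous_intros simp: cfc_mult cfc_scaleC cfc_id)
    also have "norm \<dots> \<le> d"
    proof (rule norm_cfc_le)
      show "cmod (of_real u * f u - of_real s * f u) \<le> d" for u
      proof (cases "\<bar>u - s\<bar> \<ge> d")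
        case False
        have "of_real u * f u - of_real s * f u = of_real (u - s) * f u" by (simp add: algebra_simps)
        then have "cmod (of_real u * f u - of_real s * f u) = \<bar>u - s\<bar> * cmod (f u)"
          by (simp only: norm_mult norm_of_real)
        also have "\<dots> \<le> d * 1" using False by (intro mult_mono le) auto
        finally show ?thesis by simp
      qed (use z \<open>d > 0\<close> in simp)
    qed (use f0 in \<open>auto intro!: continuous_intros cont\<close>)
    finally show "norm (b * cfc b f - of_real s *\<^sub>C cfc b f) \<le> d" .
  qed
  then show ?thesis using cont z by (intro exI[of _ f]) (auto simp: f_def)
qed

end

section \<open>Spectra, positive elements and square roots\<close>

lemma cstar_subalgebraD:
  assumes "cstar_subalgebra A"
  shows "closed A" "0 \<in> A" "x \<in> A \<Longrightarrow> y \<in> A \<Longrightarrow> x + y \<in> A"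
    "x \<in> A \<Longrightarrow> y \<in> A \<Longrightarrow> x * y \<in> A" "x \<in> A \<Longrightarrow> c *\<^sub>C x \<in> A" "x \<in> A \<Longrightarrow> star x \<in> A"
  using assms by (auto simp: cstar_subalgebra_def)

lemma cstar_subalgebra_diff:
  assumes "cstar_subalgebra A" "x \<in> A" "y \<in> A"
  shows "x - y \<in> A"
proof -
  have "x + (-1) *\<^sub>C y \<in> A" using assms by (intro cstar_subalgebraD) auto
  then show ?thesis by (simp add: scaleC_simps)
qed

lemma cstar_subalgebra_pact:
  assumes "cstar_subalgebra A" "b \<in> A" "y \<in> A"
  shows "pact q b y \<in> A"
  by (induction q) (use assms in \<open>auto simp: pact_pCons intro: cstar_subalgebraD\<close>)

lemma cfc_mem:
  assumes "cstar_subalgebra A" "b \<in> A" "star b = b" "continuous_on UNIV f" "f 0 = 0"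
  shows "cfc b f \<in> A"
  using assms by (intro cfc_closed_property cstar_subalgebra_pact) (auto dest: cstar_subalgebraD)

lemma bump_sequence:
  fixes b :: "'a::cstar_algebra"
  assumes sa: "star b = b" and s: "s \<in> sig b" "s \<noteq> 0" and "e > 0"
  obtains f :: "nat \<Rightarrow> real \<Rightarrow> complex" where
    "\<And>j. continuous_on UNIV (f j)" "\<And>j. f j 0 = 0" "\<And>j u. \<bar>u - s\<bar> \<ge> e \<Longrightarrow> f j u = 0"
    "\<And>j. star (cfc b (f j)) = cfc b (f j)" "\<And>j. norm (cfc b (f j)) = 1"
    "(\<lambda>j. b * cfc b (f j) - of_real s *\<^sub>C cfc b (f j)) \<longlonglongrightarrow> 0"
proof -
  \<comment> \<open>The bound by \<open>\<bar>s\<bar>\<close> forces the tents to vanish at 0, the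
    bound by e confines their supports, and 1/(j+1) makes them concentrate at s.\<close>
  define d where "d j = min e (min \<bar>s\<bar> (1 / real (Suc j)))" for j
  have d: "d j > 0" "d j \<le> e" "d j \<le> \<bar>s\<bar>" "d j \<le> 1 / real (Suc j)" for j
    using s \<open>e > 0\<close> by (auto simp: d_def)
  have "\<forall>j. \<exists>f. continuous_on UNIV f \<and> (\<forall>u. \<bar>u - s\<bar> \<ge> d j \<longrightarrow> f u = 0) \<and> (\<forall>u. cnj (f u) = f u) \<and>
    (f 0 = 0 \<longrightarrow> norm (cfc b f) = 1 \<and> norm (b * cfc b f - of_real s *\<^sub>C cfc b f) \<le> d j)"
    by (intro allI approx_eigenvectors sa s d)
  then obtain f where f: "\<And>j. continuous_on UNIV (f j)" "\<And>j u. \<bar>u - s\<bar> \<ge> d j \<Longrightarrow> f j u = 0"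
      "\<And>j u. cnj (f j u) = f j u"
    and f': "\<And>j. f j 0 = 0 \<Longrightarrow> norm (cfc b (f j)) = 1 \<and>
        norm (b * cfc b (f j) - of_real s *\<^sub>C cfc b (f j)) \<le> d j"
    by metis
  have f0: "f j 0 = 0" for j using f(2)[of j 0] d(3)[of j] by simp
  show thesis
  proof (rule that[of f])
    show "f j u = 0" if "\<bar>u - s\<bar> \<ge> e" for j u using f(2)[of j u] d(2)[of j] that by simp
    show "star (cfc b (f j)) = cfc b (f j)" for j
      using cfc_star[OF sa f(1) f0, of j] by (simp add: f(3))
    show "(\<lambda>j. b * cfc b (f j) - of_real s *\<^sub>C cfc b (f j)) \<longlonglongrightarrow> 0"
    proof (rule Lim_null_comparison[OF _ LIMSEQ_Suc[OF lim_1_over_n]])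
      have "norm (b * cfc b (f j) - of_real s *\<^sub>C cfc b (f j)) \<le> 1 / real (Suc j)" for j
        using f'[OF f0, of j] d(4)[of j] by linarith
      then show "\<forall>\<^sub>F j in sequentially. norm (b * cfc b (f j) - of_real s *\<^sub>C cfc b (f j)) \<le> 1 / real (Suc j)"
        by (simp only: eventually_sequentially) blast
    qed
  qed (use f f0 f' in auto)
qed

section \<open>Spectrum and \<open>sig\<close> agree away from 0\<close>

text \<open>The equation says that \<open>y - 1/z\<close> inverts \<open>c - z\<close>. It is
  written without a unit so that one y serves both for a unital algebra and for the
  unitization.\<close>

lemma not_in_spectrumI:
  fixes c y :: "'a::cstar_algebra"
  assumes A: "cstar_subalgebra A" and c: "c \<in> A" and y: "y \<in> A" and z: "z \<noteq> 0"
    and eq: "c * y = (1 / z) *\<^sub>C c + z *\<^sub>C y" and comm: "y * c = c * y"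
  shows "z \<notin> spectrum A c"
proof (cases "\<exists>e. unit_of A e")
  case True
  have "\<exists>b\<in>A. (c - z *\<^sub>C e) * b = e \<and> b * (c - z *\<^sub>C e) = e" if e: "unit_of A e" for e
  proof (intro bexI conjI)
    show "y - (1 / z) *\<^sub>C e \<in> A"
      using e A y by (auto simp: unit_of_def intro!: cstar_subalgebra_diff cstar_subalgebraD)
    have *: "e * c = c" "c * e = c" "e * y = y" "y * e = y" "e * e = e"
      using e c y by (auto simp: unit_of_def)
    show "(c - z *\<^sub>C e) * (y - (1 / z) *\<^sub>C e) = e" "(y - (1 / z) *\<^sub>C e) * (c - z *\<^sub>C e) = e"
      using z by (simp_all add: left_diff_distrib right_diff_distrib mult_scaleC_left mult_scaleC_right
          * eq comm scaleC_scaleC scaleC.diff_right)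
  qed
  then show ?thesis using True by (auto simp: spectrum_def)
next
  case False
  have "unitization_mult (c, - z) (y, - (1 / z)) = (0, 1)" "unitization_mult (y, - (1 / z)) (c, - z) = (0, 1)"
    using z by (simp_all add: unitization_mult_def eq comm scaleC_simps)
  then show ?thesis using False y by (auto simp: spectrum_def)
qed

lemma in_spectrumI:
  fixes c :: "'a::cstar_algebra" and x :: "nat \<Rightarrow> 'a"
  assumes z: "z \<noteq> 0" and x: "\<And>j. x j \<in> A" "\<And>j. norm (x j) = 1"
    and lim: "(\<lambda>j. c * x j - z *\<^sub>C x j) \<longlonglongrightarrow> 0"
  shows "z \<in> spectrum A c"
proof (rule ccontr)
  assume nz: "z \<notin> spectrum A c"
  have "x \<longlonglongrightarrow> 0"
  proof (cases "\<exists>e. unit_of A e")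
    case True
    then obtain e where e: "unit_of A e" by blast
    then obtain b where b: "b * (c - z *\<^sub>C e) = e"
      using nz True by (auto simp: spectrum_def)
    have ex: "e * x j = x j" for j using e x by (auto simp: unit_of_def)
    have "b * (c * x j - z *\<^sub>C x j) = x j" for j
    proof -
      have "b * (c - z *\<^sub>C e) * x j = b * (c * x j - z *\<^sub>C x j)"
        by (simp add: mult.assoc left_diff_distrib mult_scaleC_left ex)
      then show ?thesis by (simp add: b ex)
    qed
    moreover have "(\<lambda>j. b * (c * x j - z *\<^sub>C x j)) \<longlonglongrightarrow> b * 0"
      by (intro tendsto_intros lim)
    ultimately show ?thesis by simp
  next
    case False
    then obtain y w where "unitization_mult (y, w) (c, - z) = (0, 1)"
      using nz by (auto simp: spectrum_def)
    then have yw: "y * c + w *\<^sub>C c - z *\<^sub>C y = 0" "- (w * z) = 1"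
      by (auto simp: unitization_mult_def scaleC_simps)
    have "y * (c * x j - z *\<^sub>C x j) + w *\<^sub>C (c * x j - z *\<^sub>C x j) = x j" for j
    proof -
      have "y * (c * x j - z *\<^sub>C x j) + w *\<^sub>C (c * x j - z *\<^sub>C x j)
          = (y * c + w *\<^sub>C c - z *\<^sub>C y) * x j + (- (w * z)) *\<^sub>C x j"
        by (simp add: left_diff_distrib right_diff_distrib distrib_right mult.assoc
            scaleC.minus_left scaleC.diff_right scaleC_scaleC mult_scaleC_left mult_scaleC_right)
      then show ?thesis by (simp add: yw)
    qed
    moreover have "(\<lambda>j. y * (c * x j - z *\<^sub>C x j) + w *\<^sub>C (c * x j - z *\<^sub>C x j)) \<longlonglongrightarrow> y * 0 + w *\<^sub>C 0"
      by (intro tendsto_intros tendsto_scaleC lim)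
    ultimately show ?thesis by simp
  qed
  from tendsto_norm[OF this] x(2) show False by (simp add: LIMSEQ_const_iff)
qed

text \<open>Since \<open>sig c\<close> does not mention A, this contains the independence of the
  spectrum from the surrounding subalgebra. Points of \<open>sig c\<close> have approximate
  eigenvectors; at other points the resolvent is a function of c.\<close>

lemma spectrum_nonzero_iff:
  fixes c :: "'a::cstar_algebra"
  assumes A: "cstar_subalgebra A" "c \<in> A" and sa: "star c = c" and z: "z \<noteq> 0"
  shows "z \<in> spectrum A c \<longleftrightarrow> z \<in> complex_of_real ` sig c"
proof
  assume "z \<in> complex_of_real ` sig c"
  then obtain s where s: "s \<in> sig c" "z = of_real s" by blast
  then have "s \<noteq> 0" using z by auto
  obtain f where f: "\<And>j. continuous_on UNIV (f j)" "\<And>j. f j 0 = 0" "\<And>j u. \<bar>u - s\<bar> \<ge> 1 \<Longrightarrow> f j u = 0"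
    "\<And>j. star (cfc c (f j)) = cfc c (f j)" "\<And>j. norm (cfc c (f j)) = 1"
    "(\<lambda>j. c * cfc c (f j) - of_real s *\<^sub>C cfc c (f j)) \<longlonglongrightarrow> 0"
    by (rule bump_sequence[OF sa s(1) \<open>s \<noteq> 0\<close> less_numeral_extra(1)]) (rule that; assumption)
  show "z \<in> spectrum A c"
    by (rule in_spectrumI[of z "\<lambda>j. cfc c (f j)"]) (use z s f cfc_mem[OF A sa] in auto)
next
  assume spec: "z \<in> spectrum A c"
  show "z \<in> complex_of_real ` sig c"
  proof (rule ccontr)
    assume nz: "z \<notin> complex_of_real ` sig c"
    have "bounded (sig c)"
      unfolding bounded_iff using sig_norm by (auto intro!: exI[of _ "norm c"])
    then have "compact (complex_of_real ` sig c)"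
      by (intro compact_continuous_image continuous_intros) (auto simp: compact_eq_bounded_closed closed_sig)
    then obtain d where d: "d > 0" "\<And>s. s \<in> sig c \<Longrightarrow> d \<le> cmod (of_real s - z)"
      using separate_point_closed[OF compact_imp_closed nz] by (auto simp: dist_norm norm_minus_commute)
    \<comment> \<open>The function g is \<open>s / (z (s - z))\<close> on \<open>sig c\<close>, the
      solution of \<open>s g = s / z + z g\<close>. Bounding the denominator below by d^2 makes it
      continuous on the whole line without changing it on \<open>sig c\<close>.\<close>
    define m where "m s = max (d\<^sup>2) ((cmod (of_real s - z))\<^sup>2)" for s
    define g where "g s = of_real s * cnj (of_real s - z) / (z * of_real (m s))" for s
    have m: "m s > 0" for s using d(1) by (simp add: m_def less_max_iff_disj)
    then have "m s \<noteq> 0" for s by (metis less_irrefl)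
    then have cont: "continuous_on UNIV g"
      unfolding g_def m_def using z by (intro continuous_intros) auto
    have g0: "g 0 = 0" by (simp add: g_def)
    have gs: "of_real s * g s = (1 / z) * of_real s + z * g s" if s: "s \<in> sig c" for s
    proof -
      have "m s = (cmod (of_real s - z))\<^sup>2"
        using d(2)[OF s] d(1) by (auto simp: m_def intro!: max_absorb2 power_mono)
      then have "of_real (m s) = (of_real s - z) * cnj (of_real s - z)"
        by (simp only: complex_norm_square)
      moreover have "of_real s - z \<noteq> 0" using nz s by auto
      ultimately have "g s = of_real s / (z * (of_real s - z))"
        by (simp add: g_def del: complex_cnj_diff)
      then show ?thesis using z \<open>of_real s - z \<noteq> 0\<close> by (simp add: field_simps)
    qed
    have "c * cfc c g = cfc c (\<lambda>s. of_real s * g s)"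
      using cont g0 by (subst cfc_mult[OF sa]) (auto intro!: continuous_intros simp: cfc_id sa)
    also have "\<dots> = cfc c (\<lambda>s. (1 / z) * of_real s + z * g s)"
      by (rule cfc_cong[OF sa]) (rule gs)
    also have "\<dots> = (1 / z) *\<^sub>C c + z *\<^sub>C cfc c g"
      using cont g0 by (simp only: cfc_add[OF sa] cfc_scaleC[OF sa] cfc_id[OF sa] continuous_intros
          continuous_on_mult_left continuous_on_of_real_id mult_zero_right of_real_0)
    finally have 1: "c * cfc c g = (1 / z) *\<^sub>C c + z *\<^sub>C cfc c g" .
    have 2: "cfc c g * c = c * cfc c g"
    proof -
      have "cfc c (\<lambda>s. g s * of_real s) = cfc c (\<lambda>s. of_real s * g s)" by (simp add: mult.commute)
      then show ?thesis
        using cont g0 by (simp add: cfc_mult[OF sa] cfc_id[OF sa] continuous_intros)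
    qed
    from not_in_spectrumI[OF A cfc_mem[OF A sa cont g0] z 1 2] spec show False by simp
  qed
qed

lemma positive_iff:
  fixes c :: "'a::cstar_algebra"
  assumes A: "cstar_subalgebra A"
  shows "positive A c \<longleftrightarrow> c \<in> A \<and> star c = c \<and> sig c \<subseteq> {0..}"
proof (intro iffI conjI)
  assume p: "positive A c"
  then show c: "c \<in> A" "star c = c" by (auto simp: positive_def)
  show "sig c \<subseteq> {0..}"
  proof
    fix s assume s: "s \<in> sig c"
    show "s \<in> {0..}"
    proof (cases "s = 0")
      case False
      then have "of_real s \<in> spectrum A c"
        using spectrum_nonzero_iff[OF A c, of "of_real s"] s by auto
      then show ?thesis using p by (auto simp: positive_def)
    qed simp
  qed
next
  assume c: "c \<in> A \<and> star c = c \<and> sig c \<subseteq> {0..}"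
  have "z \<in> complex_of_real ` {0..}" if "z \<in> spectrum A c" for z
  proof (cases "z = 0")
    case True
    then show ?thesis by (auto intro: image_eqI[of _ _ 0])
  next
    case False
    then show ?thesis using spectrum_nonzero_iff[OF A, of c z] c that by auto
  qed
  then show "positive A c" using c by (auto simp: positive_def)
qed

section \<open>Square roots of positive elements\<close>

lemma pact_square: "pact (q \<circ>\<^sub>p [:0, 0, 1:]) c y = pact q (c * c) y"
  by (induction q) (auto simp: pact_pCons pcompose_pCons pact_add pact_mult mult.assoc simp flip: one_pCons)

lemma sig_squareI:
  fixes c :: "'a::cstar_algebra"
  assumes sa: "star c = c" and s: "s \<in> sig c"
  shows "s\<^sup>2 \<in> sig (c * c)"
proof -
  have "cmod (of_real (s\<^sup>2) * poly q (of_real (s\<^sup>2))) \<le> norm (pact q (c * c) (c * c))" for q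
  proof -
    have "cmod (of_real s * poly ([:0, 1:] * (q \<circ>\<^sub>p [:0, 0, 1:])) (of_real s))
        \<le> norm (pact ([:0, 1:] * (q \<circ>\<^sub>p [:0, 0, 1:])) c c)"
      using s unfolding sig_def by blast
    moreover have "pact ([:0, 1:] * (q \<circ>\<^sub>p [:0, 0, 1:])) c c = pact q (c * c) (c * c)"
      by (simp only: pact_mult pact_X pact_square) (metis pact_commute mult.assoc)
    ultimately show ?thesis by (simp add: poly_pcompose power2_eq_square mult.assoc)
  qed
  then show ?thesis by (simp add: sig_def)
qed

text \<open>For s \<ge> 0 the square root of s^2 is s, so polynomials approximating the square root
  on \<open>sig (c * c)\<close> give, at c^2, approximations of c itself. Thus c is determined by
  c^2, and whatever commutes with c^2 commutes with c.\<close>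

lemma sqrt_limit:
  fixes c :: "'a::cstar_algebra"
  assumes sa: "star c = c" and pos: "sig c \<subseteq> {0..}"
    and p: "approximates p (c * c) (\<lambda>u. of_real (sqrt \<bar>u\<bar>))"
  shows "(\<lambda>n. pact (p n) (c * c) (c * c)) \<longlonglongrightarrow> c"
proof -
  define P where "P n = [:0, 1:] * (p n \<circ>\<^sub>p [:0, 0, 1:])" for n
  obtain d where d: "d \<longlonglongrightarrow> 0"
      "\<And>n u. u \<in> sig (c * c) \<Longrightarrow> cmod (of_real u * poly (p n) (of_real u) - of_real (sqrt \<bar>u\<bar>)) \<le> d n"
    using p unfolding approximates_def by blast
  have "approximates P c of_real"
    unfolding approximates_def
  proof (intro exI[of _ d] conjI allI ballI)
    fix n s assume s: "s \<in> sig c"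
    then have "s \<ge> 0" using pos by auto
    then show "cmod (of_real s * poly (P n) (of_real s) - of_real s) \<le> d n"
      using d(2)[OF sig_squareI[OF sa s], of n]
      by (simp add: P_def poly_pcompose power2_eq_square mult.assoc)
  qed (rule d)
  moreover have "approximates (\<lambda>_. 1) c of_real"
    by (auto simp: approximates_def)
  ultimately have "(\<lambda>n. pact (P n) c c) \<longlonglongrightarrow> c"
    using approximates_unique[OF sa, of "\<lambda>_. 1" _ P] by simp
  moreover have "pact (P n) c c = pact (p n) (c * c) (c * c)" for n
    unfolding P_def by (simp only: pact_mult pact_X pact_square) (metis pact_commute mult.assoc)
  ultimately show ?thesis by simp
qed

lemma continuous_sqrt_abs: "continuous_on UNIV (\<lambda>u. complex_of_real (sqrt \<bar>u\<bar>))"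
  by (intro continuous_intros)

lemma sqrt_properties:
  fixes b :: "'a::cstar_algebra"
  assumes sa: "star b = b" and pos: "sig b \<subseteq> {0..}"
  defines "c \<equiv> cfc b (\<lambda>u. complex_of_real (sqrt \<bar>u\<bar>))"
  shows "star c = c" "c * c = b" "sig c \<subseteq> {0..}"
proof -
  note cont = continuous_sqrt_abs
  show sc: "star c = c"
    unfolding c_def using cfc_star[OF sa cont] by simp
  have "c * c = cfc b (\<lambda>u. complex_of_real (sqrt \<bar>u\<bar>) * complex_of_real (sqrt \<bar>u\<bar>))"
    unfolding c_def using cfc_mult[OF sa cont _ cont] by simp
  also have "\<dots> = cfc b of_real"
    by (rule cfc_cong[OF sa]) (use pos in \<open>auto simp flip: of_real_mult\<close>)
  finally show "c * c = b" by (simp add: cfc_id sa)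
  show "sig c \<subseteq> {0..}"
  proof
    fix s assume s: "s \<in> sig c"
    show "s \<in> {0..}"
    proof (rule ccontr)
      assume neg: "s \<notin> {0..}"
      define t where "t = - s"
      have t: "t > 0" using neg by (simp add: t_def)
      have "s \<noteq> 0" using neg by auto
      obtain f where f: "\<And>j. continuous_on UNIV (f j)" "\<And>j. f j 0 = 0" "\<And>j u. \<bar>u - s\<bar> \<ge> 1 \<Longrightarrow> f j u = 0"
    "\<And>j. star (cfc c (f j)) = cfc c (f j)" "\<And>j. norm (cfc c (f j)) = 1"
    "(\<lambda>j. c * cfc c (f j) - of_real s *\<^sub>C cfc c (f j)) \<longlonglongrightarrow> 0"
        by (rule bump_sequence[OF sc s \<open>s \<noteq> 0\<close> less_numeral_extra(1)]) (rule that; assumption)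
      \<comment> \<open>With s = -t this gives \<open>g(b) (c + t) = c\<close>. If
        \<open>(c + t) x\<close> is null along the approximate eigenvectors x, then so is c x, hence
        t x, although t > 0 and x has norm 1.\<close>
      define g where "g u = complex_of_real (sqrt \<bar>u\<bar> / (sqrt \<bar>u\<bar> + t))" for u
      have nz: "sqrt \<bar>u\<bar> + t \<noteq> 0" for u using t real_sqrt_ge_zero[of "\<bar>u\<bar>"] by linarith
      have gcont: "continuous_on UNIV g"
        unfolding g_def using nz by (intro continuous_intros) auto
      have g0: "g 0 = 0" by (simp add: g_def)
      have "cfc b (\<lambda>u. g u * of_real (sqrt \<bar>u\<bar>) + of_real t * g u) = cfc b (\<lambda>u. of_real (sqrt \<bar>u\<bar>))"
      proof (rule cfc_cong[OF sa])
        fix u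
        have "sqrt \<bar>u\<bar> / (sqrt \<bar>u\<bar> + t) * sqrt \<bar>u\<bar> + t * (sqrt \<bar>u\<bar> / (sqrt \<bar>u\<bar> + t)) = sqrt \<bar>u\<bar>"
        proof -
          have "sqrt \<bar>u\<bar> / (sqrt \<bar>u\<bar> + t) * sqrt \<bar>u\<bar> + t * (sqrt \<bar>u\<bar> / (sqrt \<bar>u\<bar> + t))
              = sqrt \<bar>u\<bar> * (sqrt \<bar>u\<bar> + t) / (sqrt \<bar>u\<bar> + t)"
            by (simp only: distrib_left add_divide_distrib times_divide_eq_left times_divide_eq_right mult.commute)
          then show ?thesis using nz[of u] by simp
        qed
        then show "g u * of_real (sqrt \<bar>u\<bar>) + of_real t * g u = of_real (sqrt \<bar>u\<bar>)"
          unfolding g_def by (simp only: of_real_mult[symmetric] of_real_add[symmetric])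
      qed
      moreover have "cfc b (\<lambda>u. g u * of_real (sqrt \<bar>u\<bar>) + of_real t * g u) = cfc b g * c + of_real t *\<^sub>C cfc b g"
        using gcont g0 cont unfolding c_def
        by (subst cfc_add[OF sa]) (auto intro!: continuous_intros simp: cfc_mult[OF sa] cfc_scaleC[OF sa])
      ultimately have g: "cfc b g * c + of_real t *\<^sub>C cfc b g = c" by (simp add: c_def)
      define r where "r j = c * cfc c (f j) - of_real s *\<^sub>C cfc c (f j)" for j
      have "r j - cfc b g * r j = of_real t *\<^sub>C cfc c (f j)" for j
      proof -
        have "cfc b g * r j = (cfc b g * c + of_real t *\<^sub>C cfc b g) * cfc c (f j)"
          by (simp add: r_def t_def algebra_simps mult_scaleC_left mult_scaleC_right scaleC.minus_left)
        then have "cfc b g * r j = c * cfc c (f j)" by (simp add: g)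
        then show ?thesis by (simp add: r_def t_def scaleC.minus_left)
      qed
      moreover have "(\<lambda>j. r j - cfc b g * r j) \<longlonglongrightarrow> 0 - cfc b g * 0"
        unfolding r_def by (intro tendsto_intros f)
      ultimately have "(\<lambda>j. of_real t *\<^sub>C cfc c (f j)) \<longlonglongrightarrow> 0" by simp
      from tendsto_norm[OF this] show False
        using t f(5) by (simp add: norm_scaleC LIMSEQ_const_iff)
    qed
  qed
qed

lemma cstar_sqrt_eq:
  fixes b :: "'a::cstar_algebra"
  assumes A: "cstar_subalgebra A" "b \<in> A" and sa: "star b = b" and pos: "sig b \<subseteq> {0..}"
  shows "cstar_sqrt A b = cfc b (\<lambda>u. complex_of_real (sqrt \<bar>u\<bar>))"
  unfolding cstar_sqrt_def
proof (rule the_equality)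
  let ?c = "cfc b (\<lambda>u. complex_of_real (sqrt \<bar>u\<bar>))"
  note props = sqrt_properties[OF sa pos]
  show "positive A ?c \<and> ?c * ?c = b"
    using props cfc_mem[OF A sa continuous_sqrt_abs] by (simp add: positive_iff[OF A(1)])
  fix c assume c: "positive A c \<and> c * c = b"
  then have c': "star c = c" "sig c \<subseteq> {0..}" by (auto simp: positive_iff[OF A(1)])
  obtain q where q: "approximates q b (\<lambda>u. of_real (sqrt \<bar>u\<bar>))" "(\<lambda>n. pact (q n) b b) \<longlonglongrightarrow> ?c"
    using cfc_approx[OF sa continuous_sqrt_abs] by (metis abs_zero of_real_0 real_sqrt_zero)
  then show "c = ?c"
    using sqrt_limit[OF c', of q] c LIMSEQ_unique by blast
qed

text \<open>Factor c^2 - t^2 = (c + t)(c - t). As -t lies outside \<open>sig c\<close>, a null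
  sequence \<open>(c + t) y\<close> forces y to be null, so approximate eigenvectors of c^2 at t^2
  already belong to c at t.\<close>

lemma sig_sqrt_iff:
  fixes c :: "'a::cstar_algebra"
  assumes sa: "star c = c" and pos: "sig c \<subseteq> {0..}" and t: "t > 0"
  shows "t \<in> sig c \<longleftrightarrow> t\<^sup>2 \<in> sig (c * c)"
proof
  assume t2: "t\<^sup>2 \<in> sig (c * c)"
  have sa2: "star (c * c) = c * c" using sa by (simp add: star_mult)
  have "t\<^sup>2 \<noteq> 0" using t by simp
  obtain f where f: "\<And>j. continuous_on UNIV (f j)" "\<And>j. f j 0 = 0" "\<And>j u. \<bar>u - t\<^sup>2\<bar> \<ge> 1 \<Longrightarrow> f j u = 0"
    "\<And>j. star (cfc (c * c) (f j)) = cfc (c * c) (f j)" "\<And>j. norm (cfc (c * c) (f j)) = 1"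
    "(\<lambda>j. (c * c) * cfc (c * c) (f j) - of_real (t\<^sup>2) *\<^sub>C cfc (c * c) (f j)) \<longlonglongrightarrow> 0"
    by (rule bump_sequence[OF sa2 t2 \<open>t\<^sup>2 \<noteq> 0\<close> less_numeral_extra(1)]) (rule that; assumption)
  define x where "x j = cfc (c * c) (f j)" for j
  define y where "y j = c * x j - of_real t *\<^sub>C x j" for j
  have "c * y j - of_real (- t) *\<^sub>C y j = (c * c) * x j - of_real (t\<^sup>2) *\<^sub>C x j" for j
    by (simp add: y_def algebra_simps scaleC_simps power2_eq_square)
  then have "(\<lambda>j. c * y j - of_real (- t) *\<^sub>C y j) \<longlonglongrightarrow> 0" using f(6) by (simp add: x_def)
  moreover have "- t \<notin> sig c" using pos t by auto
  ultimately have "y \<longlonglongrightarrow> 0" using sigI_approx_eigen by blast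
  moreover have "\<not> x \<longlonglongrightarrow> 0"
  proof
    assume "x \<longlonglongrightarrow> 0"
    from tendsto_norm[OF this] show False by (simp add: x_def f(5) LIMSEQ_const_iff)
  qed
  ultimately show "t \<in> sig c" unfolding y_def by (rule sigI_approx_eigen)
qed (rule sig_squareI[OF sa])

section \<open>Projections\<close>

lemma sig_projection:
  fixes e :: "'a::cstar_algebra"
  assumes "e * e = e" "s \<in> sig e"
  shows "s = 0 \<or> s = 1"
proof -
  have "pact [:-1, 1:] e e = 0"
    using assms(1) by (simp add: pact_pCons scaleC.minus_left)
  then have "cmod (of_real s * poly [:-1, 1:] (of_real s)) \<le> 0"
    using assms(2) unfolding sig_def by (metis (mono_tags, lifting) mem_Collect_eq norm_zero)
  then have "complex_of_real s * (of_real s - 1) = 0" by simp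
  then show ?thesis by (metis mult_eq_0_iff of_real_1 of_real_eq_iff of_real_eq_0_iff right_minus_eq)
qed

lemma positive_projection:
  assumes "cstar_subalgebra A" "projection A e"
  shows "positive A e"
  using assms sig_projection[of e] by (fastforce simp: positive_iff projection_def)

text \<open>The square of \<open>P - Q\<close> commutes with \<open>P\<close>; hence so does the positive element \<open>P - Q\<close> itself.\<close>

lemma projection_le_imp_mult:
  fixes P Q :: "'a::cstar_algebra"
  assumes A: "cstar_subalgebra A" and P: "projection A P" and Q: "projection A Q"
    and le: "cstar_le A Q P"
  shows "P * Q = Q"
proof -
  have PP: "P * P = P" "Q * Q = Q" "star P = P" "star Q = Q"
    using P Q by (auto simp: projection_def)
  have PPx: "P * (P * x) = P * x" "Q * (Q * x) = Q * x" for x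
    by (simp_all add: PP mult.assoc[symmetric])
  define c where "c = P - Q"
  have c: "star c = c" "sig c \<subseteq> {0..}"
    using le by (auto simp: cstar_le_def positive_iff[OF A] c_def)
  have sa2: "star (c * c) = c * c" using c by (simp add: star_mult)
  obtain q where q: "approximates q (c * c) (\<lambda>u. of_real (sqrt \<bar>u\<bar>))"
    using cfc_approx[OF sa2 continuous_sqrt_abs] by (metis abs_zero of_real_0 real_sqrt_zero)
  note lim = sqrt_limit[OF c q]
  have comm: "P * (c * c) = (c * c) * P"
    by (simp add: c_def algebra_simps PP PPx)
  have "P * pact (q n) (c * c) (c * c) = pact (q n) (c * c) (c * c) * P" for n
    using pact_commute[OF comm, of "q n" "c * c"] by (simp add: comm flip: pact_mult_right)
  then have "P * c = c * P"
    using LIMSEQ_unique[OF tendsto_mult_left[OF lim, of P]] tendsto_mult_right[OF lim, of P] by simp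
  then have PQ: "Q * P = P * Q" by (simp add: c_def algebra_simps PP)
  have "Q * (P * Q) = P * Q" by (metis PQ PPx(2))
  \<comment> \<open>For commuting projections the difference satisfies c^3 = c, so its spectral
    values are among -1, 0, 1, and positivity excludes -1.\<close>
  then have ccc: "c * (c * c) = c"
    by (simp add: c_def algebra_simps PP PPx PQ)
  have "s = 0 \<or> s = 1" if s: "s \<in> sig c" for s
  proof -
    have "pact [:-1, 0, 1:] c c = 0"
      using ccc by (simp add: pact_pCons scaleC.minus_left)
    then have "cmod (of_real s * poly [:-1, 0, 1:] (of_real s)) \<le> 0"
      using s unfolding sig_def by (metis (mono_tags, lifting) mem_Collect_eq norm_zero)
    then have "complex_of_real (s * (s * s - 1)) = 0" by simp
    then have "s * (s * s - 1) = 0" by (simp only: of_real_eq_0_iff)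
    then have "s = 0 \<or> s * s = 1" by simp
    moreover have "s \<ge> 0" using c(2) s by auto
    ultimately show ?thesis by (auto simp: square_eq_1_iff)
  qed
  then have "norm (pact [:-1, 1:] c c) \<le> 0"
    by (intro norm_pact_le[OF c(1)]) auto
  then have "c * c = c" by (simp add: pact_pCons scaleC.minus_left)
  moreover have "c * c = P - P * Q - P * Q + Q"
    by (simp add: c_def left_diff_distrib right_diff_distrib PP PQ)
  ultimately have "P - P * Q - P * Q + Q = P - Q" by (simp add: c_def)
  then have "Q + Q = P * Q + P * Q"
    by (metis (no_types, lifting) add.commute add_diff_cancel_left' diff_add_cancel diff_diff_add diff_eq_eq)
  then have "2 *\<^sub>R Q = 2 *\<^sub>R (P * Q)" by (simp only: scaleR_2)
  then show ?thesis by simp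
qed

section \<open>Scaling elements with a spectral gap\<close>

lemma cstar_subalgebra_Cstar: "cstar_subalgebra (Cstar X)"
  unfolding Cstar_def
proof (rule hull_in)
  fix T :: "'a set set"
  assume "Ball T cstar_subalgebra"
  then have T: "\<And>A. A \<in> T \<Longrightarrow> cstar_subalgebra A" by blast
  show "cstar_subalgebra (\<Inter>T)"
    using T unfolding cstar_subalgebra_def by (intro conjI closed_Inter) blast+
qed

lemma mem_Cstar: "X \<in> Cstar X"
  unfolding Cstar_def using hull_subset[of "{X}"] by blast

text \<open>A polynomial in b without constant term is a multiple of b plus some b u, so a closed
  linear condition that holds for b and all b u passes to f(b). This carries identities such as a b
  = b over to functions of b.\<close>

lemma cfc_left_induct:
  fixes b :: "'a::cstar_algebra"
  assumes "star b = b" "continuous_on UNIV f" "f 0 = 0" and "closed S" "b \<in> S" "0 \<in> S" "\<And>u. b * u \<in> S"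
    and "\<And>x y. x \<in> S \<Longrightarrow> y \<in> S \<Longrightarrow> x + y \<in> S" "\<And>c x. x \<in> S \<Longrightarrow> c *\<^sub>C x \<in> S"
  shows "cfc b f \<in> S"
proof (rule cfc_closed_property)
  show "pact q b b \<in> S" for q
    by (induction q) (use assms in \<open>auto simp: pact_pCons\<close>)
qed (use assms in auto)

section \<open>Relations between X, a and b\<close>

locale scaling =
  fixes X :: "'a::cstar_algebra"
  assumes scaling: "scaling_element X"
begin

abbreviation "a \<equiv> star X * X"
abbreviation "b \<equiv> X * star X"

lemma aX: "star X * (X * X) = X" "star X * (X * (X * u)) = X * u"
proof -
  have "a * X = X" using scaling by (simp add: scaling_element_def)
  then show "star X * (X * X) = X" "star X * (X * (X * u)) = X * u"
    by (metis mult.assoc)+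
qed

lemma Xa: "star X * (star X * X) = star X" "star X * (star X * (X * u)) = star X * u"
proof -
  have "star (star X * (X * X)) = star X" by (simp only: aX)
  then show "star X * (star X * X) = star X" by (simp add: star_mult star_star mult.assoc)
  then show "star X * (star X * (X * u)) = star X * u" by (metis mult.assoc)
qed

lemma a_neq_b: "a \<noteq> b"
  using scaling by (simp add: scaling_element_def)

lemma sa_b: "star b = b" and sa_a: "star a = a"
  by (simp_all add: star_mult star_star)

lemma a_cfc:
  assumes "continuous_on UNIV f" "f 0 = 0"
  shows "star X * (X * cfc b f) = cfc b f"
proof -
  have "cfc b f \<in> {h. star X * (X * h) = h}"
    by (rule cfc_left_induct[OF sa_b assms])
      (auto simp: mult.assoc aX distrib_left mult_scaleC_right intro!: closed_Collect_eq continuous_intros)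
  then show ?thesis by simp
qed

lemma b_X_cfc:
  assumes "continuous_on UNIV f" "f 0 = 0"
  shows "X * (star X * (X * cfc b f)) = X * cfc b f"
  by (simp add: a_cfc assms)

text \<open>Since a g(b) = g(b), the element X g(b) is an eigenvector of b at 1, so functions
  vanishing at 1 annihilate it. This is the source of the orthogonality relations below.\<close>

lemma cfc_X_cfc:
  assumes f: "continuous_on UNIV f" "f 0 = 0" "f 1 = 0" and "continuous_on UNIV g" "g 0 = 0"
  shows "cfc b f * (X * cfc b g) = 0"
  using cfc_eigen[OF sa_b f(1,2), of "X * cfc b g" 1] assms by (simp add: mult.assoc b_X_cfc)

lemma cfc_X_X:
  assumes f: "continuous_on UNIV f" "f 0 = 0" "f 1 = 0"
  shows "cfc b f * (X * X) = 0"
  using cfc_eigen[OF sa_b f(1,2), of "X * X" 1] assms by (simp add: mult.assoc aX)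

lemma star_X_star_X_cfc:
  assumes f: "continuous_on UNIV f" "f 0 = 0" "f 1 = 0" and sa: "star (cfc b f) = cfc b f"
  shows "star X * (star X * cfc b f) = 0"
proof -
  have "star (cfc b f * (X * X)) = star X * (star X * cfc b f)"
    by (simp add: star_mult sa mult.assoc)
  then show ?thesis using cfc_X_X[OF f] by simp
qed

text \<open>Positivity of \<open>X * star X\<close> by a direct construction: for a spectral value s
  < 0, a bump h of b near s combines with \<open>star X * h\<close> into a sequence u that must be
  null, and applying b to u shows that b h is null although it is close to s h.\<close>

lemma sig_b_nonneg: "sig b \<subseteq> {0..}"
proof
  fix s assume s: "s \<in> sig b"
  show "s \<in> {0..}"
  proof (rule ccontr)
    assume "s \<notin> {0..}"
    then have neg: "s < 0" by simp
    then have "- s / 2 > 0" "s \<noteq> 0" by simp_all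
    obtain f where f: "\<And>j. continuous_on UNIV (f j)" "\<And>j. f j 0 = 0" "\<And>j u. \<bar>u - s\<bar> \<ge> - s / 2 \<Longrightarrow> f j u = 0"
    "\<And>j. star (cfc b (f j)) = cfc b (f j)" "\<And>j. norm (cfc b (f j)) = 1"
    "(\<lambda>j. b * cfc b (f j) - of_real s *\<^sub>C cfc b (f j)) \<longlonglongrightarrow> 0"
      by (rule bump_sequence[OF sa_b s \<open>s \<noteq> 0\<close> \<open>- s / 2 > 0\<close>]) (rule that; assumption)
    have f1: "f j 1 = 0" for j using f(3)[of 1 j] neg by simp
    define h where "h j = cfc b (f j)" for j
    define l where "l = sqrt (- s)"
    \<comment> \<open>The weight satisfies l^2 = -s, and the cross terms vanish because h X h = 0,
      so \<open>star u * u\<close> is \<open>h (b - s) h\<close>.\<close>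
    define u where "u j = star X * h j + l *\<^sub>R h j" for j
    have l: "l \<noteq> 0" "l * l = - s" using neg by (auto simp: l_def)
    have hXh: "h j * (X * h j) = 0" for j
      unfolding h_def by (intro cfc_X_cfc f f1)
    have hX'h: "h j * (star X * h j) = 0" for j
    proof -
      have "star (h j * (X * h j)) = h j * (star X * h j)"
        by (simp add: star_mult h_def f(4) mult.assoc)
      then show ?thesis by (simp add: hXh)
    qed
    have "star (u j) * u j = h j * (b * h j - of_real s *\<^sub>C h j)" for j
      using l(2) by (simp add: u_def star_add star_mult star_scaleR star_star h_def[symmetric] f(4)[folded h_def]
          distrib_left distrib_right mult.assoc hXh hX'h right_diff_distrib scaleC_of_real)
    moreover have "(\<lambda>j. h j * (b * h j - of_real s *\<^sub>C h j)) \<longlonglongrightarrow> 0"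
    proof (rule null_of_bounded_below[OF f(6) less_numeral_extra(1)])
      show "1 * norm (h j * (b * h j - of_real s *\<^sub>C h j)) \<le> norm (b * cfc b (f j) - of_real s *\<^sub>C cfc b (f j))" for j
        using norm_mult_ineq[of "h j" "b * h j - of_real s *\<^sub>C h j"] f(5)[of j] by (simp add: h_def)
    qed
    ultimately have "(\<lambda>j. star (u j) * u j) \<longlonglongrightarrow> 0" by simp
    then have "u \<longlonglongrightarrow> 0" by (rule tendsto_zero_of_star_mult)
    then have "(\<lambda>j. (1 / l) *\<^sub>R (X * (star X * u j))) \<longlonglongrightarrow> (1 / l) *\<^sub>R (X * (star X * 0))"
      by (intro tendsto_intros)
    moreover have "(1 / l) *\<^sub>R (X * (star X * u j)) = b * h j" for j
      using l(1) star_X_star_X_cfc[OF f(1,2) f1 f(4), of j]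
      by (simp add: u_def distrib_left h_def mult.assoc)
    ultimately have "(\<lambda>j. b * h j) \<longlonglongrightarrow> 0" by simp
    from tendsto_diff[OF this f(6)] have "(\<lambda>j. of_real s *\<^sub>C h j) \<longlonglongrightarrow> 0"
      by (simp add: h_def)
    from tendsto_norm[OF this] show False
      using neg f(5) by (simp add: h_def norm_scaleC LIMSEQ_const_iff)
  qed
qed

text \<open>X b is an exact eigenvector of b at 1; if it vanished, X would vanish and a would equal
  b.\<close>

lemma one_in_sig_b: "1 \<in> sig b"
proof -
  have "X * b \<noteq> 0"
  proof
    assume 0: "X * b = 0"
    then have "X * b * star X = 0" by simp
    then have "star (star X * star X) * (star X * star X) = 0"
      by (simp add: star_mult star_star mult.assoc)
    then have "star X * star X = 0" by (rule star_mult_zero)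
    then have "star (star X * star X) = 0" by simp
    then have "X * X = 0" by (simp add: star_mult star_star)
    then have "X = 0" using aX(1) by simp
    then show False using a_neq_b by simp
  qed
  moreover have "b * (X * b) = X * b" by (simp add: mult.assoc aX)
  ultimately show ?thesis
    by (intro sigI_approx_eigen[of b "\<lambda>_. X * b"]) (auto simp: LIMSEQ_const_iff)
qed

section \<open>The spectrum of the modulus of the adjoint of X\<close>

lemma cstar_abs_properties:
  defines "c \<equiv> cstar_abs (Cstar X) (star X)"
  shows "star c = c" "c * c = b" "sig c \<subseteq> {0..}" "c \<in> Cstar X"
proof -
  note A = cstar_subalgebra_Cstar[of X]
  have bA: "b \<in> Cstar X" using A mem_Cstar by (intro cstar_subalgebraD)
  have c: "c = cfc b (\<lambda>u. complex_of_real (sqrt \<bar>u\<bar>))"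
    unfolding c_def cstar_abs_def star_star by (rule cstar_sqrt_eq[OF A bA sa_b sig_b_nonneg])
  show "star c = c" "c * c = b" "sig c \<subseteq> {0..}"
    unfolding c by (rule sqrt_properties[OF sa_b sig_b_nonneg])+
  show "c \<in> Cstar X" unfolding c using cfc_mem[OF A bA sa_b continuous_sqrt_abs] by simp
qed

text \<open>In a non-unital algebra 0 belongs to every spectrum. In a unital one, invertibility of
  the modulus makes b right invertible; then a b = b gives a = 1, and this in turn gives b = 1,
  contrary to \<open>a \<noteq> b\<close>.\<close>

lemma zero_in_spectrum_abs: "0 \<in> spectrum (Cstar X) (cstar_abs (Cstar X) (star X))"
proof (rule ccontr)
  let ?c = "cstar_abs (Cstar X) (star X)"
  note A = cstar_subalgebra_Cstar[of X]
  assume n: "0 \<notin> spectrum (Cstar X) ?c"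
  show False
  proof (cases "\<exists>e. unit_of (Cstar X) e")
    case True
    then obtain e where e: "unit_of (Cstar X) e" by blast
    then obtain g where g: "g \<in> Cstar X" "?c * g = e" using n True by (auto simp: spectrum_def)
    have eX: "e * X = X" "X * e = X" "e * star X = star X" "e * g = g" "g * e = g" "e * a = a" "a * e = a"
      using e g A mem_Cstar[of X] by (auto simp: unit_of_def intro: cstar_subalgebraD)
    have bg: "b * (g * g) = e"
    proof -
      have "b * (g * g) = ?c * (?c * g) * g"
        by (simp add: cstar_abs_properties(2)[symmetric] mult.assoc)
      moreover have "?c * e = ?c" using e cstar_abs_properties(4) by (auto simp: unit_of_def)
      ultimately show ?thesis using g by simp
    qed
    have "a * (b * (g * g)) = b * (g * g)" by (simp add: mult.assoc aX)
    then have ae: "a = e" by (simp add: bg eX)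
    have "star X * e = star X"
      using e A mem_Cstar[of X] by (auto simp: unit_of_def intro: cstar_subalgebraD)
    then have "star X = star X * (b * (g * g))" by (simp only: bg)
    also have "\<dots> = a * (star X * (g * g))" by (simp add: mult.assoc)
    also have "\<dots> = star X * (g * g)"
      using e A mem_Cstar[of X] g(1) unfolding ae by (auto simp: unit_of_def intro: cstar_subalgebraD)
    finally have "X * star X = X * (star X * (g * g))" by simp
    then have "b = e" by (metis bg mult.assoc)
    with ae a_neq_b show False by simp
  next
    case False
    then show False using n by (auto simp: spectrum_def unitization_mult_def)
  qed
qed

lemma spectrum_abs_iff:
  assumes "t > 0"
  shows "complex_of_real t \<in> spectrum (Cstar X) (cstar_abs (Cstar X) (star X)) \<longleftrightarrow> t\<^sup>2 \<in> sig b"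
proof -
  note c = cstar_abs_properties
  have "complex_of_real t \<in> spectrum (Cstar X) (cstar_abs (Cstar X) (star X))
      \<longleftrightarrow> t \<in> sig (cstar_abs (Cstar X) (star X))"
    using spectrum_nonzero_iff[OF cstar_subalgebra_Cstar c(4) c(1), of "complex_of_real t"] assms
    by (auto simp: image_iff)
  then show ?thesis using sig_sqrt_iff[OF c(1,3) assms] c(2) by simp
qed

text \<open>Both end points 0 and 1 always lie in the spectrum, so a missing point is interior; the
  square converts from the modulus to b.\<close>

lemma gap_iff:
  "complex_of_real ` {0..1} - spectrum (Cstar X) (cstar_abs (Cstar X) (star X)) \<noteq> {}
    \<longleftrightarrow> (\<exists>t. 0 < t \<and> t < 1 \<and> t\<^sup>2 \<notin> sig b)"
proof
  assume "complex_of_real ` {0..1} - spectrum (Cstar X) (cstar_abs (Cstar X) (star X)) \<noteq> {}"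
  then obtain z where z: "z \<in> complex_of_real ` {0..1}"
      "z \<notin> spectrum (Cstar X) (cstar_abs (Cstar X) (star X))"
    by (meson Diff_eq_empty_iff subsetI)
  then obtain t where "t \<in> {0..1}" "z = complex_of_real t" by (meson imageE)
  with z have t: "0 \<le> t" "t \<le> 1" "complex_of_real t \<notin> spectrum (Cstar X) (cstar_abs (Cstar X) (star X))"
    by simp_all
  then have "t \<noteq> 0" using zero_in_spectrum_abs by auto
  moreover have "t \<noteq> 1" using t(3) one_in_sig_b spectrum_abs_iff[of 1] by auto
  ultimately show "\<exists>t. 0 < t \<and> t < 1 \<and> t\<^sup>2 \<notin> sig b"
    using t spectrum_abs_iff[of t] by (intro exI[of _ t]) auto
next
  assume "\<exists>t. 0 < t \<and> t < 1 \<and> t\<^sup>2 \<notin> sig b"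
  then obtain t where t: "0 < t" "t < 1" "t\<^sup>2 \<notin> sig b" by blast
  then have "complex_of_real t \<notin> spectrum (Cstar X) (cstar_abs (Cstar X) (star X))"
    using spectrum_abs_iff by blast
  moreover have "complex_of_real t \<in> complex_of_real ` {0..1}" using t by simp
  ultimately show "complex_of_real ` {0..1} - spectrum (Cstar X) (cstar_abs (Cstar X) (star X)) \<noteq> {}"
    by blast
qed

text \<open>Cutting \<open>b\<close> at the gap gives the projection \<open>f(b)\<close>; the partial isometry is
  \<open>g(b) X\<close> with \<open>g(u) = f(u) / sqrt u\<close>.\<close>

lemma gap_imp_infinite_projection:
  assumes s0: "0 < s0" "s0 < 1" "s0 \<notin> sig b"
  shows "\<exists>P. infinite_projection (Cstar X) P"
proof -
  note A = cstar_subalgebra_Cstar[of X]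
  note [intro] = cstar_subalgebraD[OF A]
  have XA: "X \<in> Cstar X" "star X \<in> Cstar X" using mem_Cstar by auto
  then have bA: "b \<in> Cstar X" by blast
  obtain d where d: "d > 0" "\<And>s. s \<in> sig b \<Longrightarrow> d \<le> \<bar>s - s0\<bar>"
    using separate_point_closed[OF closed_sig s0(3)] by (auto simp: dist_real_def abs_minus_commute)
  \<comment> \<open>f0 ramps from 0 at s0 - r to 1 at s0 + r. The bound d keeps \<open>sig b\<close>
    off the ramp; the other two bounds give f0 the value 0 at 0 and the value 1 at 1. Below, m
    equals u above the gap and stays positive elsewhere, so that it may be divided by.\<close>
  define r where "r = min d (min (s0 / 2) (1 - s0))"
  have r: "r > 0" "r \<le> d" "r \<le> s0 / 2" "r \<le> 1 - s0" using d s0 by (auto simp: r_def min_def)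
  define f0 where "f0 u = max 0 (min 1 ((u - s0 + r) / (2 * r)))" for u
  define m where "m u = max u (s0 / 2)" for u
  have m: "m u > 0" "m u \<noteq> 0" "sqrt (m u) \<noteq> 0" for u using s0 by (auto simp: m_def less_max_iff_disj)
  have f0s: "f0 u = 0 \<or> f0 u = 1 \<and> m u = u" if "u \<in> sig b" for u
  proof -
    have "d \<le> \<bar>u - s0\<bar>" by (rule d(2)[OF that])
    then have "u \<le> s0 - r \<or> u \<ge> s0 + r" using r by linarith
    then show ?thesis using r by (auto simp: f0_def m_def field_simps)
  qed
  have f00: "f0 0 = 0" using r by (simp add: f0_def field_simps)
  have f01: "f0 1 = 1" using r by (simp add: f0_def field_simps)
  have m1: "m 1 = 1" using s0 by (simp add: m_def)
  define f where "f u = complex_of_real (f0 u)" for u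
  define g where "g u = complex_of_real (f0 u / sqrt (m u))" for u
  define k where "k u = complex_of_real (f0 u / m u)" for u
  have cf0: "continuous_on UNIV f0" unfolding f0_def using r by (intro continuous_intros) auto
  have cm: "continuous_on UNIV m" unfolding m_def by (intro continuous_intros)
  have f: "continuous_on UNIV f" "f 0 = 0" unfolding f_def by (intro continuous_intros cf0) (simp add: f00)
  have g: "continuous_on UNIV g" "g 0 = 0"
    unfolding g_def using m by (intro continuous_intros cf0 cm) (auto simp: f00)
  have k: "continuous_on UNIV k" "k 0 = 0"
    unfolding k_def using m by (intro continuous_intros cf0 cm) (auto simp: f00)
  have idc: "continuous_on UNIV complex_of_real" by (intro continuous_intros)
  define Q where "Q = cfc b f"
  define G where "G = cfc b g"
  define K where "K = cfc b k"
  have cn: "(\<lambda>s. cnj (f s)) = f" "(\<lambda>s. cnj (g s)) = g" "(\<lambda>s. cnj (k s)) = k"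
    by (simp_all add: fun_eq_iff f_def g_def k_def)
  have sa: "star Q = Q" "star G = G" "star K = K"
    using cfc_star[OF sa_b f, symmetric] cfc_star[OF sa_b g, symmetric] cfc_star[OF sa_b k, symmetric]
    unfolding cn Q_def G_def K_def by simp_all
  have mem: "Q \<in> Cstar X" "G \<in> Cstar X" "K \<in> Cstar X"
    using cfc_mem[OF A bA sa_b f] cfc_mem[OF A bA sa_b g] cfc_mem[OF A bA sa_b k]
    unfolding Q_def G_def K_def by simp_all
  have GG: "G * G = K"
  proof -
    have "G * G = cfc b (\<lambda>u. g u * g u)" unfolding G_def by (simp add: cfc_mult[OF sa_b g g])
    also have "\<dots> = K"
      unfolding K_def
    proof (rule cfc_cong[OF sa_b])
      fix u assume "u \<in> sig b"
      then have "f0 u * f0 u = f0 u" using f0s by force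
      then have "f0 u / sqrt (m u) * (f0 u / sqrt (m u)) = f0 u / m u"
        using m(1)[of u] by simp
      then show "g u * g u = k u" unfolding g_def k_def by (simp only: of_real_mult[symmetric])
    qed
    finally show ?thesis .
  qed
  have bG: "b * G = cfc b (\<lambda>u. of_real u * g u)" "b * K = cfc b (\<lambda>u. of_real u * k u)"
    unfolding G_def K_def using cfc_mult[OF sa_b idc _ g] cfc_mult[OF sa_b idc _ k] by (simp_all add: cfc_id[OF sa_b])
  have GbG: "G * (b * G) = Q"
  proof -
    have "G * (b * G) = cfc b (\<lambda>u. g u * (of_real u * g u))"
      unfolding bG unfolding G_def using g
      by (subst cfc_mult[OF sa_b g]) (auto intro!: continuous_intros)
    also have "\<dots> = Q"
      unfolding Q_def
    proof (rule cfc_cong[OF sa_b])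
      fix u assume "u \<in> sig b"
      then have "f0 u / sqrt (m u) * (u * (f0 u / sqrt (m u))) = f0 u"
        using f0s[of u] m[of u] by auto
      then show "g u * (of_real u * g u) = f u" unfolding g_def f_def by (simp only: of_real_mult[symmetric])
    qed
    finally show ?thesis .
  qed
  have bK: "b * K = Q"
    unfolding bG Q_def
  proof (rule cfc_cong[OF sa_b])
    fix u assume "u \<in> sig b"
    then have "u * (f0 u / m u) = f0 u" using f0s[of u] m[of u] by auto
    then show "of_real u * k u = f u" unfolding k_def f_def by (simp only: of_real_mult[symmetric])
  qed
  have KQ: "K * Q = K"
  proof -
    have "K * Q = cfc b (\<lambda>u. k u * f u)" unfolding K_def Q_def by (simp add: cfc_mult[OF sa_b k f])
    also have "\<dots> = K"
      unfolding K_def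
      by (rule cfc_cong[OF sa_b]) (use f0s in \<open>force simp: k_def f_def\<close>)
    finally show ?thesis .
  qed
  have QQ: "Q * Q = Q"
  proof -
    have "Q * Q = cfc b (\<lambda>u. f u * f u)" unfolding Q_def by (simp add: cfc_mult[OF sa_b f f])
    also have "\<dots> = Q"
      unfolding Q_def by (rule cfc_cong[OF sa_b]) (use f0s in \<open>force simp: f_def\<close>)
    finally show ?thesis .
  qed
  have Kb: "K * b = Q"
  proof -
    have "star (b * K) = K * b" by (simp only: star_mult[of b K] sa sa_b)
    then show ?thesis by (simp add: bK sa)
  qed
  define U where "U = G * X"
  define P where "P = star X * (K * X)"
  have UU: "star U * U = P" "U * star U = Q"
    using GbG by (simp_all add: U_def P_def star_mult sa mult.assoc flip: GG)
  have saP: "star P = P" by (simp add: P_def star_mult star_star sa mult.assoc)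
  have PP: "P * P = P"
  proof -
    have "P * P = star X * (K * (b * K) * X)" by (simp add: P_def mult.assoc)
    then show ?thesis by (simp add: bK KQ P_def)
  qed
  have k1: "k 1 = 1" by (simp add: k_def f01 m1)
  \<comment> \<open>X b is an eigenvector of b at 1 and k 1 = 1. Hence P b = b, and P absorbs every
    function of b, in particular Q.\<close>
  have KXb: "K * (X * (X * star X)) = X * (X * star X)"
    using cfc_eigen[OF sa_b k, of "X * (X * star X)" 1]
    by (simp add: mult.assoc aX K_def k1)
  then have Pb: "P * b = b"
    by (simp add: P_def mult.assoc aX)
  have Pbu: "P * (X * (star X * u)) = X * (star X * u)" for u
  proof -
    have "P * b * u = b * u" by (simp only: Pb)
    then show ?thesis by (simp only: mult.assoc)
  qed
  have PQ: "P * Q = Q"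
  proof -
    have "Q \<in> {h. P * h = h}"
      unfolding Q_def
      by (rule cfc_left_induct[OF sa_b f])
        (auto simp: Pb Pbu mult.assoc distrib_left mult_scaleC_right intro!: closed_Collect_eq continuous_intros)
    then show ?thesis by simp
  qed
  then have "star (P * Q) = star Q" by simp
  then have QP: "Q * P = Q" by (simp only: star_mult sa saP)
  have mem': "U \<in> Cstar X" "P \<in> Cstar X" using mem XA by (auto simp: U_def P_def)
  have "projection (Cstar X) (P - Q)"
    using mem' mem by (auto simp: projection_def left_diff_distrib right_diff_distrib PP PQ QP QQ star_diff sa saP
        intro!: cstar_subalgebra_diff[OF A])
  then have le: "cstar_le (Cstar X) (U * star U) P"
    unfolding UU cstar_le_def by (rule positive_projection[OF A])
  have "Q \<noteq> P"
  proof
    \<comment> \<open>Equality would give Q X = X and then a = Q. So a is a projection, hence X a =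
      X and b^2 = b; on the spectrum {0, 1} the function f is the identity, so Q = b and finally a =
      b.\<close>
    assume eq: "Q = P"
    have Qb: "Q * b = b" using Pb eq by simp
    then have "star (Q * b) = star b" by simp
    then have bQ: "b * Q = b" by (simp only: star_mult[of Q b] sa sa_b)
    have "star (star (Q * X - X)) * star (Q * X - X) = Q * b * Q - Q * b - b * Q + b"
      by (simp add: star_diff star_mult sa star_star left_diff_distrib right_diff_distrib mult.assoc)
    also have "\<dots> = 0" by (simp only: Qb bQ) simp
    finally have "star (Q * X - X) = 0" by (rule star_mult_zero)
    then have "star (star (Q * X - X)) = 0" by simp
    then have QX: "Q * X = X" by (simp add: star_star)
    have "P * a = star X * (K * b * X)" by (simp add: P_def mult.assoc)
    then have Pa: "P * a = a" by (simp add: Kb QX)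
    have "star X * (X * Q) = Q" unfolding Q_def by (rule a_cfc[OF f])
    then have "star (a * Q) = star Q" by (simp add: mult.assoc)
    then have "Q * a = Q" by (simp add: star_mult[of a Q] sa sa_a)
    with Pa eq have aQ: "a = Q" by simp
    then have aa: "a * a = a" using QQ by simp
    have "star (X * a - X) * (X * a - X) = a * a * a - a * a - a * a + a"
      by (simp add: star_diff star_mult star_star left_diff_distrib right_diff_distrib mult.assoc)
    also have "\<dots> = 0" by (simp only: aa) simp
    finally have "X * a - X = 0" by (rule star_mult_zero)
    then have Xaa: "X * a = X" by simp
    have "b * b = X * a * star X" by (simp add: mult.assoc)
    then have "b * b = b" by (simp only: Xaa)
    then have s01: "s = 0 \<or> s = 1" if "s \<in> sig b" for s using sig_projection that by blast
    have "Q = cfc b of_real"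
      unfolding Q_def by (rule cfc_cong[OF sa_b]) (use s01 in \<open>force simp: f_def f00 f01\<close>)
    then have "Q = b" by (simp add: cfc_id[OF sa_b])
    with aQ a_neq_b show False by simp
  qed
  then have "infinite_projection (Cstar X) P"
    unfolding infinite_projection_def
    using mem' UU le PP saP by (auto simp: projection_def)
  then show ?thesis by blast
qed

end

section \<open>Approximate shift systems\<close>

lemma tendsto_zero_mult_left:
  fixes f :: "nat \<Rightarrow> 'a::real_normed_algebra"
  shows "f \<longlonglongrightarrow> 0 \<Longrightarrow> (\<lambda>j. y * f j) \<longlonglongrightarrow> 0"
  using tendsto_mult_left[of f 0 sequentially y] by simp

lemma tendsto_zero_scaleC:
  fixes f :: "nat \<Rightarrow> 'a::cstar_algebra"
  shows "f \<longlonglongrightarrow> 0 \<Longrightarrow> (\<lambda>j. c *\<^sub>C f j) \<longlonglongrightarrow> 0"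
  using tendsto_scaleC[OF tendsto_const[of c], of f 0 sequentially] by simp

lemma tendsto_zero_add:
  fixes f g :: "nat \<Rightarrow> 'a::real_normed_vector"
  shows "f \<longlonglongrightarrow> 0 \<Longrightarrow> g \<longlonglongrightarrow> 0 \<Longrightarrow> (\<lambda>j. f j + g j) \<longlonglongrightarrow> 0"
  using tendsto_add[of f 0 sequentially g 0] by simp

text \<open>The symbol at z of the Toeplitz matrix with entries \<open>c (m - n)\<close> of band
  width N.\<close>

definition symb :: "(int \<Rightarrow> complex) \<Rightarrow> nat \<Rightarrow> complex \<Rightarrow> complex" where
  "symb c N z = (\<Sum>k\<in>{- int N..int N}. c k * z powi k)"

lemma symb_superset:
  assumes "finite S" "{- int N..int N} \<subseteq> S" "\<And>k. int N < \<bar>k\<bar> \<Longrightarrow> c k = 0"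
  shows "symb c N z = (\<Sum>k\<in>S. c k * z powi k)"
  unfolding symb_def by (rule sum.mono_neutral_left) (use assms in auto)

lemma symb_shift:
  assumes c: "\<And>k. int N < \<bar>k\<bar> \<Longrightarrow> c k = 0" and z: "z \<noteq> 0" and d: "\<bar>d\<bar> \<le> 1"
  shows "symb (\<lambda>k. c (k - d)) (N + 2) z = z powi d * symb c N z"
proof -
  have "symb (\<lambda>k. c (k - d)) (N + 2) z = (\<Sum>k\<in>{- int (N + 2)..int (N + 2)}. c (k - d) * z powi k)"
    by (simp add: symb_def)
  also have "\<dots> = (\<Sum>k\<in>{- int (N + 2) - d..int (N + 2) - d}. c k * z powi (k + d))"
    by (rule sum.reindex_bij_witness[of _ "\<lambda>k. k + d" "\<lambda>k. k - d"]) auto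
  also have "\<dots> = z powi d * (\<Sum>k\<in>{- int (N + 2) - d..int (N + 2) - d}. c k * z powi k)"
    using z by (simp add: power_int_add sum_distrib_left algebra_simps)
  also have "(\<Sum>k\<in>{- int (N + 2) - d..int (N + 2) - d}. c k * z powi k) = symb c N z"
    by (rule symb_superset[symmetric]) (use c d in auto)
  finally show ?thesis .
qed

context scaling
begin

section \<open>Polynomials in X and its adjoint, their matrices and symbols\<close>

text \<open>Only left multiplications by the generators are built in, so that inductions need just
  the action of X and \<open>star X\<close> on vectors; closure under products follows.\<close>

inductive_set pol :: "'a set" where
  gen: "X \<in> pol"
| gen_star: "star X \<in> pol"
| left: "y \<in> pol \<Longrightarrow> X * y \<in> pol"
| left_star: "y \<in> pol \<Longrightarrow> star X * y \<in> pol"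
| add: "y \<in> pol \<Longrightarrow> w \<in> pol \<Longrightarrow> y + w \<in> pol"
| scale: "y \<in> pol \<Longrightarrow> r *\<^sub>C y \<in> pol"

lemma pol_mult: "y \<in> pol \<Longrightarrow> w \<in> pol \<Longrightarrow> y * w \<in> pol"
  by (induction rule: pol.induct)
    (simp_all add: mult.assoc distrib_right mult_scaleC_left pol.intros)

lemma pol_star: "y \<in> pol \<Longrightarrow> star y \<in> pol"
  by (induction rule: pol.induct)
    (simp_all add: star_mult star_star star_add star_scaleC pol.intros pol_mult)

lemma Cstar_subset_closure: "Cstar X \<subseteq> closure pol"
  unfolding Cstar_def
proof (rule hull_minimal)
  show "{X} \<subseteq> closure pol" using pol.gen closure_subset by blast
  have 0: "0 \<in> pol" using pol.scale[OF pol.gen, of 0] by simp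
  have add: "x + y \<in> closure pol" and mult: "x * y \<in> closure pol"
    if xy: "x \<in> closure pol" "y \<in> closure pol" for x y
  proof -
    obtain f g where f: "\<And>n::nat. f n \<in> pol" "f \<longlonglongrightarrow> x" and g: "\<And>n::nat. g n \<in> pol" "g \<longlonglongrightarrow> y"
      using xy unfolding closure_sequential by blast
    show "x + y \<in> closure pol"
      unfolding closure_sequential
      by (rule exI[of _ "\<lambda>n. f n + g n"]) (simp add: pol.add f g tendsto_add)
    show "x * y \<in> closure pol"
      unfolding closure_sequential
      by (rule exI[of _ "\<lambda>n. f n * g n"]) (simp add: pol_mult f g tendsto_mult)
  qed
  have scale: "c *\<^sub>C x \<in> closure pol" and star: "star x \<in> closure pol" if x: "x \<in> closure pol" for c x
  proof -
    obtain f where f: "\<And>n::nat. f n \<in> pol" "f \<longlonglongrightarrow> x"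
      using x unfolding closure_sequential by blast
    show "c *\<^sub>C x \<in> closure pol"
      unfolding closure_sequential
      by (rule exI[of _ "\<lambda>n. c *\<^sub>C f n"]) (simp add: pol.scale f tendsto_scaleC)
    show "star x \<in> closure pol"
      unfolding closure_sequential
      by (rule exI[of _ "\<lambda>n. star (f n)"]) (simp add: pol_star f tendsto_star)
  qed
  show "cstar_subalgebra (closure pol)"
    unfolding cstar_subalgebra_def
    by (intro conjI ballI allI closed_closure subsetD[OF closure_subset 0] add mult scale star)
qed

lemma pol_approx:
  assumes "y \<in> Cstar X" "e > 0"
  shows "\<exists>w\<in>pol. norm (w - y) < e"
  using Cstar_subset_closure assms by (auto simp: closure_approachable dist_norm subset_iff)

text \<open>Along \<open>sysT t v\<close> the element \<open>X\<close> acts, in the limit, like the weighted shift on \<open>\<ell>\<^sup>2\<close> whose first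
  weight is \<open>t\<close> and whose other weights are 1; along \<open>sysC z x\<close> it acts like the scalar \<open>z\<close>.\<close>

definition sysT :: "real \<Rightarrow> (nat \<Rightarrow> nat \<Rightarrow> 'a) \<Rightarrow> bool" where
  "sysT t v \<longleftrightarrow>
     (\<forall>m. (\<lambda>j. X * v j m - (if m = 0 then t else 1) *\<^sub>R v j (Suc m)) \<longlonglongrightarrow> 0) \<and>
     (\<lambda>j. star X * v j 0) \<longlonglongrightarrow> 0 \<and>
     (\<forall>m. (\<lambda>j. star X * v j (Suc m) - (if m = 0 then t else 1) *\<^sub>R v j m) \<longlonglongrightarrow> 0) \<and>
     (\<exists>k. (\<forall>j. star (k j) = k j \<and> norm (k j) = 1) \<and>
          (\<forall>m n. (\<lambda>j. star (v j m) * v j n - (if m = n then k j else 0)) \<longlonglongrightarrow> 0))"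

definition sysC :: "complex \<Rightarrow> (nat \<Rightarrow> 'a) \<Rightarrow> bool" where
  "sysC z x \<longleftrightarrow> cmod z = 1 \<and> (\<lambda>j. X * x j - z *\<^sub>C x j) \<longlonglongrightarrow> 0 \<and> (\<lambda>j. star X * x j - cnj z *\<^sub>C x j) \<longlonglongrightarrow> 0"

text \<open>F t is the matrix of y along systems with first weight t. It differs from the Toeplitz
  matrix of c only in the corner of size N. The last two clauses say that the shift with first
  weight 0 is the direct sum of 0 and the shift with first weight 1: F 0 is F 1 moved one step down
  the diagonal, bordered by zeros.\<close>

definition represents :: "'a \<Rightarrow> (real \<Rightarrow> nat \<Rightarrow> nat \<Rightarrow> complex) \<Rightarrow> (int \<Rightarrow> complex) \<Rightarrow> nat \<Rightarrow> bool" where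
  "represents y F c N \<longleftrightarrow>
     (\<forall>t v n M. sysT t v \<longrightarrow> n + N \<le> M \<longrightarrow> (\<lambda>j. y * v j n - (\<Sum>m\<le>M. F t m n *\<^sub>C v j m)) \<longlonglongrightarrow> 0) \<and>
     (\<forall>z x. sysC z x \<longrightarrow> (\<lambda>j. y * x j - symb c N z *\<^sub>C x j) \<longlonglongrightarrow> 0) \<and>
     (\<forall>m n. continuous_on UNIV (\<lambda>t. F t m n)) \<and>
     (\<forall>t m n. N \<le> m \<or> N \<le> n \<longrightarrow> F t m n = c (int m - int n)) \<and>
     (\<forall>k. int N < \<bar>k\<bar> \<longrightarrow> c k = 0) \<and>
     (\<forall>n. F 0 0 n = 0 \<and> F 0 n 0 = 0) \<and>
     (\<forall>m n. F 0 (Suc m) (Suc n) = F 1 m n)"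

lemma representsD:
  assumes "represents y F c N"
  shows "\<And>t v n M. sysT t v \<Longrightarrow> n + N \<le> M \<Longrightarrow> (\<lambda>j. y * v j n - (\<Sum>m\<le>M. F t m n *\<^sub>C v j m)) \<longlonglongrightarrow> 0"
    "\<And>z x. sysC z x \<Longrightarrow> (\<lambda>j. y * x j - symb c N z *\<^sub>C x j) \<longlonglongrightarrow> 0"
    "\<And>m n. continuous_on UNIV (\<lambda>t. F t m n)"
    "\<And>t m n. N \<le> m \<or> N \<le> n \<Longrightarrow> F t m n = c (int m - int n)"
    "\<And>k. int N < \<bar>k\<bar> \<Longrightarrow> c k = 0"
    "\<And>n. F 0 0 n = 0" "\<And>n. F 0 n 0 = 0" "\<And>m n. F 0 (Suc m) (Suc n) = F 1 m n"
  using assms unfolding represents_def by blast+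

lemma represents_mono:
  assumes r: "represents y F c N" and "N \<le> N'"
  shows "represents y F c N'"
proof -
  have "symb c N' z = symb c N z" for z
    using \<open>N \<le> N'\<close> representsD(5)[OF r] unfolding symb_def[of c N']
    by (intro symb_superset[symmetric]) auto
  then show ?thesis
    unfolding represents_def using representsD[OF r] \<open>N \<le> N'\<close> by simp
qed

text \<open>The width is 2 because the entry t in row 1, column 0 must lie inside the corner exempt
  from the Toeplitz clause.\<close>

lemma represents_X: "represents X (\<lambda>t m n. if m = Suc n then (if n = 0 then of_real t else 1) else 0) (\<lambda>k. if k = 1 then 1 else 0) 2"
  unfolding represents_def
proof (intro conjI allI impI)
  fix t v and n M :: nat
  assume v: "sysT t v" and M: "n + 2 \<le> M"
  have "(\<Sum>m\<le>M. (if m = Suc n then (if n = 0 then complex_of_real t else 1) else 0) *\<^sub>C v j m)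
      = (if n = 0 then t else 1) *\<^sub>R v j (Suc n)" for j
  proof -
    have "(\<Sum>m\<le>M. (if m = Suc n then (if n = 0 then complex_of_real t else 1) else 0) *\<^sub>C v j m)
      = (\<Sum>m\<le>M. if m = Suc n then (if n = 0 then t else 1) *\<^sub>R v j (Suc n) else 0)"
      by (intro sum.cong refl) (simp add: scaleC_of_real)
    then show ?thesis using M by simp
  qed
  then show "(\<lambda>j. X * v j n - (\<Sum>m\<le>M. (if m = Suc n then (if n = 0 then complex_of_real t else 1) else 0) *\<^sub>C v j m)) \<longlonglongrightarrow> 0"
    using v unfolding sysT_def by simp
next
  fix z x assume "sysC z x"
  moreover have "symb (\<lambda>k. if k = 1 then 1 else 0) 2 z = z"
  proof -
    have "symb (\<lambda>k. if k = 1 then 1 else 0) 2 z = (\<Sum>k\<in>{- 2..2::int}. if k = 1 then z else 0)"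
      unfolding symb_def by (intro sum.cong) auto
    then show ?thesis by simp
  qed
  ultimately show "(\<lambda>j. X * x j - symb (\<lambda>k. if k = 1 then 1 else 0) 2 z *\<^sub>C x j) \<longlonglongrightarrow> 0"
    by (simp add: sysC_def)
next
  fix m n
  show "continuous_on UNIV (\<lambda>t. if m = Suc n then (if n = 0 then complex_of_real t else 1) else 0)"
    by (cases "m = Suc n"; cases "n = 0") (auto intro!: continuous_intros)
qed auto

lemma represents_star_X: "represents (star X) (\<lambda>t m n. if n = Suc m then (if m = 0 then of_real t else 1) else 0) (\<lambda>k. if k = -1 then 1 else 0) 2"
  unfolding represents_def
proof (intro conjI allI impI)
  fix t v and n M :: nat
  assume v: "sysT t v" and M: "n + 2 \<le> M"
  show "(\<lambda>j. star X * v j n - (\<Sum>m\<le>M. (if n = Suc m then (if m = 0 then complex_of_real t else 1) else 0) *\<^sub>C v j m)) \<longlonglongrightarrow> 0"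
  proof (cases n)
    case 0
    then show ?thesis using v unfolding sysT_def by simp
  next
    case (Suc l)
    have "(\<Sum>m\<le>M. (if n = Suc m then (if m = 0 then complex_of_real t else 1) else 0) *\<^sub>C v j m)
        = (if l = 0 then t else 1) *\<^sub>R v j l" for j
    proof -
      have "(\<Sum>m\<le>M. (if n = Suc m then (if m = 0 then complex_of_real t else 1) else 0) *\<^sub>C v j m)
        = (\<Sum>m\<le>M. if m = l then (if l = 0 then t else 1) *\<^sub>R v j l else 0)"
        by (intro sum.cong refl) (auto simp: Suc scaleC_of_real)
      then show ?thesis using M Suc by simp
    qed
    then show ?thesis using v unfolding sysT_def Suc by simp
  qed
next
  fix z x assume x: "sysC z x"
  then have "z * cnj z = 1" by (simp add: sysC_def complex_norm_square[symmetric])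
  then have zc: "inverse z = cnj z" by (rule inverse_unique)
  have "symb (\<lambda>k. if k = -1 then 1 else 0) 2 z = cnj z"
  proof -
    have "symb (\<lambda>k. if k = -1 then 1 else 0) 2 z = (\<Sum>k\<in>{- 2..2::int}. if k = -1 then cnj z else 0)"
      unfolding symb_def by (intro sum.cong) (auto simp: power_int_minus zc)
    then show ?thesis by simp
  qed
  then show "(\<lambda>j. star X * x j - symb (\<lambda>k. if k = -1 then 1 else 0) 2 z *\<^sub>C x j) \<longlonglongrightarrow> 0"
    using x by (simp add: sysC_def)
next
  fix m n
  show "continuous_on UNIV (\<lambda>t. if n = Suc m then (if m = 0 then complex_of_real t else 1) else 0)"
    by (cases "n = Suc m"; cases "m = 0") (auto intro!: continuous_intros)
qed auto

lemma sysC_nonzero: "sysC z x \<Longrightarrow> z \<noteq> 0"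
  by (auto simp: sysC_def)

text \<open>Multiplication by X moves the rows down, and row 1 acquires the factor t. The width
  grows by 2 so that row 1 remains in the exempt corner even when N = 0.\<close>

lemma represents_left:
  assumes r: "represents y F c N"
  shows "represents (X * y) (\<lambda>t m n. case m of 0 \<Rightarrow> 0 | Suc l \<Rightarrow> (if l = 0 then of_real t else 1) * F t l n)
    (\<lambda>k. c (k - 1)) (N + 2)"
  unfolding represents_def
proof (intro conjI allI impI)
  note R = representsD[OF r]
  fix t v and n M :: nat
  assume v: "sysT t v" and M: "n + (N + 2) \<le> M"
  then obtain K where K: "M = Suc K" "n + N \<le> K" by (cases M) auto
  let ?w = "\<lambda>j. \<Sum>m\<le>M. (case m of 0 \<Rightarrow> 0 | Suc l \<Rightarrow> (if l = 0 then of_real t else 1) * F t l n) *\<^sub>C v j m"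
  have w: "?w j = (\<Sum>m\<le>K. F t m n *\<^sub>C ((if m = 0 then t else 1) *\<^sub>R v j (Suc m)))" for j
    unfolding K(1) by (subst sum.atMost_Suc_shift)
      (auto intro!: sum.cong simp: scaleC_scaleC mult.commute simp flip: scaleC_of_real)
  have vX: "(\<lambda>j. X * v j m - (if m = 0 then t else 1) *\<^sub>R v j (Suc m)) \<longlonglongrightarrow> 0" for m
    using v unfolding sysT_def by blast
  have "(\<lambda>j. X * (y * v j n - (\<Sum>m\<le>K. F t m n *\<^sub>C v j m))
      + (\<Sum>m\<le>K. F t m n *\<^sub>C (X * v j m - (if m = 0 then t else 1) *\<^sub>R v j (Suc m)))) \<longlonglongrightarrow> 0"
    by (rule tendsto_zero_add[OF tendsto_zero_mult_left[OF R(1)[OF v K(2)]] tendsto_null_sum])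
      (rule tendsto_zero_scaleC[OF vX])
  moreover have "X * (y * v j n - (\<Sum>m\<le>K. F t m n *\<^sub>C v j m))
      + (\<Sum>m\<le>K. F t m n *\<^sub>C (X * v j m - (if m = 0 then t else 1) *\<^sub>R v j (Suc m)))
      = X * y * v j n - ?w j" for j
    unfolding w
    by (simp only: scaleC.diff_right sum_subtractf right_diff_distrib sum_distrib_left mult_scaleC_right mult.assoc)
      simp
  ultimately show "(\<lambda>j. X * y * v j n - ?w j) \<longlonglongrightarrow> 0" by simp
next
  note R = representsD[OF r]
  fix z x assume x: "sysC z x"
  have s: "symb (\<lambda>k. c (k - 1)) (N + 2) z = z * symb c N z"
    using symb_shift[OF R(5) sysC_nonzero[OF x], where d = 1] by simp
  have "(\<lambda>j. X * (y * x j - symb c N z *\<^sub>C x j) + symb c N z *\<^sub>C (X * x j - z *\<^sub>C x j)) \<longlonglongrightarrow> 0"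
    by (rule tendsto_zero_add[OF tendsto_zero_mult_left[OF R(2)[OF x]] tendsto_zero_scaleC])
      (use x in \<open>simp add: sysC_def\<close>)
  then show "(\<lambda>j. X * y * x j - symb (\<lambda>k. c (k - 1)) (N + 2) z *\<^sub>C x j) \<longlonglongrightarrow> 0"
    unfolding s by (simp add: right_diff_distrib scaleC.diff_right mult_scaleC_right mult.assoc scaleC_scaleC mult.commute)
next
  note R = representsD[OF r]
  show "continuous_on UNIV (\<lambda>t. case m of 0 \<Rightarrow> 0 | Suc l \<Rightarrow> (if l = 0 then of_real t else 1) * F t l n)" for m n
  proof (cases m)
    case (Suc l)
    then show ?thesis by (cases l) (auto intro!: continuous_intros R(3))
  qed simp
  show "(case m of 0 \<Rightarrow> 0 | Suc l \<Rightarrow> (if l = 0 then of_real t else 1) * F t l n) = c (int m - int n - 1)"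
    if mn: "N + 2 \<le> m \<or> N + 2 \<le> n" for t m n
  proof (cases m)
    case 0
    then show ?thesis using mn by (simp add: R(5))
  next
    case (Suc l)
    then have "F t l n = c (int l - int n)" using mn by (intro R(4)) auto
    moreover have "c (int l - int n) = 0" if "l = 0" using mn Suc that by (intro R(5)) auto
    ultimately show ?thesis using Suc by auto
  qed
  show "c (k - 1) = 0" if "int (N + 2) < \<bar>k\<bar>" for k using that by (intro R(5)) auto
  show "(case 0 of 0 \<Rightarrow> 0 | Suc l \<Rightarrow> (if l = 0 then of_real 0 else 1) * F 0 l n) = 0" for n by simp
  show "(case n of 0 \<Rightarrow> 0 | Suc l \<Rightarrow> (if l = 0 then of_real 0 else 1) * F 0 l 0) = 0" for n
    by (auto split: nat.split simp: R(7))
  show "(case Suc m of 0 \<Rightarrow> 0 | Suc l \<Rightarrow> (if l = 0 then of_real 0 else 1) * F 0 l (Suc n))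
      = (case m of 0 \<Rightarrow> 0 | Suc l \<Rightarrow> (if l = 0 then of_real 1 else 1) * F 1 l n)" for m n
    by (auto split: nat.split simp: R(8))
qed

lemma represents_left_star:
  assumes r: "represents y F c N"
  shows "represents (star X * y) (\<lambda>t m n. (if m = 0 then of_real t else 1) * F t (Suc m) n)
    (\<lambda>k. c (k + 1)) (N + 2)"
  unfolding represents_def
proof (intro conjI allI impI)
  note R = representsD[OF r]
  fix t v and n M :: nat
  assume v: "sysT t v" and M: "n + (N + 2) \<le> M"
  then have K: "n + N \<le> Suc M" by simp
  let ?w = "\<lambda>j. \<Sum>m\<le>M. ((if m = 0 then of_real t else 1) * F t (Suc m) n) *\<^sub>C v j m"
  define u where "u j m = (case m of 0 \<Rightarrow> 0 | Suc l \<Rightarrow> (if l = 0 then t else 1) *\<^sub>R v j l)" for j m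
  have w: "?w j = (\<Sum>m\<le>Suc M. F t m n *\<^sub>C u j m)" for j
    by (subst sum.atMost_Suc_shift)
      (auto intro!: sum.cong simp: u_def scaleC_scaleC mult.commute simp flip: scaleC_of_real)
  have u: "(\<lambda>j. star X * v j m - u j m) \<longlonglongrightarrow> 0" for m
    using v by (cases m) (auto simp: sysT_def u_def)
  have "(\<lambda>j. star X * (y * v j n - (\<Sum>m\<le>Suc M. F t m n *\<^sub>C v j m))
      + (\<Sum>m\<le>Suc M. F t m n *\<^sub>C (star X * v j m - u j m))) \<longlonglongrightarrow> 0"
    by (rule tendsto_zero_add[OF tendsto_zero_mult_left[OF R(1)[OF v K]] tendsto_null_sum])
      (rule tendsto_zero_scaleC[OF u])
  moreover have "star X * (y * v j n - (\<Sum>m\<le>Suc M. F t m n *\<^sub>C v j m))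
      + (\<Sum>m\<le>Suc M. F t m n *\<^sub>C (star X * v j m - u j m))
      = star X * y * v j n - ?w j" for j
    unfolding w
    by (simp only: scaleC.diff_right sum_subtractf right_diff_distrib sum_distrib_left mult_scaleC_right mult.assoc)
      simp
  ultimately show "(\<lambda>j. star X * y * v j n - ?w j) \<longlonglongrightarrow> 0" by simp
next
  note R = representsD[OF r]
  fix z x assume x: "sysC z x"
  then have "z * cnj z = 1" by (simp add: sysC_def complex_norm_square[symmetric])
  then have zc: "inverse z = cnj z" by (rule inverse_unique)
  have s: "symb (\<lambda>k. c (k + 1)) (N + 2) z = cnj z * symb c N z"
    using symb_shift[OF R(5) sysC_nonzero[OF x], where d = "-1"] by (simp add: power_int_minus zc)
  have "(\<lambda>j. star X * (y * x j - symb c N z *\<^sub>C x j) + symb c N z *\<^sub>C (star X * x j - cnj z *\<^sub>C x j)) \<longlonglongrightarrow> 0"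
    by (rule tendsto_zero_add[OF tendsto_zero_mult_left[OF R(2)[OF x]] tendsto_zero_scaleC])
      (use x in \<open>simp add: sysC_def\<close>)
  then show "(\<lambda>j. star X * y * x j - symb (\<lambda>k. c (k + 1)) (N + 2) z *\<^sub>C x j) \<longlonglongrightarrow> 0"
    unfolding s by (simp add: right_diff_distrib scaleC.diff_right mult_scaleC_right mult.assoc scaleC_scaleC mult.commute)
next
  note R = representsD[OF r]
  show "continuous_on UNIV (\<lambda>t. (if m = 0 then of_real t else 1) * F t (Suc m) n)" for m n
    by (cases m) (auto intro!: continuous_intros R(3))
  show "(if m = 0 then of_real t else 1) * F t (Suc m) n = c (int m - int n + 1)"
    if mn: "N + 2 \<le> m \<or> N + 2 \<le> n" for t m n
  proof -
    have e: "int (Suc m) - int n = int m - int n + 1" by simp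
    have "F t (Suc m) n = c (int m - int n + 1)"
      unfolding e[symmetric] using mn by (intro R(4)) auto
    moreover have "c (int m - int n + 1) = 0" if "m = 0" using mn that by (intro R(5)) auto
    ultimately show ?thesis by auto
  qed
  show "c (k + 1) = 0" if "int (N + 2) < \<bar>k\<bar>" for k using that by (intro R(5)) auto
qed (use representsD[OF r] in auto)

lemma represents_add:
  assumes r1: "represents y F c N" and r2: "represents w G d N"
  shows "represents (y + w) (\<lambda>t m n. F t m n + G t m n) (\<lambda>k. c k + d k) N"
  unfolding represents_def
proof (intro conjI allI impI)
  note R1 = representsD[OF r1] and R2 = representsD[OF r2]
  fix t v and n M :: nat
  assume v: "sysT t v" and M: "n + N \<le> M"
  show "(\<lambda>j. (y + w) * v j n - (\<Sum>m\<le>M. (F t m n + G t m n) *\<^sub>C v j m)) \<longlonglongrightarrow> 0"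
    using tendsto_zero_add[OF R1(1)[OF v M] R2(1)[OF v M]]
    by (simp add: distrib_right scaleC_add_left sum.distrib algebra_simps)
next
  note R1 = representsD[OF r1] and R2 = representsD[OF r2]
  fix z x assume x: "sysC z x"
  have "symb (\<lambda>k. c k + d k) N z = symb c N z + symb d N z"
    by (simp add: symb_def distrib_right sum.distrib)
  then show "(\<lambda>j. (y + w) * x j - symb (\<lambda>k. c k + d k) N z *\<^sub>C x j) \<longlonglongrightarrow> 0"
    using tendsto_zero_add[OF R1(2)[OF x] R2(2)[OF x]]
    by (simp add: distrib_right scaleC_add_left algebra_simps)
next
  show "continuous_on UNIV (\<lambda>t. F t m n + G t m n)" for m n
    by (intro continuous_intros representsD(3)[OF r1] representsD(3)[OF r2])
qed (simp_all add: representsD(4-8)[OF r1] representsD(4-8)[OF r2])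

lemma represents_scale:
  assumes r: "represents y F c N"
  shows "represents (\<alpha> *\<^sub>C y) (\<lambda>t m n. \<alpha> * F t m n) (\<lambda>k. \<alpha> * c k) N"
  unfolding represents_def
proof (intro conjI allI impI)
  note R = representsD[OF r]
  fix t v and n M :: nat
  assume v: "sysT t v" and M: "n + N \<le> M"
  have "(\<Sum>m\<le>M. (\<alpha> * F t m n) *\<^sub>C v j m) = \<alpha> *\<^sub>C (\<Sum>m\<le>M. F t m n *\<^sub>C v j m)" for j
    by (simp add: scaleC.sum_right scaleC_scaleC)
  then show "(\<lambda>j. (\<alpha> *\<^sub>C y) * v j n - (\<Sum>m\<le>M. (\<alpha> * F t m n) *\<^sub>C v j m)) \<longlonglongrightarrow> 0"
    using tendsto_zero_scaleC[OF R(1)[OF v M], of \<alpha>]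
    by (simp add: mult_scaleC_left scaleC.diff_right)
next
  note R = representsD[OF r]
  fix z x assume x: "sysC z x"
  have "symb (\<lambda>k. \<alpha> * c k) N z = \<alpha> * symb c N z"
    by (simp add: symb_def sum_distrib_left mult.assoc)
  then show "(\<lambda>j. (\<alpha> *\<^sub>C y) * x j - symb (\<lambda>k. \<alpha> * c k) N z *\<^sub>C x j) \<longlonglongrightarrow> 0"
    using tendsto_zero_scaleC[OF R(2)[OF x], of \<alpha>]
    by (simp add: mult_scaleC_left scaleC.diff_right scaleC_scaleC)
next
  show "continuous_on UNIV (\<lambda>t. \<alpha> * F t m n)" for m n
    by (intro continuous_intros representsD(3)[OF r])
qed (simp_all add: representsD(4-8)[OF r])

lemma pol_represents: "y \<in> pol \<Longrightarrow> \<exists>F c N. represents y F c N"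
proof (induction rule: pol.induct)
  case (add y w)
  then obtain F c N G d M where "represents y F c N" "represents w G d M" by blast
  then have "represents y F c (max N M)" "represents w G d (max N M)"
    using represents_mono by simp_all
  then show ?case using represents_add by blast
qed (use represents_X represents_star_X represents_left represents_left_star represents_scale in blast)+

section \<open>Finite combinations along a shift system\<close>

definition vec_sum :: "(nat \<Rightarrow> nat \<Rightarrow> 'a) \<Rightarrow> (nat \<Rightarrow> complex) \<Rightarrow> nat \<Rightarrow> nat \<Rightarrow> 'a" where
  "vec_sum v \<xi> L j = (\<Sum>n<L. \<xi> n *\<^sub>C v j n)"

text \<open>\<open>star V * V\<close> approaches the squared l2 norm of the coefficients times
  \<open>k j\<close>, and \<open>k j\<close> has norm 1. Thus combinations along a system have, in
  the limit, exactly the Hilbert space norm.\<close>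

lemma norm_vec_sum:
  assumes v: "sysT t v"
  shows "(\<lambda>j. norm (vec_sum v \<xi> L j)) \<longlonglongrightarrow> L2_set (\<lambda>n. cmod (\<xi> n)) {..<L}"
proof -
  obtain k where k: "\<And>j. star (k j) = k j" "\<And>j. norm (k j) = 1"
      "\<And>m n. (\<lambda>j. star (v j m) * v j n - (if m = n then k j else 0)) \<longlonglongrightarrow> 0"
    using v unfolding sysT_def by blast
  define S where "S = (\<Sum>n<L. (cmod (\<xi> n))\<^sup>2)"
  have "(\<lambda>j. \<Sum>m<L. \<Sum>n<L. (cnj (\<xi> m) * \<xi> n) *\<^sub>C (star (v j m) * v j n - (if m = n then k j else 0))) \<longlonglongrightarrow> 0"
    by (intro tendsto_null_sum tendsto_zero_scaleC k)
  moreover have "(\<Sum>m<L. \<Sum>n<L. (cnj (\<xi> m) * \<xi> n) *\<^sub>C (star (v j m) * v j n - (if m = n then k j else 0)))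
      = star (vec_sum v \<xi> L j) * vec_sum v \<xi> L j - S *\<^sub>R k j" for j
  proof -
    have "star (vec_sum v \<xi> L j) * vec_sum v \<xi> L j = (\<Sum>m<L. \<Sum>n<L. (cnj (\<xi> m) * \<xi> n) *\<^sub>C (star (v j m) * v j n))"
      by (simp add: vec_sum_def star_sum star_scaleC sum_product mult_scaleC_left mult_scaleC_right
          scaleC_scaleC mult.commute)
    moreover have "(\<Sum>m<L. \<Sum>n<L. (cnj (\<xi> m) * \<xi> n) *\<^sub>C (if m = n then k j else 0)) = S *\<^sub>R k j"
    proof -
      have "(\<Sum>n<L. (cnj (\<xi> m) * \<xi> n) *\<^sub>C (if m = n then k j else 0)) = (cmod (\<xi> m))\<^sup>2 *\<^sub>R k j" if "m < L" for m
      proof -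
        have "(\<Sum>n<L. (cnj (\<xi> m) * \<xi> n) *\<^sub>C (if m = n then k j else 0))
            = (\<Sum>n<L. if m = n then (cnj (\<xi> m) * \<xi> m) *\<^sub>C k j else 0)"
          by (intro sum.cong) auto
        also have "\<dots> = (cnj (\<xi> m) * \<xi> m) *\<^sub>C k j" using that by simp
        also have "cnj (\<xi> m) * \<xi> m = complex_of_real ((cmod (\<xi> m))\<^sup>2)"
          by (simp only: complex_norm_square mult.commute)
        finally show ?thesis by (simp only: scaleC_of_real)
      qed
      then show ?thesis by (simp add: S_def scaleR_sum_left)
    qed
    ultimately show ?thesis by (simp only: scaleC.diff_right sum_subtractf)
  qed
  ultimately have "(\<lambda>j. star (vec_sum v \<xi> L j) * vec_sum v \<xi> L j - S *\<^sub>R k j) \<longlonglongrightarrow> 0" by simp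
  then have lim: "(\<lambda>j. norm (star (vec_sum v \<xi> L j) * vec_sum v \<xi> L j - S *\<^sub>R k j)) \<longlonglongrightarrow> 0"
    by (rule tendsto_norm_zero)
  have "(\<lambda>j. (norm (vec_sum v \<xi> L j))\<^sup>2 - S) \<longlonglongrightarrow> 0"
  proof (rule Lim_null_comparison[OF _ lim], intro always_eventually allI)
    fix j
    have "S \<ge> 0" by (simp add: S_def sum_nonneg)
    then have "norm (S *\<^sub>R k j) = S" by (simp add: k)
    then show "norm ((norm (vec_sum v \<xi> L j))\<^sup>2 - S) \<le> norm (star (vec_sum v \<xi> L j) * vec_sum v \<xi> L j - S *\<^sub>R k j)"
      using norm_triangle_ineq3[of "star (vec_sum v \<xi> L j) * vec_sum v \<xi> L j" "S *\<^sub>R k j"]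
      by (simp add: cstar_identity)
  qed
  then have "(\<lambda>j. (norm (vec_sum v \<xi> L j))\<^sup>2) \<longlonglongrightarrow> S" by (simp add: LIM_zero_iff)
  then have "(\<lambda>j. sqrt ((norm (vec_sum v \<xi> L j))\<^sup>2)) \<longlonglongrightarrow> sqrt S" by (rule tendsto_real_sqrt)
  then show ?thesis by (simp add: S_def L2_set_def)
qed

lemma represents_vec_sum:
  assumes r: "represents y F c N" and v: "sysT t v"
  shows "(\<lambda>j. y * vec_sum v \<xi> L j - vec_sum v (\<lambda>m. \<Sum>n<L. F t m n * \<xi> n) (L + N) j) \<longlonglongrightarrow> 0"
proof (cases "L + N")
  case 0
  then show ?thesis by (simp add: vec_sum_def)
next
  case (Suc M)
  have "(\<lambda>j. \<Sum>n<L. \<xi> n *\<^sub>C (y * v j n - (\<Sum>m\<le>M. F t m n *\<^sub>C v j m))) \<longlonglongrightarrow> 0"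
    by (intro tendsto_null_sum tendsto_zero_scaleC representsD(1)[OF r v]) (use Suc in auto)
  moreover have "(\<Sum>n<L. \<xi> n *\<^sub>C (y * v j n - (\<Sum>m\<le>M. F t m n *\<^sub>C v j m)))
      = y * vec_sum v \<xi> L j - vec_sum v (\<lambda>m. \<Sum>n<L. F t m n * \<xi> n) (L + N) j" for j
  proof -
    have "(\<Sum>n<L. \<xi> n *\<^sub>C (\<Sum>m\<le>M. F t m n *\<^sub>C v j m)) = (\<Sum>m\<le>M. (\<Sum>n<L. F t m n * \<xi> n) *\<^sub>C v j m)"
      by (simp add: scaleC.sum_right scaleC.sum_left scaleC_scaleC mult.commute) (rule sum.swap)
    moreover have "{..<L + N} = {..M}" using Suc by auto
    ultimately show ?thesis
      by (simp add: vec_sum_def scaleC.diff_right sum_subtractf sum_distrib_left mult_scaleC_right)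
  qed
  ultimately show ?thesis by simp
qed

lemma vec_sum_extend: "L \<le> M \<Longrightarrow> vec_sum v \<xi> L j = vec_sum v (\<lambda>n. if n < L then \<xi> n else 0) M j"
proof -
  assume "L \<le> M"
  have "(\<Sum>n<M. (if n < L then \<xi> n else 0) *\<^sub>C v j n) = (\<Sum>n<L. (if n < L then \<xi> n else 0) *\<^sub>C v j n)"
    by (rule sum.mono_neutral_right) (use \<open>L \<le> M\<close> in auto)
  then show ?thesis by (simp add: vec_sum_def)
qed

text \<open>The scalar \<open>\<alpha>\<close> acts on the vectors because there is no unit to add
  to y. It is used with -1/2, for y near a projection, and with 1, for a perturbation of the
  identity.\<close>

lemma represents_norm:
  assumes r: "represents y F c N" and v: "sysT t v"
  shows "(\<lambda>j. norm (\<alpha> *\<^sub>C vec_sum v \<xi> L j + y * vec_sum v \<xi> L j))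
     \<longlonglongrightarrow> L2_set (\<lambda>m. cmod (\<alpha> * (if m < L then \<xi> m else 0) + (\<Sum>n<L. F t m n * \<xi> n))) {..<L + N}"
proof -
  let ?\<zeta> = "\<lambda>m. \<alpha> * (if m < L then \<xi> m else 0) + (\<Sum>n<L. F t m n * \<xi> n)"
  have eq: "vec_sum v ?\<zeta> (L + N) j = \<alpha> *\<^sub>C vec_sum v \<xi> L j + vec_sum v (\<lambda>m. \<Sum>n<L. F t m n * \<xi> n) (L + N) j" for j
    unfolding vec_sum_extend[of L "L + N" v \<xi> j, OF le_add1]
    by (simp add: vec_sum_def scaleC_add_left sum.distrib scaleC.sum_right scaleC_scaleC)
  have "(\<lambda>j. norm (\<alpha> *\<^sub>C vec_sum v \<xi> L j + y * vec_sum v \<xi> L j) - norm (vec_sum v ?\<zeta> (L + N) j)) \<longlonglongrightarrow> 0"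
  proof (rule Lim_null_comparison[OF _ tendsto_norm_zero[OF represents_vec_sum[OF r v]]], intro always_eventually allI)
    show "norm (norm (\<alpha> *\<^sub>C vec_sum v \<xi> L j + y * vec_sum v \<xi> L j) - norm (vec_sum v ?\<zeta> (L + N) j))
        \<le> norm (y * vec_sum v \<xi> L j - vec_sum v (\<lambda>m. \<Sum>n<L. F t m n * \<xi> n) (L + N) j)" for j
      unfolding eq
      using norm_triangle_ineq3[of "\<alpha> *\<^sub>C vec_sum v \<xi> L j + y * vec_sum v \<xi> L j"
          "\<alpha> *\<^sub>C vec_sum v \<xi> L j + vec_sum v (\<lambda>m. \<Sum>n<L. F t m n * \<xi> n) (L + N) j"]
      by simp
  qed
  from tendsto_add[OF this norm_vec_sum[OF v, of ?\<zeta> "L + N"]] show ?thesis by simp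
qed

section \<open>Existence of shift systems and scalar systems\<close>

text \<open>The vector h, on which b is nearly t^2, is placed at position 1: for a shift with first
  weight t, \<open>X * star X\<close> has the eigenvalue t^2 exactly there. Position 0 is recovered
  by \<open>star X\<close>, normalised by 1/t.\<close>

definition gsys :: "real \<Rightarrow> (nat \<Rightarrow> 'a) \<Rightarrow> nat \<Rightarrow> nat \<Rightarrow> 'a" where
  "gsys t h j n = (case n of 0 \<Rightarrow> (1 / t) *\<^sub>R (star X * h j) | Suc m \<Rightarrow> ((*) X ^^ m) (h j))"

context
  fixes f :: "real \<Rightarrow> complex" and h :: 'a
  assumes f: "continuous_on UNIV f" "f 0 = 0" "f 1 = 0"
    and sah: "star (cfc b f) = cfc b f" and h_def: "h = cfc b f"
begin

lemma sa_h: "star h = h" using sah by (simp add: h_def)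

lemma a_power_h: "star X * (X * ((*) X ^^ m) h) = ((*) X ^^ m) h"
  by (cases m) (simp_all add: h_def a_cfc f aX)

lemma h_power_h: "h * (X * ((*) X ^^ m) h) = 0"
proof -
  have "b * (X * ((*) X ^^ m) h) = of_real 1 *\<^sub>C (X * ((*) X ^^ m) h)"
    by (simp add: mult.assoc a_power_h)
  from cfc_eigen[OF sa_b f(1,2) this] show ?thesis by (simp add: h_def f)
qed

text \<open>a fixes all X^m h, so factors X cancel from both sides until h meets some X^k h. For k >
  0 the latter is an eigenvector of b at 1, where f vanishes.\<close>

lemma power_h_orthogonal: "star (((*) X ^^ m) h) * ((*) X ^^ n) h = (if m = n then h * h else 0)"
proof (induction m arbitrary: n)
  case 0
  show ?case
  proof (cases n)
    case (Suc k)
    then show ?thesis using h_power_h[of k] by (simp add: sa_h)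
  qed (simp add: sa_h)
next
  case (Suc m)
  show ?case
  proof (cases n)
    case 0
    have "star (h * (X * ((*) X ^^ m) h)) = star (((*) X ^^ m) h) * (star X * h)"
      by (simp add: star_mult sa_h mult.assoc)
    then show ?thesis using 0 h_power_h[of m] by (simp add: star_mult mult.assoc)
  next
    case (Suc k)
    then show ?thesis using Suc.IH[of k] by (simp add: star_mult mult.assoc a_power_h)
  qed
qed

lemma star_X_star_X_h: "star X * (star X * h) = 0"
  unfolding h_def by (rule star_X_star_X_cfc[OF f sah])

end

lemma sysT_gsys:
  assumes f: "\<And>j. continuous_on UNIV (f j)" "\<And>j. f j 0 = 0" "\<And>j. f j 1 = 0"
    and sa: "\<And>j. star (cfc b (f j)) = cfc b (f j)" and n1: "\<And>j. norm (cfc b (f j)) = 1"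
    and lim: "(\<lambda>j. b * cfc b (f j) - of_real (t\<^sup>2) *\<^sub>C cfc b (f j)) \<longlonglongrightarrow> 0" and t: "t > 0"
  shows "sysT t (gsys t (\<lambda>j. cfc b (f j)))"
proof -
  define h where "h j = cfc b (f j)" for j
  have F: "continuous_on UNIV (f j)" "f j 0 = 0" "f j 1 = 0" "star (cfc b (f j)) = cfc b (f j)"
      "h j = cfc b (f j)" for j
    using f sa h_def by auto
  have lim': "(\<lambda>j. b * h j - t\<^sup>2 *\<^sub>R h j) \<longlonglongrightarrow> 0"
    using lim unfolding h_def scaleC_of_real .
  have 1: "(\<lambda>j. X * gsys t h j m - (if m = 0 then t else 1) *\<^sub>R gsys t h j (Suc m)) \<longlonglongrightarrow> 0" for m
  proof (cases m)
    case 0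
    have "X * gsys t h j 0 - t *\<^sub>R gsys t h j (Suc 0) = (1 / t) *\<^sub>R (b * h j - t\<^sup>2 *\<^sub>R h j)" for j
      using t by (simp add: gsys_def scaleR_diff_right power2_eq_square mult.assoc)
    moreover have "(\<lambda>j. (1 / t) *\<^sub>R (b * h j - t\<^sup>2 *\<^sub>R h j)) \<longlonglongrightarrow> (1 / t) *\<^sub>R 0"
      by (intro tendsto_scaleR tendsto_const lim')
    ultimately show ?thesis using 0 by simp
  qed (simp add: gsys_def)
  have 2: "star X * gsys t h j 0 = 0" for j
    using star_X_star_X_h[OF F] by (simp add: gsys_def)
  have 3: "star X * gsys t h j (Suc m) - (if m = 0 then t else 1) *\<^sub>R gsys t h j m = 0" for j m
  proof (cases m)
    case 0
    then show ?thesis using t by (simp add: gsys_def)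
  next
    case (Suc k)
    then show ?thesis using a_power_h[OF F[of j], of k] by (simp add: gsys_def)
  qed
  \<comment> \<open>The squares at positions 1, 2, ... equal h^2 exactly; at position 0 the square
    is \<open>h b h / t^2\<close>, which is close to h^2.\<close>
  define k where "k j = h j * h j" for j
  have k: "star (k j) = k j" "norm (k j) = 1" for j
  proof -
    have sh: "star (h j) = h j" using sa by (simp add: h_def)
    show "star (k j) = k j" by (simp add: k_def star_mult sh)
    have "norm (star (h j) * h j) = 1" by (simp only: cstar_identity) (simp add: h_def n1)
    then show "norm (k j) = 1" by (simp add: k_def sh)
  qed
  have 4: "(\<lambda>j. star (gsys t h j m) * gsys t h j n - (if m = n then k j else 0)) \<longlonglongrightarrow> 0" for m n
  proof -
    have sh: "star (h j) = h j" for j using sa by (simp add: h_def)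
    have hX: "h j * (X * ((*) X ^^ i) (h j)) = 0" for i j by (rule h_power_h[OF F])
    have hX': "star (((*) X ^^ i) (h j)) * (star X * h j) = 0" for i j
    proof -
      have "star (h j * (X * ((*) X ^^ i) (h j))) = star (((*) X ^^ i) (h j)) * (star X * h j)"
        by (simp add: star_mult sh mult.assoc)
      then show ?thesis by (simp add: hX)
    qed
    consider "m = 0" "n = 0" | i where "m = 0" "n = Suc i" | i where "m = Suc i" "n = 0"
      | i i' where "m = Suc i" "n = Suc i'"
      by (cases m; cases n) auto
    then show ?thesis
    proof cases
      case 1
      have "star (gsys t h j 0) * gsys t h j 0 - k j = (1 / t\<^sup>2) *\<^sub>R (h j * (b * h j - t\<^sup>2 *\<^sub>R h j))" for j
        using t by (simp add: gsys_def k_def star_scaleR star_mult star_star sh right_diff_distrib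
            scaleR_diff_right power2_eq_square mult.assoc)
      moreover have "(\<lambda>j. (1 / t\<^sup>2) *\<^sub>R (h j * (b * h j - t\<^sup>2 *\<^sub>R h j))) \<longlonglongrightarrow> (1 / t\<^sup>2) *\<^sub>R 0"
      proof (intro tendsto_scaleR tendsto_const null_of_bounded_below[OF lim' less_numeral_extra(1)])
        show "1 * norm (h j * (b * h j - t\<^sup>2 *\<^sub>R h j)) \<le> norm (b * h j - t\<^sup>2 *\<^sub>R h j)" for j
          using norm_mult_ineq[of "h j" "b * h j - t\<^sup>2 *\<^sub>R h j"] by (simp add: h_def n1)
      qed
      ultimately show ?thesis using 1 by simp
    next
      case 2
      then show ?thesis by (simp add: gsys_def star_scaleR star_mult star_star sh mult.assoc hX)
    next
      case 3
      then show ?thesis by (simp add: gsys_def hX')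
    next
      case 4
      then show ?thesis by (cases "i = i'") (simp_all add: gsys_def power_h_orthogonal[OF F] k_def)
    qed
  qed
  show ?thesis
    unfolding h_def[symmetric] sysT_def
  proof (intro conjI allI exI[of _ k])
    show "(\<lambda>j. star X * gsys t h j 0) \<longlonglongrightarrow> 0" by (simp add: 2)
    show "(\<lambda>j. star X * gsys t h j (Suc m) - (if m = 0 then t else 1) *\<^sub>R gsys t h j m) \<longlonglongrightarrow> 0" for m
      unfolding 3 by simp
  qed (rule 1 k 4)+
qed

text \<open>The usual approximate eigenvectors of a shift: L orthogonal vectors X^n h with phases
  form a sum of norm \<open>sqrt L\<close>, while X and \<open>star X\<close> miss the eigenvalue
  only by boundary terms of bounded norm.\<close>

lemma sysC_exists:
  assumes f: "continuous_on UNIV f" "f 0 = 0" "f 1 = 0"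
    and sa: "star (cfc b f) = cfc b f" and n1: "norm (cfc b f) = 1" and z: "cmod z = 1"
  shows "\<exists>x. sysC z x \<and> (\<forall>j. norm (x j) = 1)"
proof -
  define h where "h = cfc b f"
  note F = f sa h_def
  have zz: "z * cnj z = 1" using z by (simp add: complex_norm_square[symmetric])
  define w where "w = cnj z"
  have wz: "z * w = 1" "w * z = 1" "cnj w = z" using zz by (simp_all add: w_def mult.commute)
  define u where "u L = (\<Sum>n<L. w ^ n *\<^sub>C ((*) X ^^ n) h)" for L
  have "norm (star h * h) = 1" by (simp only: cstar_identity) (simp add: h_def n1)
  then have nhh: "norm (h * h) = 1" by (simp add: sa_h[OF F])
  have nX: "norm (((*) X ^^ n) h) = 1" for n
    using power_h_orthogonal[OF F, of n n] nhh cstar_norm_sqrt[of "((*) X ^^ n) h"] by simp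
  have "star (u L) * u L = real L *\<^sub>R (h * h)" for L
  proof -
    have "star (u L) * u L = (\<Sum>m<L. \<Sum>n<L. (cnj (w ^ m) * w ^ n) *\<^sub>C (star (((*) X ^^ m) h) * ((*) X ^^ n) h))"
      by (simp add: u_def star_sum star_scaleC sum_product mult_scaleC_left mult_scaleC_right
          scaleC_scaleC mult.commute del: complex_cnj_power)
    also have "\<dots> = (\<Sum>m<L. \<Sum>n<L. if m = n then h * h else 0)"
    proof (intro sum.cong refl)
      fix m n
      have "cnj (w ^ m) * w ^ m = 1" by (simp add: wz power_mult_distrib[symmetric])
      then show "(cnj (w ^ m) * w ^ n) *\<^sub>C (star (((*) X ^^ m) h) * ((*) X ^^ n) h) = (if m = n then h * h else 0)"
        by (cases "m = n") (simp_all add: power_h_orthogonal[OF F])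
    qed
    also have "\<dots> = (\<Sum>m<L. h * h)" by (intro sum.cong refl) simp
    also have "\<dots> = real L *\<^sub>R (h * h)" by (simp add: scaleR_conv_of_real sum_constant_scaleR)
    finally show ?thesis .
  qed
  then have nu: "norm (u L) = sqrt L" for L
    by (simp add: cstar_norm_sqrt[of "u L"] nhh)
  have tele: "X * u L = z *\<^sub>C u L + z *\<^sub>C (w ^ L *\<^sub>C ((*) X ^^ L) h - h)" for L
  proof (induction L)
    case (Suc L)
    have "u (Suc L) = u L + w ^ L *\<^sub>C ((*) X ^^ L) h" by (simp add: u_def)
    then show ?case using Suc wz
      by (simp add: distrib_left scaleC_add_right scaleC.diff_right scaleC_scaleC mult_scaleC_right mult.assoc[symmetric])
  qed (simp add: u_def)
  have tele': "star X * u (Suc L) = cnj z *\<^sub>C u L + star X * h" for L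
  proof -
    have "star X * u (Suc L) = (\<Sum>n<Suc L. w ^ n *\<^sub>C (star X * ((*) X ^^ n) h))"
      by (simp add: u_def sum_distrib_left mult_scaleC_right del: sum.lessThan_Suc)
    also have "\<dots> = star X * h + (\<Sum>n<L. w ^ Suc n *\<^sub>C (star X * (X * ((*) X ^^ n) h)))"
      by (subst sum.lessThan_Suc_shift) simp
    also have "(\<Sum>n<L. w ^ Suc n *\<^sub>C (star X * (X * ((*) X ^^ n) h))) = cnj z *\<^sub>C u L"
      by (simp add: a_power_h[OF F] u_def scaleC.sum_right scaleC_scaleC w_def)
    finally show ?thesis by simp
  qed
  define x where "x j = (1 / sqrt (Suc j)) *\<^sub>R u (Suc j)" for j
  have "norm (x j) = 1" for j by (simp add: x_def nu)
  moreover have small: "(\<lambda>j. K / sqrt (Suc j)) \<longlonglongrightarrow> 0" for K :: real by real_asymp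
  have "sysC z x"
    unfolding sysC_def
  proof (intro conjI z)
    show "(\<lambda>j. X * x j - z *\<^sub>C x j) \<longlonglongrightarrow> 0"
    proof (rule Lim_null_comparison[OF _ small[of 2]], intro always_eventually allI)
      fix j
      have "X * x j - z *\<^sub>C x j = (1 / sqrt (Suc j)) *\<^sub>R (z *\<^sub>C (w ^ Suc j *\<^sub>C ((*) X ^^ Suc j) h - h))"
        by (simp only: x_def mult_scaleR_right scaleC_scaleR scaleR_diff_right[symmetric] tele) simp
      also have "norm \<dots> \<le> 1 / sqrt (Suc j) * 2"
      proof -
        have "norm (w ^ Suc j *\<^sub>C ((*) X ^^ Suc j) h - h) \<le> 1 + 1"
          using nX[of "Suc j"] nX[of 0] z
          by (intro order_trans[OF norm_triangle_ineq4] add_mono) (simp_all add: norm_scaleC norm_power w_def norm_mult)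
        then show ?thesis using z by (simp add: norm_scaleC divide_right_mono del: funpow.simps power_Suc)
      qed
      finally show "norm (X * x j - z *\<^sub>C x j) \<le> 2 / sqrt (Suc j)" by simp
    qed
    show "(\<lambda>j. star X * x j - cnj z *\<^sub>C x j) \<longlonglongrightarrow> 0"
    proof (rule Lim_null_comparison[OF _ small[of "norm (star X * h) + 1"]], intro always_eventually allI)
      fix j
      have uS: "u (Suc j) = u j + w ^ j *\<^sub>C ((*) X ^^ j) h" by (simp add: u_def)
      have "star X * u (Suc j) - cnj z *\<^sub>C u (Suc j) = star X * h - cnj z *\<^sub>C (w ^ j *\<^sub>C ((*) X ^^ j) h)"
        by (simp only: tele') (simp add: uS scaleC_add_right)
      then have "star X * x j - cnj z *\<^sub>C x j = (1 / sqrt (Suc j)) *\<^sub>R (star X * h - cnj z *\<^sub>C (w ^ j *\<^sub>C ((*) X ^^ j) h))"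
        by (simp only: x_def mult_scaleR_right scaleC_scaleR scaleR_diff_right[symmetric])
      also have "norm \<dots> \<le> 1 / sqrt (Suc j) * (norm (star X * h) + 1)"
      proof -
        have "norm (star X * h - cnj z *\<^sub>C (w ^ j *\<^sub>C ((*) X ^^ j) h)) \<le> norm (star X * h) + 1"
          using nX[of j] z
          by (intro order_trans[OF norm_triangle_ineq4] add_mono) (simp_all add: norm_scaleC norm_power w_def)
        then show ?thesis by (simp add: divide_right_mono)
      qed
      finally show "norm (star X * x j - cnj z *\<^sub>C x j) \<le> (norm (star X * h) + 1) / sqrt (Suc j)" by simp
    qed
  qed
  ultimately show ?thesis by blast
qed

end

section \<open>Toeplitz matrices and determinants\<close>

lemma roots_of_unity_orthogonal:
  assumes R: "R > 0" "i < R" "k < R"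
  shows "(\<Sum>j<R. cis (2 * pi * real j / real R) ^ i * cnj (cis (2 * pi * real j / real R) ^ k))
    = (if i = k then of_nat R else 0)"
proof -
  define w where "w i = cis (2 * pi * real i / real R)" for i
  define q where "q = w i * cnj (w k)"
  have term_eq: "w j ^ i * cnj (w j ^ k) = q ^ j" for j
    by (simp add: w_def q_def Complex.DeMoivre cis_cnj cis_mult power_mult_distrib algebra_simps)
  have ww: "w k * cnj (w k) = 1" for k by (simp add: w_def cis_cnj cis_mult)
  have wR: "w l ^ R = 1" for l
  proof -
    have "real R * (2 * pi * real l / real R) = 2 * pi * real l" using R by simp
    then show ?thesis by (simp only: w_def Complex.DeMoivre cis_multiple_2pi Ints_of_nat)
  qed
  have "q ^ R = 1"
    by (simp add: q_def power_mult_distrib wR flip: complex_cnj_power)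
  have "q = 1 \<longleftrightarrow> i = k"
  proof
    assume "q = 1"
    have "w i = w i * (w k * cnj (w k))" by (simp only: ww mult_1_right)
    also have "\<dots> = q * w k" by (simp add: q_def)
    finally have "w i = w k" using \<open>q = 1\<close> by simp
    moreover have "inj_on w {..<R}"
      using Complex.bij_betw_roots_unity[OF R(1)] by (simp add: bij_betw_def w_def[abs_def])
    ultimately show "i = k" using R by (auto dest: inj_onD)
  qed (simp add: q_def ww)
  moreover have "(\<Sum>j<R. q ^ j) = 0" if "q \<noteq> 1"
    using geometric_sum[OF that, of R] \<open>q ^ R = 1\<close> by simp
  ultimately have "(\<Sum>j<R. q ^ j) = (if i = k then of_nat R else 0)" by auto
  then show ?thesis by (simp add: term_eq[symmetric] w_def)
qed

lemma parseval_roots_of_unity: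
  fixes p :: "complex poly"
  assumes R: "R > 0" "degree p < R"
  shows "(\<Sum>j<R. (cmod (poly p (cis (2 * pi * real j / real R))))\<^sup>2) = real R * (\<Sum>i<R. (cmod (coeff p i))\<^sup>2)"
proof -
  define w where "w j = cis (2 * pi * real j / real R)" for j
  have p: "poly p z = (\<Sum>i<R. coeff p i * z ^ i)" for z
    unfolding poly_altdef using R(2) by (intro sum.mono_neutral_left) (auto simp: coeff_eq_0)
  have "complex_of_real (\<Sum>j<R. (cmod (poly p (w j)))\<^sup>2)
      = (\<Sum>j<R. \<Sum>i<R. \<Sum>k<R. (coeff p i * cnj (coeff p k)) * (w j ^ i * cnj (w j ^ k)))"
    unfolding of_real_sum complex_norm_square p
    by (simp add: sum_product algebra_simps)
  also have "\<dots> = (\<Sum>i<R. \<Sum>k<R. \<Sum>j<R. (coeff p i * cnj (coeff p k)) * (w j ^ i * cnj (w j ^ k)))"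
    by (subst sum.swap) (intro sum.cong refl sum.swap)
  also have "\<dots> = (\<Sum>i<R. \<Sum>k<R. if i = k then of_nat R * (coeff p i * cnj (coeff p i)) else 0)"
  proof (intro sum.cong refl)
    fix i k assume ik: "i \<in> {..<R}" "k \<in> {..<R}"
    have "(\<Sum>j<R. (coeff p i * cnj (coeff p k)) * (w j ^ i * cnj (w j ^ k)))
        = (coeff p i * cnj (coeff p k)) * (if i = k then of_nat R else 0)"
      unfolding sum_distrib_left[symmetric] w_def using roots_of_unity_orthogonal[of R i k] R ik by simp
    then show "(\<Sum>j<R. (coeff p i * cnj (coeff p k)) * (w j ^ i * cnj (w j ^ k)))
        = (if i = k then of_nat R * (coeff p i * cnj (coeff p i)) else 0)"
      by auto
  qed
  also have "\<dots> = (\<Sum>i<R. of_nat R * (coeff p i * cnj (coeff p i)))"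
    by (intro sum.cong refl) simp
  also have "\<dots> = complex_of_real (real R * (\<Sum>i<R. (cmod (coeff p i))\<^sup>2))"
    by (simp add: complex_norm_square sum_distrib_left del: of_real_power)
  finally show ?thesis unfolding w_def of_real_eq_iff .
qed

text \<open>Compressing multiplication by the symbol does not increase the norm; the multiplication
  is carried out on polynomials, and the norms are computed at roots of unity.\<close>

lemma toeplitz_bound:
  assumes c: "\<And>k. int N < \<bar>k\<bar> \<Longrightarrow> c k = 0"
    and le: "\<And>z. cmod z = 1 \<Longrightarrow> cmod (symb c N z) \<le> \<tau>"
  shows "L2_set (\<lambda>m. cmod (\<Sum>n<L. c (int m - int n) * \<xi> n)) {..<M} \<le> \<tau> * L2_set (\<lambda>n. cmod (\<xi> n)) {..<L}"
proof -
  have \<tau>: "\<tau> \<ge> 0" using order_trans[OF norm_ge_zero le[of 1]] by simp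
  \<comment> \<open>z^N times the symbol, so that the negative powers disappear; coefficients of p q
    are therefore read at m + N.\<close>
  define p where "p = (\<Sum>i\<le>2 * N. monom (c (int i - int N)) i)"
  define q where "q = (\<Sum>n<L. monom (\<xi> n) n)"
  have cp: "coeff p i = c (int i - int N)" for i
    unfolding p_def coeff_sum coeff_monom using c[of "int i - int N"] by (cases "i \<le> 2 * N") auto
  have cq: "coeff q n = (if n < L then \<xi> n else 0)" for n
    unfolding q_def coeff_sum coeff_monom by auto
  have cpq: "coeff (p * q) (m + N) = (\<Sum>n<L. c (int m - int n) * \<xi> n)" for m
  proof -
    have "coeff (p * q) (m + N) = (\<Sum>i\<le>m + N. coeff q i * coeff p (m + N - i))"
      by (simp only: mult.commute[of p] coeff_mult)
    also have "\<dots> = (\<Sum>i\<in>{..m + N} \<union> {..<L}. c (int m - int i) * (if i < L then \<xi> i else 0))"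
      by (rule sum.mono_neutral_cong_left) (auto simp: cp cq of_nat_diff c algebra_simps)
    also have "\<dots> = (\<Sum>n<L. c (int m - int n) * \<xi> n)"
      by (rule sum.mono_neutral_cong_right) auto
    finally show ?thesis .
  qed
  have pz: "poly p z = z ^ N * symb c N z" if z: "cmod z = 1" for z
  proof -
    have "z \<noteq> 0" using z by auto
    have "symb c N z = (\<Sum>i\<le>2 * N. c (int i - int N) * z powi (int i - int N))"
      unfolding symb_def
      by (rule sum.reindex_bij_witness[of _ "\<lambda>i. int i - int N" "\<lambda>k. nat (k + int N)"]) auto
    moreover have "z ^ N * (u * z powi (int i - int N)) = u * z ^ i" for u i
      using \<open>z \<noteq> 0\<close> by (simp add: power_int_diff)
    ultimately show ?thesis
      by (simp only: p_def poly_sum poly_monom sum_distrib_left)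
  qed
  \<comment> \<open>Large enough to exceed both the degree 2 N + L of p q and the last index M + N
    that is read off.\<close>
  define R where "R = M + 3 * N + L + 1"
  have dp: "degree p \<le> 2 * N"
    by (rule degree_le) (auto simp: cp intro: c)
  have dq: "degree q \<le> L"
    by (rule degree_le) (auto simp: cq)
  have "degree (p * q) \<le> 2 * N + L" using degree_mult_le[of p q] dp dq by linarith
  then have R: "R > 0" "degree (p * q) < R" "degree q < R" using dq by (auto simp: R_def)
  define w where "w j = cis (2 * pi * real j / real R)" for j
  have "(\<Sum>m<M. (cmod (\<Sum>n<L. c (int m - int n) * \<xi> n))\<^sup>2) = (\<Sum>i\<in>{N..<M + N}. (cmod (coeff (p * q) i))\<^sup>2)"
    by (rule sum.reindex_bij_witness[of _ "\<lambda>i. i - N" "\<lambda>m. m + N"]) (auto simp: cpq)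
  also have "\<dots> \<le> (\<Sum>i<R. (cmod (coeff (p * q) i))\<^sup>2)"
    by (rule sum_mono2) (auto simp: R_def)
  finally have 1: "real R * (\<Sum>m<M. (cmod (\<Sum>n<L. c (int m - int n) * \<xi> n))\<^sup>2)
      \<le> (\<Sum>j<R. (cmod (poly (p * q) (w j)))\<^sup>2)"
    unfolding w_def parseval_roots_of_unity[OF R(1,2)] by (intro mult_left_mono) auto
  have "(\<Sum>j<R. (cmod (poly (p * q) (w j)))\<^sup>2) \<le> (\<Sum>j<R. \<tau>\<^sup>2 * (cmod (poly q (w j)))\<^sup>2)"
  proof (rule sum_mono)
    fix j
    have w1: "cmod (w j) = 1" by (simp add: w_def)
    have "cmod (poly (p * q) (w j)) = cmod (symb c N (w j)) * cmod (poly q (w j))"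
      by (simp add: pz[OF w1] norm_mult norm_power w1)
    also have "\<dots> \<le> \<tau> * cmod (poly q (w j))" by (intro mult_right_mono le w1) simp
    finally show "(cmod (poly (p * q) (w j)))\<^sup>2 \<le> \<tau>\<^sup>2 * (cmod (poly q (w j)))\<^sup>2"
      by (simp add: power_mono flip: power_mult_distrib)
  qed
  also have "\<dots> = \<tau>\<^sup>2 * (real R * (\<Sum>i<R. (cmod (coeff q i))\<^sup>2))"
    unfolding w_def sum_distrib_left[symmetric] parseval_roots_of_unity[OF R(1,3)] ..
  also have "(\<Sum>i<R. (cmod (coeff q i))\<^sup>2) = (\<Sum>n<L. (cmod (\<xi> n))\<^sup>2)"
    by (rule sum.mono_neutral_cong_right) (auto simp: cq R_def)
  finally have "real R * (\<Sum>m<M. (cmod (\<Sum>n<L. c (int m - int n) * \<xi> n))\<^sup>2) \<le> real R * (\<tau>\<^sup>2 * (\<Sum>n<L. (cmod (\<xi> n))\<^sup>2))"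
    using 1 by (simp add: mult.left_commute)
  then have "(\<Sum>m<M. (cmod (\<Sum>n<L. c (int m - int n) * \<xi> n))\<^sup>2) \<le> \<tau>\<^sup>2 * (\<Sum>n<L. (cmod (\<xi> n))\<^sup>2)"
    using R(1) by simp
  then have "L2_set (\<lambda>m. cmod (\<Sum>n<L. c (int m - int n) * \<xi> n)) {..<M} \<le> sqrt (\<tau>\<^sup>2 * (\<Sum>n<L. (cmod (\<xi> n))\<^sup>2))"
    unfolding L2_set_def by (rule real_sqrt_le_mono)
  then show ?thesis using \<tau> by (simp add: L2_set_def real_sqrt_mult)
qed

section \<open>Determinants of finite corners\<close>

abbreviation corner :: "nat \<Rightarrow> (nat \<Rightarrow> nat \<Rightarrow> complex) \<Rightarrow> complex Matrix.mat" where
  "corner n G \<equiv> Matrix.mat n n (\<lambda>(i, j). G i j)"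

lemma det_corner: "Determinant.det (corner n G) = (\<Sum>p | p permutes {0..<n}. signof p * (\<Prod>i = 0..<n. G i (p i)))"
proof -
  have "Determinant.det (corner n G) = (\<Sum>p | p permutes {0..<n}. signof p * (\<Prod>i = 0..<n. corner n G $$ (i, p i)))"
    by (rule det_def') simp
  also have "\<dots> = (\<Sum>p | p permutes {0..<n}. signof p * (\<Prod>i = 0..<n. G i (p i)))"
    by (intro sum.cong refl arg_cong2[of _ _ _ _ "(*)"] prod.cong)
      (auto dest: permutes_in_image)
  finally show ?thesis .
qed

lemma continuous_det_corner:
  fixes G :: "real \<Rightarrow> nat \<Rightarrow> nat \<Rightarrow> complex"
  assumes "\<And>m n. continuous_on S (\<lambda>t. G t m n)"
  shows "continuous_on S (\<lambda>t. Determinant.det (corner n (G t)))"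
  unfolding det_corner by (intro continuous_intros assms)

lemma det_corner_hermitian:
  assumes "\<And>m k. G k m = cnj (G m k)"
  shows "Im (Determinant.det (corner n G)) = 0"
proof -
  have "cnj (Determinant.det (corner n G)) = Determinant.det (corner n (\<lambda>i j. cnj (G i j)))"
    unfolding det_corner by (simp add: sign_def)
  also have "corner n (\<lambda>i j. cnj (G i j)) = transpose_mat (corner n G)"
    by (rule eq_matI) (auto simp: assms[symmetric])
  also have "Determinant.det (transpose_mat (corner n G)) = Determinant.det (corner n G)"
    by (rule Determinant.det_transpose) (rule mat_carrier)
  finally show ?thesis by (simp add: complex_eq_iff)
qed

lemma det_corner_nonzero:
  assumes inj: "\<And>\<xi> :: nat \<Rightarrow> complex. (\<And>m. m < n \<Longrightarrow> (\<Sum>k<n. G m k * \<xi> k) = 0) \<Longrightarrow> (\<And>k. k < n \<Longrightarrow> \<xi> k = 0)"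
  shows "Determinant.det (corner n G) \<noteq> 0"
proof
  assume "Determinant.det (corner n G) = 0"
  then obtain v where v: "v \<in> carrier_vec n" "v \<noteq> 0\<^sub>v n" "corner n G *\<^sub>v v = 0\<^sub>v n"
    using det_0_iff_vec_prod_zero[of "corner n G" n] by auto
  have "(\<Sum>k<n. G m k * vec_index v k) = 0" if m: "m < n" for m
  proof -
    have "vec_index (corner n G *\<^sub>v v) m = (\<Sum>k = 0..<n. G m k * vec_index v k)"
      using m v(1) by (simp add: scalar_prod_def)
    then show ?thesis using v(3) m by (simp add: atLeast0LessThan)
  qed
  then have "vec_index v k = 0" if "k < n" for k using inj[of "\<lambda>k. vec_index v k"] that by blast
  then have "v = 0\<^sub>v n" using v(1) by (intro eq_vecI) auto
  with v(2) show False ..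
qed

text \<open>Column l of the inverse matrix, by Cramer's rule.\<close>

lemma corner_solve:
  assumes inj: "\<And>\<xi> :: nat \<Rightarrow> complex. (\<And>m. m < n \<Longrightarrow> (\<Sum>k<n. G m k * \<xi> k) = 0) \<Longrightarrow> (\<And>k. k < n \<Longrightarrow> \<xi> k = 0)"
    and l: "l < n"
  shows "\<exists>\<eta>. \<forall>m<n. (\<Sum>k<n. G m k * \<eta> k) = (if m = l then 1 else 0)"
proof -
  let ?A = "corner n G"
  have A: "?A \<in> carrier_mat n n" by simp
  have d: "Determinant.det ?A \<noteq> 0" by (rule det_corner_nonzero) (rule inj)
  have "(\<Sum>k<n. G m k * (adj_mat ?A $$ (k, l) / Determinant.det ?A)) = (if m = l then 1 else 0)" if m: "m < n" for m
  proof -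
    have "(?A * adj_mat ?A) $$ (m, l) = (\<Sum>k = 0..<n. G m k * adj_mat ?A $$ (k, l))"
      using m l adj_mat(1)[OF A] by (simp add: scalar_prod_def)
    moreover have "(?A * adj_mat ?A) $$ (m, l) = Determinant.det ?A * (if m = l then 1 else 0)"
      unfolding adj_mat(2)[OF A] using m l by simp
    ultimately have "(\<Sum>k<n. G m k * adj_mat ?A $$ (k, l)) = Determinant.det ?A * (if m = l then 1 else 0)"
      by (simp add: atLeast0LessThan)
    then show ?thesis using d by (simp add: sum_divide_distrib[symmetric])
  qed
  then show ?thesis by (intro exI[of _ "\<lambda>k. adj_mat ?A $$ (k, l) / Determinant.det ?A"]) blast
qed

text \<open>Passing from \<open>t = 1\<close> to \<open>t = 0\<close> the extra eigenvalue 1 at the end becomes an extra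
  eigenvalue \<open>-1\<close> at the beginning, so the real determinant would change sign without vanishing.\<close>

lemma determinant_sign_change:
  fixes G :: "real \<Rightarrow> nat \<Rightarrow> nat \<Rightarrow> complex"
  assumes cont: "\<And>m n. continuous_on UNIV (\<lambda>t. G t m n)"
    and herm: "\<And>t m n. t \<in> {0..1} \<Longrightarrow> G t n m = cnj (G t m n)"
    and inj: "\<And>t \<xi> k. t \<in> {0..1} \<Longrightarrow> (\<And>m. m < Suc K \<Longrightarrow> (\<Sum>n<Suc K. G t m n * \<xi> n) = 0) \<Longrightarrow> k < Suc K \<Longrightarrow> \<xi> k = 0"
    and G0: "G 0 0 0 = -1" "\<And>n. G 0 0 (Suc n) = 0" "\<And>m n. G 0 (Suc m) (Suc n) = G 1 m n"
    and G1: "\<And>n. n \<le> K \<Longrightarrow> G 1 K n = (if n = K then 1 else 0)"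
  shows False
proof -
  define D where "D t = Determinant.det (corner (Suc K) (G t))" for t
  have Im: "Im (D t) = 0" if "t \<in> {0..1}" for t
    unfolding D_def by (rule det_corner_hermitian) (rule herm[OF that])
  have nz: "D t \<noteq> 0" if "t \<in> {0..1}" for t
    unfolding D_def by (rule det_corner_nonzero) (rule inj[OF that])
  have contD: "continuous_on {0..1} (\<lambda>t. Re (D t))"
    unfolding D_def by (intro continuous_intros continuous_det_corner continuous_on_subset[OF cont]) simp
  have D0: "D 0 = - Determinant.det (corner K (G 1))"
  proof -
    have "D 0 = (\<Sum>j<Suc K. corner (Suc K) (G 0) $$ (0, j) * cofactor (corner (Suc K) (G 0)) 0 j)"
      unfolding D_def by (rule laplace_expansion_row) auto
    also have "\<dots> = (\<Sum>j<Suc K. if j = 0 then - cofactor (corner (Suc K) (G 0)) 0 0 else 0)"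
    proof (intro sum.cong refl)
      fix j assume j: "j \<in> {..<Suc K}"
      show "corner (Suc K) (G 0) $$ (0, j) * cofactor (corner (Suc K) (G 0)) 0 j
          = (if j = 0 then - cofactor (corner (Suc K) (G 0)) 0 0 else 0)"
        using j by (cases j) (auto simp: G0)
    qed
    also have "\<dots> = - cofactor (corner (Suc K) (G 0)) 0 0" by simp
    also have "cofactor (corner (Suc K) (G 0)) 0 0 = Determinant.det (mat_delete (corner (Suc K) (G 0)) 0 0)"
      by (simp add: cofactor_def)
    also have "mat_delete (corner (Suc K) (G 0)) 0 0 = corner K (G 1)"
      by (rule eq_matI) (auto simp: mat_delete_def G0)
    finally show ?thesis .
  qed
  have D1: "D 1 = Determinant.det (corner K (G 1))"
  proof -
    have "D 1 = (\<Sum>j<Suc K. corner (Suc K) (G 1) $$ (K, j) * cofactor (corner (Suc K) (G 1)) K j)"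
      unfolding D_def by (rule laplace_expansion_row) auto
    also have "\<dots> = (\<Sum>j<Suc K. if j = K then cofactor (corner (Suc K) (G 1)) K K else 0)"
      by (intro sum.cong refl) (auto simp: G1)
    also have "\<dots> = cofactor (corner (Suc K) (G 1)) K K" by simp
    also have "\<dots> = Determinant.det (mat_delete (corner (Suc K) (G 1)) K K)"
      by (simp add: cofactor_def)
    also have "mat_delete (corner (Suc K) (G 1)) K K = corner K (G 1)"
      by (rule eq_matI) (auto simp: mat_delete_def)
    finally show ?thesis .
  qed
  have opp: "Re (D 0) = - Re (D 1)" by (simp add: D0 D1)
  have "\<exists>t\<ge>0. t \<le> 1 \<and> Re (D t) = 0"
  proof (cases "Re (D 0) \<le> 0")
    case True
    then show ?thesis using IVT'[of "\<lambda>t. Re (D t)" 0 0 1] contD opp by simp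
  next
    case False
    then show ?thesis using IVT2'[of "\<lambda>t. Re (D t)" 1 0 0] contD opp by simp
  qed
  then obtain t where "t \<in> {0..1}" "Re (D t) = 0" by auto
  with Im nz show False by (simp add: complex_eq_iff)
qed

section \<open>Projections have vanishing symbol\<close>

text \<open>2 P - 1 is a self-adjoint unitary, hence isometric on vectors.\<close>

lemma norm_half_projection:
  fixes P :: "'a::cstar_algebra"
  assumes "P * P = P" "star P = P"
  shows "norm ((- (1/2)) *\<^sub>C x + P * x) = norm x / 2"
proof -
  define u where "u = P * x + P * x - x"
  have PP: "P * (P * x) = P * x" by (simp add: assms(1) mult.assoc[symmetric])
  have "star u * u = star x * x"
    by (simp add: u_def star_diff star_add star_mult assms(2) algebra_simps PP)
  then have "norm u = norm x" by (metis cstar_norm_sqrt)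
  moreover have "(- (1/2)) *\<^sub>C x + P * x = (1/2) *\<^sub>C u"
  proof -
    have "(1/2) *\<^sub>C (P * x) + (1/2) *\<^sub>C (P * x) = P * x"
      by (simp flip: scaleC_add_left)
    then show ?thesis by (simp add: u_def scaleC_add_right scaleC.diff_right scaleC.minus_left)
  qed
  ultimately show ?thesis by (simp add: norm_scaleC)
qed

text \<open>Carries closed conditions on the matrices F t from the open interval, where shift
  systems exist, to the end points needed for the sign change.\<close>

lemma interval_subset_closed:
  fixes S :: "real set"
  assumes "closed S" "{0<..<1} \<subseteq> S"
  shows "{0..1} \<subseteq> S"
  using closure_minimal[OF assms(2,1)] by (simp add: closure_greaterThanLessThan)

lemma L2_set_zero_imp:
  fixes \<xi> :: "nat \<Rightarrow> complex"
  assumes "L2_set (\<lambda>n. cmod (\<xi> n)) {..<L} = 0" "n < L"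
  shows "\<xi> n = 0"
  using assms L2_set_eq_0_iff[of "{..<L}" "\<lambda>n. cmod (\<xi> n)"] by simp

context scaling
begin

lemma generic_bump:
  assumes s: "s \<in> sig b" "s \<noteq> 0" "s \<noteq> 1"
  obtains f :: "nat \<Rightarrow> real \<Rightarrow> complex" where
    "\<And>j. continuous_on UNIV (f j)" "\<And>j. f j 0 = 0" "\<And>j. f j 1 = 0"
    "\<And>j. star (cfc b (f j)) = cfc b (f j)" "\<And>j. norm (cfc b (f j)) = 1"
    "(\<lambda>j. b * cfc b (f j) - of_real s *\<^sub>C cfc b (f j)) \<longlonglongrightarrow> 0"
proof -
  have e: "\<bar>1 - s\<bar> > 0" using s by simp
  show thesis
  proof (rule bump_sequence[OF sa_b s(1,2) e])
    fix f :: "nat \<Rightarrow> real \<Rightarrow> complex"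
    assume f: "\<And>j. continuous_on UNIV (f j)" "\<And>j. f j 0 = 0" "\<And>j u. \<bar>1 - s\<bar> \<le> \<bar>u - s\<bar> \<Longrightarrow> f j u = 0"
      "\<And>j. star (cfc b (f j)) = cfc b (f j)" "\<And>j. norm (cfc b (f j)) = 1"
      "(\<lambda>j. b * cfc b (f j) - of_real s *\<^sub>C cfc b (f j)) \<longlonglongrightarrow> 0"
    show thesis by (rule that[of f]) (use f in auto)
  qed
qed

lemma sysT_exists:
  assumes "t > 0" "t \<noteq> 1" "t\<^sup>2 \<in> sig b"
  shows "\<exists>v. sysT t v"
proof -
  have "t\<^sup>2 \<noteq> 0" "t\<^sup>2 \<noteq> 1" using assms by (auto simp: power2_eq_1_iff)
  show ?thesis
  proof (rule generic_bump[OF assms(3) \<open>t\<^sup>2 \<noteq> 0\<close> \<open>t\<^sup>2 \<noteq> 1\<close>])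
    fix f :: "nat \<Rightarrow> real \<Rightarrow> complex"
    assume f: "\<And>j. continuous_on UNIV (f j)" "\<And>j. f j 0 = 0" "\<And>j. f j 1 = 0"
      "\<And>j. star (cfc b (f j)) = cfc b (f j)" "\<And>j. norm (cfc b (f j)) = 1"
      "(\<lambda>j. b * cfc b (f j) - of_real (t\<^sup>2) *\<^sub>C cfc b (f j)) \<longlonglongrightarrow> 0"
    show ?thesis using sysT_gsys[OF f assms(1)] by blast
  qed
qed

text \<open>The entry of row m and column n is recovered from
  \<open>star (v j m) * (y * v j n)\<close> as the coefficient of \<open>k j\<close>, and taking
  adjoints exchanges the two indices.\<close>

lemma represents_hermitian:
  assumes r: "represents y F c N" and sa: "star y = y" and v: "sysT t v"
  shows "F t n m = cnj (F t m n)"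
proof -
  obtain k where k: "\<And>j. star (k j) = k j" "\<And>j. norm (k j) = 1"
      "\<And>m n. (\<lambda>j. star (v j m) * v j n - (if m = n then k j else 0)) \<longlonglongrightarrow> 0"
    using v unfolding sysT_def by blast
  have nv: "(\<lambda>j. norm (v j m)) \<longlonglongrightarrow> L2_set (\<lambda>i. cmod (if i = m then 1 else 0)) {..<Suc m}" for m
  proof -
    have "vec_sum v (\<lambda>i. if i = m then 1 else 0) (Suc m) j = v j m" for j
    proof -
      have "vec_sum v (\<lambda>i. if i = m then 1 else 0) (Suc m) j = (\<Sum>i<Suc m. if i = m then v j m else 0)"
        unfolding vec_sum_def by (intro sum.cong refl) auto
      then show ?thesis by simp
    qed
    then show ?thesis using norm_vec_sum[OF v, of "\<lambda>i. if i = m then 1 else 0" "Suc m"] by simp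
  qed
  have key: "(\<lambda>j. star (v j m) * (y * v j n) - F t m n *\<^sub>C k j) \<longlonglongrightarrow> 0" for m n
  proof -
    define M where "M = m + n + N"
    define w where "w j = y * v j n - (\<Sum>i\<le>M. F t i n *\<^sub>C v j i)" for j
    have w: "w \<longlonglongrightarrow> 0" unfolding w_def by (rule representsD(1)[OF r v]) (simp add: M_def)
    have 1: "(\<lambda>j. star (v j m) * w j) \<longlonglongrightarrow> 0"
    proof (rule Lim_null_comparison)
      show "(\<lambda>j. norm (v j m) * norm (w j)) \<longlonglongrightarrow> 0"
        using tendsto_mult[OF nv tendsto_norm[OF w]] by simp
      show "\<forall>\<^sub>F j in sequentially. norm (star (v j m) * w j) \<le> norm (v j m) * norm (w j)"
        using norm_mult_ineq[of "star (v _ m)"] by (simp add: always_eventually)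
    qed
    have 2: "(\<lambda>j. \<Sum>i\<le>M. F t i n *\<^sub>C (star (v j m) * v j i - (if m = i then k j else 0))) \<longlonglongrightarrow> 0"
      by (intro tendsto_null_sum tendsto_zero_scaleC k)
    have "star (v j m) * w j + (\<Sum>i\<le>M. F t i n *\<^sub>C (star (v j m) * v j i - (if m = i then k j else 0)))
        = star (v j m) * (y * v j n) - F t m n *\<^sub>C k j" for j
    proof -
      have "(\<Sum>i\<le>M. F t i n *\<^sub>C (if m = i then k j else 0)) = (\<Sum>i\<le>M. if m = i then F t m n *\<^sub>C k j else 0)"
        by (intro sum.cong refl) auto
      also have "\<dots> = F t m n *\<^sub>C k j" by (simp add: M_def)
      finally show ?thesis
        by (simp add: w_def right_diff_distrib sum_distrib_left mult_scaleC_right scaleC.diff_right sum_subtractf)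
    qed
    then show ?thesis using tendsto_zero_add[OF 1 2] by simp
  qed
  have "(\<lambda>j. star (star (v j n) * (y * v j m) - F t n m *\<^sub>C k j)) \<longlonglongrightarrow> star 0"
    by (rule tendsto_star[OF key])
  then have "(\<lambda>j. star (v j m) * (y * v j n) - cnj (F t n m) *\<^sub>C k j) \<longlonglongrightarrow> 0"
    by (simp add: star_diff star_mult star_star star_scaleC k sa mult.assoc)
  from tendsto_diff[OF this key[of m n]]
  have "(\<lambda>j. (F t m n - cnj (F t n m)) *\<^sub>C k j) \<longlonglongrightarrow> 0"
    by (simp add: scaleC.diff_left)
  from tendsto_norm[OF this] have "F t m n - cnj (F t n m) = 0"
    by (simp add: norm_scaleC k LIMSEQ_const_iff)
  then show ?thesis by simp
qed

lemma symb_self_adjoint: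
  assumes r: "represents y F c N" and sa: "star y = y" and x: "sysC z x" "\<And>j. norm (x j) = 1"
  shows "Im (symb c N z) = 0"
proof -
  define q where "q = symb c N z"
  define w where "w j = star (x j) * (y * x j - q *\<^sub>C x j)" for j
  have w: "w \<longlonglongrightarrow> 0"
  proof (rule Lim_null_comparison[OF _ tendsto_norm_zero[OF representsD(2)[OF r x(1)]]], intro always_eventually allI)
    show "norm (w j) \<le> norm (y * x j - symb c N z *\<^sub>C x j)" for j
      using norm_mult_ineq[of "star (x j)" "y * x j - q *\<^sub>C x j"] by (simp add: w_def x q_def)
  qed
  have "star (w j) - w j = (q - cnj q) *\<^sub>C (star (x j) * x j)" for j
    by (simp add: w_def star_mult star_diff star_scaleC star_star sa right_diff_distrib left_diff_distrib
        mult_scaleC_left mult_scaleC_right scaleC.diff_left mult.assoc)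
  moreover have "(\<lambda>j. star (w j) - w j) \<longlonglongrightarrow> star 0 - 0"
    by (rule tendsto_diff[OF tendsto_star[OF w] w])
  ultimately have "(\<lambda>j. (q - cnj q) *\<^sub>C (star (x j) * x j)) \<longlonglongrightarrow> 0" by simp
  from tendsto_norm[OF this] have "q - cnj q = 0"
    by (simp add: norm_scaleC cstar_identity x LIMSEQ_const_iff)
  then have "q = cnj q" by simp
  then show ?thesis by (simp add: q_def[symmetric] complex_eq_iff)
qed

text \<open>On x the operator P - 1/2 scales norms by exactly 1/2, whereas y - 1/2 scales them
  nearly by the distance of the symbol from 1/2; the two agree up to
  \<open>\<epsilon>\<close>.\<close>

lemma symb_projection_dichotomy:
  assumes r: "represents y F c N" and sa: "star y = y" and x: "sysC z x" "\<And>j. norm (x j) = 1"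
    and P: "P * P = P" "star P = P" and le: "norm (y - P) \<le> \<epsilon>"
  shows "\<bar>\<bar>Re (symb c N z) - 1/2\<bar> - 1/2\<bar> \<le> \<epsilon>"
proof -
  define q where "q = symb c N z"
  define n where "n j = norm ((- (1/2)) *\<^sub>C x j + y * x j)" for j
  have q: "Im q = 0" unfolding q_def by (rule symb_self_adjoint[OF r sa x])
  have "(\<lambda>j. n j - cmod (q - 1/2)) \<longlonglongrightarrow> 0"
  proof (rule Lim_null_comparison[OF _ tendsto_norm_zero[OF representsD(2)[OF r x(1)]]], intro always_eventually allI)
    fix j
    have nq: "norm ((q - 1/2) *\<^sub>C x j) = cmod (q - 1/2)" by (simp add: norm_scaleC x)
    have e: "(- (1/2)) *\<^sub>C x j + y * x j - (q - 1/2) *\<^sub>C x j = y * x j - q *\<^sub>C x j"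
      by (simp add: scaleC.diff_left scaleC.minus_left)
    have "\<bar>norm ((- (1/2)) *\<^sub>C x j + y * x j) - norm ((q - 1/2) *\<^sub>C x j)\<bar>
        \<le> norm ((- (1/2)) *\<^sub>C x j + y * x j - (q - 1/2) *\<^sub>C x j)"
      by (rule norm_triangle_ineq3)
    then show "norm (n j - cmod (q - 1/2)) \<le> norm (y * x j - symb c N z *\<^sub>C x j)"
      by (simp only: n_def nq e q_def[symmetric] real_norm_def)
  qed
  then have "n \<longlonglongrightarrow> cmod (q - 1/2)" by (simp add: LIM_zero_iff)
  then have lim: "(\<lambda>j. \<bar>n j - 1/2\<bar>) \<longlonglongrightarrow> \<bar>cmod (q - 1/2) - 1/2\<bar>"
    by (intro tendsto_intros)
  have "\<bar>n j - 1/2\<bar> \<le> \<epsilon>" for j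
  proof -
    have "(- (1/2)) *\<^sub>C x j + y * x j - ((- (1/2)) *\<^sub>C x j + P * x j) = (y - P) * x j"
      by (simp add: left_diff_distrib)
    moreover have "norm ((y - P) * x j) \<le> \<epsilon>"
      using norm_mult_ineq[of "y - P" "x j"] le by (simp add: x)
    ultimately show ?thesis
      using norm_triangle_ineq3[of "(- (1/2)) *\<^sub>C x j + y * x j" "(- (1/2)) *\<^sub>C x j + P * x j"]
      by (simp add: n_def norm_half_projection[OF P] x)
  qed
  then have "\<bar>cmod (q - 1/2) - 1/2\<bar> \<le> \<epsilon>"
    by (intro LIMSEQ_le_const2[OF lim]) blast
  moreover have "q - 1/2 = of_real (Re q - 1/2)" using q by (simp add: complex_eq_iff)
  then have "cmod (q - 1/2) = \<bar>Re q - 1/2\<bar>" by (metis norm_of_real)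
  ultimately show ?thesis by (simp add: q_def)
qed

lemma sysC_nonempty:
  assumes "\<And>t. 0 < t \<Longrightarrow> t < 1 \<Longrightarrow> t\<^sup>2 \<in> sig b" and z: "cmod z = 1"
  shows "\<exists>x. sysC z x \<and> (\<forall>j. norm (x j) = 1)"
proof -
  \<comment> \<open>Any point of the open interval would do; the scalar systems arise from the shift
    part, not from the first weight.\<close>
  have s: "(1/2)\<^sup>2 \<in> sig b" "(1/2 :: real)\<^sup>2 \<noteq> 0" "(1/2 :: real)\<^sup>2 \<noteq> 1"
    using assms(1)[of "1/2"] by (auto simp: power2_eq_square)
  show ?thesis
  proof (rule generic_bump[OF s])
    fix f :: "nat \<Rightarrow> real \<Rightarrow> complex"
    assume "\<And>j. continuous_on UNIV (f j)" "\<And>j. f j 0 = 0" "\<And>j. f j 1 = 0"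
      "\<And>j. star (cfc b (f j)) = cfc b (f j)" "\<And>j. norm (cfc b (f j)) = 1"
    then show ?thesis by (intro sysC_exists[of "f 0"] z)
  qed
qed

text \<open>By connectedness of the circle, a symbol not near 0 is near 1 everywhere. Then 2 F t - 1
  has a Toeplitz part close to the identity, and subtracting the small difference leaves a matrix G
  t equal to the identity outside a finite corner. The lower bound for F t - 1/2 survives the
  subtraction, so the corners of G t are injective along the whole path.\<close>

lemma projection_symbol_small:
  assumes full: "\<And>t. 0 < t \<Longrightarrow> t < 1 \<Longrightarrow> t\<^sup>2 \<in> sig b"
    and r: "represents y F c N" and sa: "star y = y"
    and P: "P * P = P" "star P = P" and le: "norm (y - P) \<le> \<epsilon>" and \<epsilon>: "\<epsilon> \<le> 1/10" and z: "cmod z = 1"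
  shows "cmod (symb c N z) \<le> \<epsilon>"
proof (rule ccontr)
  assume not: "\<not> cmod (symb c N z) \<le> \<epsilon>"
  note R = representsD[OF r]
  have re: "Im (symb c N z) = 0" and dich: "\<bar>\<bar>Re (symb c N z) - 1/2\<bar> - 1/2\<bar> \<le> \<epsilon>" if z: "cmod z = 1" for z
  proof -
    obtain x where x: "sysC z x" "\<And>j. norm (x j) = 1" using sysC_nonempty[OF full z] by auto
    show "Im (symb c N z) = 0" by (rule symb_self_adjoint[OF r sa x])
    show "\<bar>\<bar>Re (symb c N z) - 1/2\<bar> - 1/2\<bar> \<le> \<epsilon>" by (rule symb_projection_dichotomy[OF r sa x P le])
  qed
  have creal: "cmod (symb c N z - of_real k) = \<bar>Re (symb c N z) - k\<bar>" if "cmod z = 1" for z k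
  proof -
    have "symb c N z - of_real k = of_real (Re (symb c N z) - k)" using re[OF that] by (simp add: complex_eq_iff)
    then show ?thesis by (metis norm_of_real)
  qed
  define g where "g \<theta> = Re (symb c N (cis \<theta>))" for \<theta>
  have contg: "continuous_on UNIV g"
    unfolding g_def symb_def by (intro continuous_intros) auto
  obtain \<theta>0 where th0: "z = cis \<theta>0" using z by (metis complex_norm_eq_1_exp cis_conv_exp mult.commute)
  have g0: "g \<theta>0 > 1/2"
    using not dich[OF z] creal[OF z, of 0] \<epsilon> unfolding g_def th0[symmetric] by (auto simp: abs_if split: if_splits)
  have gbig: "g \<theta> > 1/2" for \<theta>
  proof (rule ccontr)
    assume "\<not> g \<theta> > 1/2"
    moreover have "connected (range g)" using contg connected_continuous_image by blast
    ultimately have "1/2 \<in> range g"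
      using connected_contains_Icc[of "range g" "g \<theta>" "g \<theta>0"] g0 by auto
    then obtain \<phi> where "g \<phi> = 1/2" by auto
    then show False using dich[of "cis \<phi>"] \<epsilon> by (simp add: g_def)
  qed
  have near1: "cmod (symb c N z - 1) \<le> \<epsilon>" if z: "cmod z = 1" for z
  proof -
    obtain \<theta> where "z = cis \<theta>" using z by (metis complex_norm_eq_1_exp cis_conv_exp mult.commute)
    then have "Re (symb c N z) > 1/2" using gbig[of \<theta>] by (simp add: g_def)
    then show ?thesis using dich[OF z] creal[OF z, of 1] by (auto simp: abs_if split: if_splits)
  qed
  have \<epsilon>0: "\<epsilon> \<ge> 0" using le norm_ge_zero order_trans by blast
  \<comment> \<open>The coefficients of twice the deviation of the symbol from 1.\<close>
  define d where "d k = 2 * c k - (if k = 0 then 2 else 0)" for k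
  have dN: "d k = 0" if "int N < \<bar>k\<bar>" for k using R(5)[OF that] that by (auto simp: d_def)
  have symbd: "cmod (symb d N z) \<le> 2 * \<epsilon>" if z: "cmod z = 1" for z
  proof -
    have "symb d N z = 2 * symb c N z - (\<Sum>k\<in>{- int N..int N}. if k = 0 then 2 else 0)"
      unfolding symb_def d_def left_diff_distrib sum_subtractf sum_distrib_left
      by (intro arg_cong2[of _ _ _ _ "(-)"] sum.cong refl) (auto simp: mult.assoc)
    also have "\<dots> = 2 * (symb c N z - 1)" by simp
    finally have "cmod (symb d N z) = 2 * cmod (symb c N z - 1)" by (simp only: norm_mult) simp
    then show ?thesis using near1[OF z] by simp
  qed
  \<comment> \<open>With these weights the subtracted matrix loses row and column 0 at t = 0, just
    as F 0 does, so that G 0 is still G 1 moved down the diagonal, now with -1 in front.\<close>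
  define s where "s t m = (if m = (0::nat) then complex_of_real t else 1)" for t m
  define G where "G t m n = 2 * F t m n - (if m = n then 1 else 0) - s t m * s t n * d (int m - int n)" for t m n
  have Fherm: "F t n m = cnj (F t m n)" if t: "t \<in> {0..1}" for t m n
  proof -
    have "closed {t. F t n m = cnj (F t m n)}"
      by (intro closed_Collect_eq continuous_intros R(3))
    moreover have "{0<..<1} \<subseteq> {t. F t n m = cnj (F t m n)}"
    proof
      fix t :: real assume t: "t \<in> {0<..<1}"
      then obtain v where v: "sysT t v" using sysT_exists[of t] full[of t] by auto
      show "t \<in> {t. F t n m = cnj (F t m n)}"
        by (intro CollectI represents_hermitian[OF r sa v])
    qed
    ultimately have "{0..1} \<subseteq> {t. F t n m = cnj (F t m n)}" by (rule interval_subset_closed)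
    then show ?thesis using t by blast
  qed
  have lower: "(1/2 - \<epsilon>) * L2_set (\<lambda>n. cmod (\<xi> n)) {..<L}
      \<le> L2_set (\<lambda>m. cmod ((- (1/2)) * (if m < L then \<xi> m else 0) + (\<Sum>n<L. F t m n * \<xi> n))) {..<L + N}"
    if t: "t \<in> {0..1}" for t \<xi> L
  proof -
    let ?S = "{t. (1/2 - \<epsilon>) * L2_set (\<lambda>n. cmod (\<xi> n)) {..<L}
      \<le> L2_set (\<lambda>m. cmod ((- (1/2)) * (if m < L then \<xi> m else 0) + (\<Sum>n<L. F t m n * \<xi> n))) {..<L + N}}"
    have "closed ?S"
      unfolding L2_set_def by (intro closed_Collect_le continuous_intros R(3))
    moreover have "{0<..<1} \<subseteq> ?S"
    proof
      fix t :: real assume t: "t \<in> {0<..<1}"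
      then obtain v where v: "sysT t v" using sysT_exists[of t] full[of t] by auto
      have "(1/2 - \<epsilon>) * norm (vec_sum v \<xi> L j) \<le> norm ((- (1/2)) *\<^sub>C vec_sum v \<xi> L j + y * vec_sum v \<xi> L j)" for j
      proof -
        let ?V = "vec_sum v \<xi> L j"
        have "norm ((y - P) * ?V) \<le> \<epsilon> * norm ?V"
          by (rule order_trans[OF norm_mult_ineq mult_right_mono[OF le norm_ge_zero]])
        moreover have "(- (1/2)) *\<^sub>C ?V + P * ?V = ((- (1/2)) *\<^sub>C ?V + y * ?V) - (y - P) * ?V"
          by (simp add: left_diff_distrib)
        then have "norm ?V / 2 \<le> norm ((- (1/2)) *\<^sub>C ?V + y * ?V) + norm ((y - P) * ?V)"
          using norm_triangle_ineq4 norm_half_projection[OF P, of ?V] by metis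
        ultimately show ?thesis by (simp add: left_diff_distrib)
      qed
      then show "t \<in> ?S"
        by (intro CollectI LIMSEQ_le[OF tendsto_mult_left[OF norm_vec_sum[OF v]] represents_norm[OF r v]]) blast
    qed
    ultimately have "{0..1} \<subseteq> ?S" by (rule interval_subset_closed)
    then show ?thesis using t by blast
  qed
  show False
  \<comment> \<open>The size is N + 1: rows beyond N are rows of the identity for every t, while row
    N may have a nonzero entry in column 0 that disappears at t = 1.\<close>
  proof (rule determinant_sign_change[of G N])
    show "continuous_on UNIV (\<lambda>t. G t m n)" for m n
      unfolding G_def s_def by (cases "m = 0"; cases "n = 0") (auto intro!: continuous_intros R(3))
    show "G t n m = cnj (G t m n)" if t: "t \<in> {0..1}" for t m n
    proof -
      have "F t (n + N) (m + N) = cnj (F t (m + N) (n + N))" by (rule Fherm[OF t])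
      then have "c (int n - int m) = cnj (c (int m - int n))" by (simp add: R(4))
      then have "d (int n - int m) = cnj (d (int m - int n))" by (auto simp: d_def)
      then show ?thesis using Fherm[OF t, of n m] by (auto simp: G_def s_def)
    qed
    show "\<xi> k = 0" if t: "t \<in> {0..1}" and eq: "\<And>m. m < Suc N \<Longrightarrow> (\<Sum>n<Suc N. G t m n * \<xi> n) = 0"
      and k: "k < Suc N" for t \<xi> k
    proof -
      \<comment> \<open>The rows outside the corner vanish on the columns in use, so a kernel vector
        of the corner is one of the whole matrix.\<close>
      have zero: "(\<Sum>n<Suc N. G t m n * \<xi> n) = 0" for m
      proof (cases "m < Suc N")
        case False
        have "G t m n = 0" if "n < Suc N" for n
        proof -
          have "F t m n = c (int m - int n)" using False by (intro R(4)) simp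
          moreover have "c (int m - int n) = 0" if "n = 0" using False that by (intro R(5)) simp
          ultimately show ?thesis using False \<open>n < Suc N\<close> by (auto simp: G_def s_def d_def)
        qed
        then show ?thesis by simp
      qed (rule eq)
      define \<xi>' where "\<xi>' n = s t n * \<xi> n" for n
      have half: "(- (1/2)) * (if m < Suc N then \<xi> m else 0) + (\<Sum>n<Suc N. F t m n * \<xi> n)
          = (1/2) * s t m * (\<Sum>n<Suc N. d (int m - int n) * \<xi>' n)" for m
      proof -
        have "(\<Sum>n<Suc N. G t m n * \<xi> n) = 2 * (\<Sum>n<Suc N. F t m n * \<xi> n)
            - (\<Sum>n<Suc N. (if m = n then \<xi> m else 0)) - s t m * (\<Sum>n<Suc N. d (int m - int n) * \<xi>' n)"
          unfolding G_def left_diff_distrib sum_subtractf sum_distrib_left \<xi>'_def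
          by (intro arg_cong2[of _ _ _ _ "(-)"] sum.cong refl) (auto simp: mult_ac)
        also have "(\<Sum>n<Suc N. (if m = n then \<xi> m else 0)) = (if m < Suc N then \<xi> m else 0)" by simp
        finally have e: "0 = 2 * (\<Sum>n<Suc N. F t m n * \<xi> n) - (if m < Suc N then \<xi> m else 0)
            - s t m * (\<Sum>n<Suc N. d (int m - int n) * \<xi>' n)"
          unfolding zero .
        have alg: "(- (1/2)) * D + A = (1/2) * r * B" if "0 = 2 * A - D - r * B" for A B D r :: complex
        proof -
          have "D = 2 * A - r * B" using that by (simp add: eq_diff_eq diff_eq_eq add.commute)
          then show ?thesis by (simp add: algebra_simps)
        qed
        show ?thesis by (rule alg[OF e])
      qed
      have sle: "cmod (s t n) \<le> 1" for n using t by (auto simp: s_def)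
      let ?X = "L2_set (\<lambda>n. cmod (\<xi> n)) {..<Suc N}"
      have "(1/2 - \<epsilon>) * ?X \<le> L2_set (\<lambda>m. cmod ((1/2) * s t m * (\<Sum>n<Suc N. d (int m - int n) * \<xi>' n))) {..<Suc N + N}"
        using lower[OF t, of \<xi> "Suc N"] unfolding half .
      also have "\<dots> \<le> L2_set (\<lambda>m. (1/2) * cmod (\<Sum>n<Suc N. d (int m - int n) * \<xi>' n)) {..<Suc N + N}"
      proof (rule L2_set_mono)
        fix m
        show "cmod ((1/2) * s t m * (\<Sum>n<Suc N. d (int m - int n) * \<xi>' n)) \<le> (1/2) * cmod (\<Sum>n<Suc N. d (int m - int n) * \<xi>' n)"
          using mult_right_mono[OF sle[of m], of "cmod (\<Sum>n<Suc N. d (int m - int n) * \<xi>' n)"]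
          by (simp add: norm_mult del: sum.lessThan_Suc)
      qed simp
      also have "\<dots> = (1/2) * L2_set (\<lambda>m. cmod (\<Sum>n<Suc N. d (int m - int n) * \<xi>' n)) {..<Suc N + N}"
        by (rule L2_set_right_distrib[symmetric]) simp
      also have "\<dots> \<le> (1/2) * (2 * \<epsilon> * L2_set (\<lambda>n. cmod (\<xi>' n)) {..<Suc N})"
        by (intro mult_left_mono toeplitz_bound[OF dN symbd]) simp_all
      also have "\<dots> = \<epsilon> * L2_set (\<lambda>n. cmod (\<xi>' n)) {..<Suc N}" by simp
      also have "\<dots> \<le> \<epsilon> * ?X"
      proof (intro mult_left_mono \<epsilon>0 L2_set_mono)
        show "cmod (\<xi>' n) \<le> cmod (\<xi> n)" for n
          using mult_right_mono[OF sle[of n], of "cmod (\<xi> n)"] by (simp add: \<xi>'_def norm_mult)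
      qed simp
      \<comment> \<open>One \<open>\<epsilon>\<close> comes from replacing P by y, the other from
        the subtracted Toeplitz part; \<open>\<epsilon> \<le> 1/10\<close> keeps the factor
        positive.\<close>
      finally have "(1/2 - 2 * \<epsilon>) * ?X \<le> 0" by (simp add: left_diff_distrib)
      moreover have "?X \<ge> 0" by (rule L2_set_nonneg)
      ultimately have "?X = 0" using \<epsilon> by (auto simp: mult_le_0_iff)
      then show ?thesis using k by (rule L2_set_zero_imp)
    qed
    show "G 0 0 0 = -1" "\<And>n. G 0 0 (Suc n) = 0" by (simp_all add: G_def s_def R(6))
    show "G 0 (Suc m) (Suc n) = G 1 m n" for m n by (simp add: G_def s_def R(8))
    show "G 1 N n = (if n = N then 1 else 0)" if "n \<le> N" for n
      using that by (auto simp: G_def s_def R(4) d_def)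
  qed
qed

lemma self_adjoint_approx:
  assumes "P \<in> Cstar X" "star P = P" "\<epsilon> > 0"
  shows "\<exists>y\<in>pol. star y = y \<and> norm (y - P) \<le> \<epsilon>"
proof -
  obtain w where w: "w \<in> pol" "norm (w - P) < \<epsilon>" using pol_approx assms by blast
  define y where "y = (1/2) *\<^sub>C (w + star w)"
  have "y \<in> pol" unfolding y_def by (intro pol.scale pol.add pol_star w)
  moreover have "star y = y" by (simp add: y_def star_scaleC star_add star_star add.commute)
  moreover have "norm (y - P) \<le> \<epsilon>"
  proof -
    have "P = (1/2) *\<^sub>C (P + P)" by (simp add: scaleC_add_right flip: scaleC_add_left)
    then have "y - P = (1/2) *\<^sub>C ((w - P) + star (w - P))"
      using assms(2) by (metis (no_types, lifting) add_diff_add scaleC.diff_right star_diff y_def)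
    also have "norm \<dots> \<le> (1/2) * (norm (w - P) + norm (star (w - P)))"
      by (simp add: norm_scaleC norm_triangle_ineq del: norm_star)
    also have "\<dots> = norm (w - P)" by simp
    finally show ?thesis using w(2) by simp
  qed
  ultimately show ?thesis by blast
qed

section \<open>Finiteness along shift systems\<close>

text \<open>W = 1 + U - P is an isometry whose range is killed by the defect R. Along a shift system
  U has a small symbol, because U x and P x have equal norms, so W is close to the identity plus a
  finite corner. An injective corner is surjective: every v_n is nearly W V for some combination V,
  and R v_n is nearly 0.\<close>

lemma isometry_defect_vanishes:
  assumes full: "\<And>t. 0 < t \<Longrightarrow> t < 1 \<Longrightarrow> t\<^sup>2 \<in> sig b"
    and mem: "P \<in> Cstar X" "U \<in> Cstar X"
    and P: "P * P = P" "star P = P" and U: "star U * U = P" and PU: "P * (U * star U) = U * star U"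
    and v: "sysT t v"
  shows "(\<lambda>j. (P - U * star U) * v j n) \<longlonglongrightarrow> 0"
proof -
  define R where "R = P - U * star U"
  have UP: "U * P = U"
  proof -
    have "star (U * P - U) * (U * P - U) = P * P * P - P * P - P * P + P"
      by (simp add: star_diff star_mult P left_diff_distrib right_diff_distrib U[symmetric] mult.assoc)
        (simp add: U P mult.assoc[symmetric])
    then have "star (U * P - U) * (U * P - U) = 0" by (simp add: P)
    then show ?thesis using star_mult_zero by fastforce
  qed
  have PU': "P * U = U"
  proof -
    have "P * U = P * (U * star U) * U" by (simp add: mult.assoc U UP)
    then show ?thesis by (simp add: PU) (simp add: mult.assoc U UP)
  qed
  have UP': "star U * P = star U"
  proof -
    have "star (P * U) = star U" by (simp only: PU')
    then show ?thesis by (simp add: star_mult P)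
  qed
  \<comment> \<open>W is the sum of U, which starts at P, and of 1 - P; the two ranges are
    orthogonal because P U = U.\<close>
  have iso: "norm (x + (U * x - P * x)) = norm x" for x
  proof -
    have 1: "star U * (P * x) = star U * x" "P * (U * x) = U * x" "star U * (U * x) = P * x" "P * (P * x) = P * x" for x
      by (simp_all add: mult.assoc[symmetric] UP' PU' U P)
    have "star (x + (U * x - P * x)) * (x + (U * x - P * x)) = star x * x"
      by (simp add: star_add star_diff star_mult P distrib_left distrib_right left_diff_distrib right_diff_distrib mult.assoc 1)
    then show ?thesis by (metis cstar_norm_sqrt)
  qed
  have RW: "R * (x + (U * x - P * x)) = 0" for x
  proof -
    have 1: "U * (star U * (U * x)) = U * x" "P * (U * x) = U * x" "P * (P * x) = P * x" for x
      by (simp_all add: mult.assoc[symmetric] UP PU' P) (simp add: mult.assoc U UP)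
    have 2: "star U * (P * x) = star U * x" for x by (simp add: mult.assoc[symmetric] UP')
    show ?thesis
      by (simp add: R_def distrib_left left_diff_distrib right_diff_distrib mult.assoc 1 2)
  qed
  have est: "\<exists>f. f \<longlonglongrightarrow> norm R * (40 * \<epsilon>) \<and> (\<forall>j. norm (R * v j n) \<le> f j)" if \<epsilon>: "0 < \<epsilon>" "\<epsilon> \<le> 1/10" for \<epsilon>
  proof -
    obtain y where y: "y \<in> pol" "star y = y" "norm (y - P) \<le> \<epsilon>" using self_adjoint_approx[OF mem(1) P(2) \<epsilon>(1)] by blast
    obtain u where u: "u \<in> pol" "norm (u - U) < \<epsilon>" using pol_approx[OF mem(2) \<epsilon>(1)] by blast
    obtain F1 c1 N1 where r1: "represents y F1 c1 N1" using pol_represents[OF y(1)] by blast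
    define w where "w = u + (-1) *\<^sub>C y"
    have "w \<in> pol" unfolding w_def by (intro pol.add pol.scale u y)
    then obtain F c N where r: "represents w F c N" using pol_represents by blast
    note Rr = representsD[OF r]
    have w_close: "norm (w - (U - P)) \<le> 2 * \<epsilon>"
    proof -
      have "w - (U - P) = (u - U) - (y - P)" by (simp add: w_def scaleC.minus_left)
      then have "norm (w - (U - P)) \<le> norm (u - U) + norm (y - P)"
        by (simp only: norm_triangle_ineq4)
      then show ?thesis using u(2) y(3) by linarith
    qed
    have wV: "norm (w * x - (U * x - P * x)) \<le> 2 * \<epsilon> * norm x" for x
    proof -
      have "w * x - (U * x - P * x) = (w - (U - P)) * x" by (simp add: left_diff_distrib)
      then show ?thesis
        using order_trans[OF norm_mult_ineq mult_right_mono[OF w_close norm_ge_zero]] by simp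
    qed
    \<comment> \<open>P x and U x each have norm at most \<open>2 \<epsilon>\<close> in the limit,
      and w is within \<open>2 \<epsilon>\<close> of U - P.\<close>
    have sw: "cmod (symb c N z) \<le> 6 * \<epsilon>" if z: "cmod z = 1" for z
    proof -
      obtain x where x: "sysC z x" "\<And>j. norm (x j) = 1" using sysC_nonempty[OF full z] by auto
      have s1: "cmod (symb c1 N1 z) \<le> \<epsilon>"
        by (rule projection_symbol_small[OF full r1 y(2) P y(3) \<epsilon>(2) z])
      define g where "g j = norm (y * x j - symb c1 N1 z *\<^sub>C x j)" for j
      define h where "h j = norm (w * x j - symb c N z *\<^sub>C x j)" for j
      have lim: "(\<lambda>j. 2 * g j + h j + 6 * \<epsilon>) \<longlonglongrightarrow> 2 * 0 + 0 + 6 * \<epsilon>"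
        unfolding g_def h_def
        by (intro tendsto_intros tendsto_norm_zero representsD(2)[OF r1 x(1)] Rr(2)[OF x(1)])
      have "cmod (symb c N z) \<le> 2 * g j + h j + 6 * \<epsilon>" for j
      proof -
        have "norm (y * x j) \<le> g j + \<epsilon>"
          using norm_triangle_sub[of "y * x j" "symb c1 N1 z *\<^sub>C x j"] s1
          by (simp add: g_def norm_scaleC x)
        moreover have "norm (P * x j) \<le> norm (y * x j) + \<epsilon>"
        proof -
          have "norm ((y - P) * x j) \<le> \<epsilon>"
            using norm_mult_ineq[of "y - P" "x j"] y(3) by (simp add: x)
          moreover have "P * x j = y * x j - (y - P) * x j" by (simp add: left_diff_distrib)
          ultimately show ?thesis using norm_triangle_ineq4[of "y * x j" "(y - P) * x j"] by simp
        qed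
        moreover have "norm (U * x j) = norm (P * x j)"
        proof -
          have "star (U * x j) * (U * x j) = star (P * x j) * (P * x j)"
          proof -
            have "star (U * x j) * (U * x j) = star (x j) * ((star U * U) * x j)"
              by (simp add: star_mult mult.assoc)
            also have "\<dots> = star (x j) * ((P * P) * x j)" by (simp only: U P)
            also have "\<dots> = star (P * x j) * (P * x j)" by (simp only: star_mult P(2) mult.assoc)
            finally show ?thesis .
          qed
          then show ?thesis by (metis cstar_norm_sqrt)
        qed
        moreover have "norm (w * x j) \<le> norm (U * x j) + norm (P * x j) + 2 * \<epsilon>"
          using norm_triangle_sub[of "w * x j" "U * x j - P * x j"] norm_triangle_ineq4[of "U * x j" "P * x j"] wV[of "x j"]
          by (simp add: x)
        moreover have "cmod (symb c N z) \<le> norm (w * x j) + h j"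
          using norm_triangle_sub[of "symb c N z *\<^sub>C x j" "w * x j"]
          by (simp add: h_def norm_scaleC x norm_minus_commute)
        ultimately show ?thesis by linarith
      qed
      then have "cmod (symb c N z) \<le> 2 * 0 + 0 + 6 * \<epsilon>"
        by (intro LIMSEQ_le_const[OF lim]) blast
      then show ?thesis by simp
    qed
    \<comment> \<open>The corner must contain the exempt part of the matrix as well as the index n
      of the vector to be reached.\<close>
    define L where "L = max N (Suc n)"
    have L: "n < L" "N \<le> L" by (auto simp: L_def)
    define G where "G m k = (if m = k then 1 else 0) + F t m k - c (int m - int k)" for m k
    have Gout: "G m k = (if m = k then 1 else 0)" if "N \<le> m" for m k
      using Rr(4)[of m k] that by (simp add: G_def)
    define T where "T \<xi> m = (\<Sum>k<L. c (int m - int k) * \<xi> k)" for \<xi> m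
    have split: "1 * (if m < L then \<xi> m else 0) + (\<Sum>k<L. F t m k * \<xi> k) = (\<Sum>k<L. G m k * \<xi> k) + T \<xi> m" for \<xi> m
    proof -
      have "(\<Sum>k<L. G m k * \<xi> k) = (\<Sum>k<L. if m = k then \<xi> m else 0) + (\<Sum>k<L. F t m k * \<xi> k) - T \<xi> m"
        unfolding G_def T_def left_diff_distrib distrib_right sum_subtractf sum.distrib
        by (intro arg_cong2[of _ _ _ _ "(-)"] arg_cong2[of _ _ _ _ "(+)"] sum.cong refl) auto
      then show ?thesis by simp
    qed
    have Tle: "L2_set (\<lambda>m. cmod (T \<xi> m)) {..<L + N} \<le> 6 * \<epsilon> * L2_set (\<lambda>k. cmod (\<xi> k)) {..<L}" for \<xi>
      unfolding T_def by (rule toeplitz_bound[OF Rr(5) sw])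
    have low: "(1 - 2 * \<epsilon>) * L2_set (\<lambda>k. cmod (\<xi> k)) {..<L}
        \<le> L2_set (\<lambda>m. cmod (1 * (if m < L then \<xi> m else 0) + (\<Sum>k<L. F t m k * \<xi> k))) {..<L + N}" for \<xi>
    proof (rule LIMSEQ_le[OF tendsto_mult_left[OF norm_vec_sum[OF v]] represents_norm[OF r v]], intro exI allI impI)
      fix j
      let ?V = "vec_sum v \<xi> L j"
      have "norm ?V = norm (?V + (U * ?V - P * ?V))" by (simp only: iso)
      also have "\<dots> = norm ((1 *\<^sub>C ?V + w * ?V) - (w * ?V - (U * ?V - P * ?V)))"
        by (simp add: algebra_simps)
      also have "\<dots> \<le> norm (1 *\<^sub>C ?V + w * ?V) + norm (w * ?V - (U * ?V - P * ?V))" by (rule norm_triangle_ineq4)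
      finally show "(1 - 2 * \<epsilon>) * norm ?V \<le> norm (1 *\<^sub>C ?V + w * ?V)"
        using wV[of ?V] by (simp add: left_diff_distrib)
    qed
    have inj: "\<xi> k = 0" if eq: "\<And>m. m < L \<Longrightarrow> (\<Sum>k<L. G m k * \<xi> k) = 0" and k: "k < L" for \<xi> k
    proof -
      have "(\<Sum>k<L. G m k * \<xi> k) = 0" for m
      proof (cases "m < L")
        case False
        then have "G m k = 0" if "k < L" for k using Gout[of m k] L that by simp
        then show ?thesis by simp
      qed (rule eq)
      then have "(1 - 2 * \<epsilon>) * L2_set (\<lambda>k. cmod (\<xi> k)) {..<L} \<le> L2_set (\<lambda>m. cmod (T \<xi> m)) {..<L + N}"
        using low[of \<xi>] unfolding split by simp
      then have "(1 - 8 * \<epsilon>) * L2_set (\<lambda>k. cmod (\<xi> k)) {..<L} \<le> 0"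
        using Tle[of \<xi>] by (simp add: left_diff_distrib)
      moreover have "L2_set (\<lambda>k. cmod (\<xi> k)) {..<L} \<ge> 0" by (rule L2_set_nonneg)
      ultimately have "L2_set (\<lambda>k. cmod (\<xi> k)) {..<L} = 0" using \<epsilon> by (auto simp: mult_le_0_iff)
      then show ?thesis using k by (rule L2_set_zero_imp)
    qed
    obtain \<eta> where eta: "\<And>m. m < L \<Longrightarrow> (\<Sum>k<L. G m k * \<eta> k) = (if m = n then 1 else 0)"
    proof -
      have "\<exists>\<eta>. \<forall>m<L. (\<Sum>k<L. G m k * \<eta> k) = (if m = n then 1 else 0)"
        by (rule corner_solve[where G = G and n = L and l = n, OF _ L(1)]) (rule inj)
      then show thesis using that by blast
    qed
    have eta': "(\<Sum>k<L. G m k * \<eta> k) = (if m = n then 1 else 0)" for m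
    proof (cases "m < L")
      case False
      then have "G m k = 0" if "k < L" for k using Gout[of m k] L that by simp
      then show ?thesis using False L by auto
    qed (rule eta)
    let ?E = "L2_set (\<lambda>k. cmod (\<eta> k)) {..<L}"
    \<comment> \<open>The solution is bounded independently of \<open>\<epsilon>\<close>, since
      \<open>1 - 8 * \<epsilon>\<close> is at least 1/5.\<close>
    have E5: "?E \<le> 5"
    proof -
      have "(1 - 2 * \<epsilon>) * ?E \<le> L2_set (\<lambda>m. cmod ((if m = n then 1 else 0) + T \<eta> m)) {..<L + N}"
        using low[of \<eta>] unfolding split eta' .
      also have "\<dots> \<le> L2_set (\<lambda>m. cmod (if m = n then 1 else 0) + cmod (T \<eta> m)) {..<L + N}"
        by (rule L2_set_mono[OF norm_triangle_ineq]) simp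
      also have "\<dots> \<le> L2_set (\<lambda>m. cmod (if m = n then 1 else 0)) {..<L + N} + L2_set (\<lambda>m. cmod (T \<eta> m)) {..<L + N}"
        by (rule L2_set_triangle_ineq)
      also have "L2_set (\<lambda>m. cmod (if m = n then 1 else 0)) {..<L + N} = 1"
      proof -
        have "(\<Sum>m<L + N. (cmod (if m = n then 1 else 0))\<^sup>2) = (\<Sum>m<L + N. if m = n then 1 else 0)"
          by (intro sum.cong refl) auto
        then show ?thesis using L by (simp add: L2_set_def)
      qed
      also have "1 + L2_set (\<lambda>m. cmod (T \<eta> m)) {..<L + N} \<le> 1 + 6 * \<epsilon> * ?E" using Tle by simp
      finally have 1: "(1 - 8 * \<epsilon>) * ?E \<le> 1" by (simp add: left_diff_distrib)
      have "(1/5) * ?E \<le> (1 - 8 * \<epsilon>) * ?E" using \<epsilon> by (intro mult_right_mono) (auto simp: L2_set_nonneg)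
      with 1 show ?thesis by simp
    qed
    define V where "V = vec_sum v \<eta> L"
    define A where "A j = w * V j - vec_sum v (\<lambda>m. \<Sum>k<L. F t m k * \<eta> k) (L + N) j" for j
    define B where "B = vec_sum v (T \<eta>) (L + N)"
    have A: "A \<longlonglongrightarrow> 0" unfolding A_def V_def by (rule represents_vec_sum[OF r v])
    have nV: "(\<lambda>j. norm (V j)) \<longlonglongrightarrow> ?E" unfolding V_def by (rule norm_vec_sum[OF v])
    have nB: "(\<lambda>j. norm (B j)) \<longlonglongrightarrow> L2_set (\<lambda>m. cmod (T \<eta> m)) {..<L + N}" unfolding B_def by (rule norm_vec_sum[OF v])
    \<comment> \<open>The identity plus F sends \<open>\<eta>\<close> to the n-th unit vector plus
      \<open>T \<eta>\<close>; here A is the error of the matrix description of w and B the Toeplitz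
      remainder.\<close>
    have vj: "v j n = V j + w * V j - A j - B j" for j
    proof -
      have "V j + vec_sum v (\<lambda>m. \<Sum>k<L. F t m k * \<eta> k) (L + N) j
          = vec_sum v (\<lambda>m. 1 * (if m < L then \<eta> m else 0) + (\<Sum>k<L. F t m k * \<eta> k)) (L + N) j"
        unfolding V_def vec_sum_extend[of L "L + N" v \<eta> j, OF le_add1]
        by (simp add: vec_sum_def scaleC_add_left sum.distrib)
      also have "\<dots> = (\<Sum>m<L + N. if m = n then v j n else 0) + B j"
        unfolding split eta' B_def vec_sum_def scaleC_add_left sum.distrib
        by (intro arg_cong2[of _ _ _ _ "(+)"] sum.cong refl) auto
      also have "(\<Sum>m<L + N. if m = n then v j n else 0) = v j n" using L by simp
      finally show ?thesis by (simp add: A_def algebra_simps)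
    qed
    define f where "f j = norm R * (2 * \<epsilon> * norm (V j) + norm (A j) + norm (B j))" for j
    have "norm (R * v j n) \<le> f j" for j
    proof -
      have d: "v j n = (V j + (U * V j - P * V j)) + ((w * V j - (U * V j - P * V j)) - A j - B j)"
        by (simp add: vj)
      have "R * v j n = R * (V j + (U * V j - P * V j)) + R * ((w * V j - (U * V j - P * V j)) - A j - B j)"
        by (subst d) (rule distrib_left)
      then have "R * v j n = R * ((w * V j - (U * V j - P * V j)) - A j - B j)"
        by (simp only: RW add_0_left)
      then have "norm (R * v j n) \<le> norm R * norm ((w * V j - (U * V j - P * V j)) - A j - B j)"
        by (simp only: norm_mult_ineq)
      also have "\<dots> \<le> norm R * (2 * \<epsilon> * norm (V j) + norm (A j) + norm (B j))"
      proof (rule mult_left_mono)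
        show "norm ((w * V j - (U * V j - P * V j)) - A j - B j) \<le> 2 * \<epsilon> * norm (V j) + norm (A j) + norm (B j)"
          using wV[of "V j"] norm_triangle_ineq4[of "(w * V j - (U * V j - P * V j)) - A j" "B j"]
            norm_triangle_ineq4[of "w * V j - (U * V j - P * V j)" "A j"] by linarith
      qed simp
      finally show ?thesis by (simp add: f_def)
    qed
    moreover have "f \<longlonglongrightarrow> norm R * (2 * \<epsilon> * ?E + 0 + L2_set (\<lambda>m. cmod (T \<eta> m)) {..<L + N})"
      unfolding f_def by (intro tendsto_intros nV nB tendsto_norm_zero A)
    \<comment> \<open>40 = 2 * 5 + 6 * 5, from the distance of w to U - P and from the bound on the
      Toeplitz part.\<close>
    moreover have "norm R * (2 * \<epsilon> * ?E + 0 + L2_set (\<lambda>m. cmod (T \<eta> m)) {..<L + N}) \<le> norm R * (40 * \<epsilon>)"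
    proof (rule mult_left_mono)
      have "\<epsilon> * ?E \<le> \<epsilon> * 5" using E5 \<epsilon> by (intro mult_left_mono) auto
      then show "2 * \<epsilon> * ?E + 0 + L2_set (\<lambda>m. cmod (T \<eta> m)) {..<L + N} \<le> 40 * \<epsilon>"
        using Tle[of \<eta>] by simp
    qed simp
    ultimately show ?thesis
      by (intro exI[of _ "\<lambda>j. f j + (norm R * (40 * \<epsilon>) - norm R * (2 * \<epsilon> * ?E + 0 + L2_set (\<lambda>m. cmod (T \<eta> m)) {..<L + N}))"])
        (auto intro!: tendsto_eq_intros add_increasing2)
  qed
  show ?thesis
    unfolding R_def[symmetric]
  proof (rule LIMSEQ_I)
    fix e :: real assume e: "e > 0"
    \<comment> \<open>80 is twice 40, which makes the final inequality strict; the added 1 covers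
      the case R = 0.\<close>
    define \<epsilon> where "\<epsilon> = min (1/10) (e / (80 * (norm R + 1)))"
    have pos: "80 * (norm R + 1) > 0" by (simp add: add_nonneg_pos)
    have "0 < \<epsilon>" unfolding \<epsilon>_def using e pos by (simp only: min_less_iff_conj) simp
    moreover have "\<epsilon> \<le> 1/10" "\<epsilon> \<le> e / (80 * (norm R + 1))"
      unfolding \<epsilon>_def by (rule min.cobounded1, rule min.cobounded2)
    ultimately have \<epsilon>: "0 < \<epsilon>" "\<epsilon> \<le> 1/10" "\<epsilon> \<le> e / (80 * (norm R + 1))" .
    obtain f where f: "f \<longlonglongrightarrow> norm R * (40 * \<epsilon>)" "\<And>j. norm (R * v j n) \<le> f j"
      using est[OF \<epsilon>(1,2)] by blast
    have "\<epsilon> * (80 * (norm R + 1)) \<le> e" using \<epsilon>(3) pos by (simp add: pos_le_divide_eq)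
    then have "norm R * (40 * \<epsilon>) < e" using \<epsilon>(1) e by (simp add: algebra_simps)
    then have "\<forall>\<^sub>F j in sequentially. f j < e" using f(1) by (rule order_tendstoD(2)[rotated])
    then have "\<forall>\<^sub>F j in sequentially. norm (R * v j n - 0) < e"
      by (rule eventually_mono) (use f(2) order_le_less_trans in auto)
    then show "\<exists>no. \<forall>j\<ge>no. norm (R * v j n - 0) < e" by (simp only: eventually_sequentially)
  qed
qed

end

section \<open>Projections vanishing along all shift systems\<close>

context scaling
begin

section \<open>Shift vectors built from b (1 - b)\<close>

text \<open>Vanishing at 0 and 1, this cuts b down to the spectral values that give rise to shift
  systems; \<open>pact q b b_cut\<close> plays the part of h with polynomials instead of
  bumps.\<close>

definition b_cut where "b_cut = b - b * b"

lemma pact_g: "pact q b b_cut = pact (q * [:1, -1:]) b b"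
  by (simp only: pact_mult) (simp add: pact_pCons b_cut_def scaleC.minus_left right_diff_distrib)

lemma star_g: "star b_cut = b_cut"
  by (simp only: b_cut_def star_diff sa_b star_mult[of b b])

lemma star_pact_g: "star (pact q b b_cut) = pact (map_poly cnj q) b b_cut"
  by (rule pact_star[OF sa_b star_g]) (simp add: b_cut_def left_diff_distrib right_diff_distrib mult.assoc)

lemma a_pact_g: "star X * (X * pact q b b_cut) = pact q b b_cut"
  by (induction q)
    (simp_all add: pact_pCons b_cut_def distrib_left right_diff_distrib mult_scaleC_right mult.assoc aX)

lemma star_X_star_X_pact_g: "star X * (star X * pact q b b_cut) = 0"
  by (induction q)
    (simp_all add: pact_pCons b_cut_def distrib_left right_diff_distrib mult_scaleC_right mult.assoc Xa)

lemma a_power_pact_g: "star X * (X * ((*) X ^^ m) (pact q b b_cut)) = ((*) X ^^ m) (pact q b b_cut)"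
  by (cases m) (simp_all add: a_pact_g aX)

lemma g_X: "star X * (X * u) = u \<Longrightarrow> b_cut * (X * u) = 0"
  by (simp add: b_cut_def left_diff_distrib mult.assoc)

lemma pact_g_X: "star X * (X * u) = u \<Longrightarrow> pact q b b_cut * (X * u) = 0"
  by (simp add: pact_mult_right[symmetric] g_X)

lemma g_mult: "b_cut * u = pact [:0, 1, -1:] b u"
  by (simp add: pact_pCons b_cut_def scaleC.minus_left left_diff_distrib right_diff_distrib mult.assoc)

text \<open>The vectors of \<open>gsys\<close> without the factor 1/t, for a single element.\<close>

definition shift_vec :: "nat \<Rightarrow> 'a \<Rightarrow> 'a" where
  "shift_vec m u = (case m of 0 \<Rightarrow> star X * u | Suc k \<Rightarrow> ((*) X ^^ k) u)"

lemma bounded_linear_shift_vec: "bounded_linear (shift_vec m)"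
  unfolding shift_vec_def
  by (cases m) (auto intro: bounded_linear_mult_right bounded_linear_funpow_mult)

lemma shift_vec_mult: "shift_vec m (u * w) = shift_vec m u * w"
proof -
  have "((*) X ^^ k) (u * w) = ((*) X ^^ k) u * w" for k by (induction k) (simp_all add: mult.assoc)
  then show ?thesis by (simp add: shift_vec_def mult.assoc split: nat.split)
qed

lemma shift_vec_scaleC: "shift_vec m (c *\<^sub>C u) = c *\<^sub>C shift_vec m u"
proof -
  have "((*) X ^^ k) (c *\<^sub>C u) = c *\<^sub>C ((*) X ^^ k) u" for k by (induction k) (simp_all add: mult_scaleC_right)
  then show ?thesis by (simp add: shift_vec_def mult_scaleC_right split: nat.split)
qed

inductive_set shift_span :: "'a set" where
  base: "shift_vec m (pact q b b_cut) \<in> shift_span"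
| add: "u \<in> shift_span \<Longrightarrow> w \<in> shift_span \<Longrightarrow> u + w \<in> shift_span"

lemma shift_span_zero: "0 \<in> shift_span"
  using shift_span.base[of 0 0] by (simp add: shift_vec_def)

lemma shift_span_X: "u \<in> shift_span \<Longrightarrow> X * u \<in> shift_span"
proof (induction rule: shift_span.induct)
  case (base m q)
  show ?case
  proof (cases m)
    case 0
    have "X * shift_vec m (pact q b b_cut) = shift_vec 1 (pact ([:0, 1:] * q) b b_cut)"
      by (simp only: 0 pact_mult pact_X) (simp add: shift_vec_def mult.assoc)
    then show ?thesis using shift_span.base by simp
  next
    case (Suc k)
    have "X * shift_vec m (pact q b b_cut) = shift_vec (Suc m) (pact q b b_cut)" by (simp add: shift_vec_def Suc)
    then show ?thesis using shift_span.base by simp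
  qed
qed (simp add: distrib_left shift_span.add)

lemma shift_span_star_X: "u \<in> shift_span \<Longrightarrow> star X * u \<in> shift_span"
proof (induction rule: shift_span.induct)
  case (base m q)
  consider "m = 0" | "m = 1" | k where "m = Suc (Suc k)" by (metis One_nat_def not0_implies_Suc)
  then show ?case
  proof cases
    case 1
    then show ?thesis using shift_span_zero by (simp add: shift_vec_def star_X_star_X_pact_g)
  next
    case 2
    then have "star X * shift_vec m (pact q b b_cut) = shift_vec 0 (pact q b b_cut)" by (simp add: shift_vec_def)
    then show ?thesis using shift_span.base by simp
  next
    case (3 k)
    then have "star X * shift_vec m (pact q b b_cut) = shift_vec (Suc k) (pact q b b_cut)"
      by (simp add: shift_vec_def a_power_pact_g)
    then show ?thesis using shift_span.base by simp
  qed
qed (simp add: distrib_left shift_span.add)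

lemma shift_span_scale: "u \<in> shift_span \<Longrightarrow> c *\<^sub>C u \<in> shift_span"
proof (induction rule: shift_span.induct)
  case (base m q)
  have "c *\<^sub>C shift_vec m (pact q b b_cut) = shift_vec m (pact (smult c q) b b_cut)" by (simp add: pact_smult shift_vec_scaleC)
  then show ?case using shift_span.base by simp
qed (simp add: scaleC_add_right shift_span.add)

lemma pol_shift_span: "y \<in> pol \<Longrightarrow> u \<in> shift_span \<Longrightarrow> y * u \<in> shift_span"
  by (induction rule: pol.induct)
    (simp_all add: mult.assoc distrib_right mult_scaleC_left shift_span_X shift_span_star_X shift_span_scale shift_span.add)

lemma power_pact_g_orthogonal:
  "\<exists>r. star (((*) X ^^ m) (pact p b b_cut)) * ((*) X ^^ n) (pact q b b_cut) = pact r b b_cut"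
proof (induction m arbitrary: n)
  case 0
  show ?case
  proof (cases n)
    case 0
    have "star (pact p b b_cut) * pact q b b_cut = pact (map_poly cnj p * [:0, 1, -1:] * q) b b_cut"
      by (simp only: star_pact_g pact_mult g_mult[symmetric] pact_mult_right)
    then show ?thesis using 0 by auto
  next
    case (Suc k)
    then have "star (((*) X ^^ 0) (pact p b b_cut)) * ((*) X ^^ n) (pact q b b_cut) = pact 0 b b_cut"
      using pact_g_X[OF a_power_pact_g] by (simp add: star_pact_g)
    then show ?thesis by blast
  qed
next
  case (Suc m)
  show ?case
  proof (cases n)
    case 0
    have "star (pact (map_poly cnj q) b b_cut * (X * ((*) X ^^ m) (pact p b b_cut)))
        = star (((*) X ^^ Suc m) (pact p b b_cut)) * pact q b b_cut"
      by (simp add: star_mult star_pact_g map_poly_map_poly o_def map_poly_id)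
    then have "star (((*) X ^^ Suc m) (pact p b b_cut)) * ((*) X ^^ n) (pact q b b_cut) = pact 0 b b_cut"
      using 0 pact_g_X[OF a_power_pact_g] by simp
    then show ?thesis by blast
  next
    case (Suc k)
    then show ?thesis using Suc.IH[of k] by (simp add: star_mult mult.assoc a_power_pact_g)
  qed
qed

text \<open>The span is invariant under \<open>pol\<close>, and inner products of its generators are
  again polynomials in b applied to \<open>b_cut\<close>. So every matrix coefficient of an element
  of \<open>pol\<close> between such vectors is a function of b vanishing at 0 and 1.\<close>

lemma shift_vec_shift_span: "u \<in> shift_span \<Longrightarrow> \<exists>q. star (shift_vec n b_cut) * u = pact q b b_cut"
proof (induction rule: shift_span.induct)
  case (add u w)
  then show ?case by (metis distrib_left pact_add)
next
  case (base m q)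
  have g1: "b_cut = pact 1 b b_cut" by simp
  show ?case
  proof (cases n)
    case n: 0
    have sd: "star (shift_vec n b_cut) = b_cut * X" by (simp add: n shift_vec_def star_mult star_g star_star)
    show ?thesis
    proof (cases m)
      case 0
      have "star (shift_vec n b_cut) * shift_vec m (pact q b b_cut) = b_cut * (b * pact q b b_cut)"
        by (simp only: sd) (simp add: 0 shift_vec_def mult.assoc)
      also have "\<dots> = pact ([:0, 1, -1:] * [:0, 1:] * q) b b_cut"
        by (simp only: pact_mult g_mult pact_X)
      finally show ?thesis by blast
    next
      case (Suc k)
      have "star (shift_vec n b_cut) * shift_vec m (pact q b b_cut) = pact 0 b b_cut"
        using g_X[OF a_power_pact_g[of k q]] by (simp only: sd) (simp add: Suc shift_vec_def mult.assoc)
      then show ?thesis by blast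
    qed
  next
    case n: (Suc i)
    show ?thesis
    proof (cases m)
      case 0
      have "star (pact (map_poly cnj q) b b_cut * (X * ((*) X ^^ i) (pact 1 b b_cut)))
        = star (((*) X ^^ i) b_cut) * (star X * pact q b b_cut)"
        by (simp only: star_mult star_pact_g mult.assoc) (simp add: map_poly_map_poly o_def map_poly_id)
      then have "star (shift_vec n b_cut) * shift_vec m (pact q b b_cut) = pact 0 b b_cut"
        using pact_g_X[OF a_power_pact_g[of i 1]] by (simp add: n 0 shift_vec_def)
      then show ?thesis by blast
    next
      case (Suc k)
      then show ?thesis using power_pact_g_orthogonal[of i 1 k q] by (simp add: n shift_vec_def)
    qed
  qed
qed

section \<open>A projection that vanishes along all shift systems\<close>

context
  fixes R :: 'a
  assumes full: "\<And>t. 0 < t \<Longrightarrow> t < 1 \<Longrightarrow> t\<^sup>2 \<in> sig b"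
    and RA: "R \<in> Cstar X" and RR: "R * R = R" and saR: "star R = R"
    and vanish: "\<And>t v n. sysT t v \<Longrightarrow> (\<lambda>j. R * v j n) \<longlonglongrightarrow> 0"
begin

lemma R_sequence: "\<exists>y. (\<forall>i::nat. y i \<in> pol) \<and> y \<longlonglongrightarrow> R"
  using subsetD[OF Cstar_subset_closure RA] unfolding closure_sequential .

text \<open>The diagonal coefficient w of R is a limit of functions of b vanishing at 0 and 1. If it
  were nonzero, a nearby polynomial would attain its norm at some s other than 0 and 1. Bumps at s
  form a shift system, on which R and hence w tend to 0, while the polynomial acts nearly as a
  scalar of modulus at least 2/3 of \<open>norm w\<close>.\<close>

lemma R_shift_vec: "R * shift_vec n b_cut = 0"
proof (rule ccontr)
  assume nz: "R * shift_vec n b_cut \<noteq> 0"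
  define w where "w = star (shift_vec n b_cut) * (R * shift_vec n b_cut)"
  have "w = star (R * shift_vec n b_cut) * (R * shift_vec n b_cut)"
    unfolding w_def by (simp add: star_mult saR) (simp add: mult.assoc RR flip: mult.assoc[of R R])
  then have "norm w = (norm (R * shift_vec n b_cut))\<^sup>2" by (simp add: cstar_identity)
  then have wpos: "norm w > 0" using nz by simp
  obtain y where y: "\<And>i::nat. y i \<in> pol" "y \<longlonglongrightarrow> R" using R_sequence by blast
  have "(\<lambda>i. star (shift_vec n b_cut) * (y i * shift_vec n b_cut)) \<longlonglongrightarrow> w"
    unfolding w_def by (intro tendsto_intros y)
  moreover have "\<exists>q. star (shift_vec n b_cut) * (y i * shift_vec n b_cut) = pact q b b_cut" for i
    using shift_vec_shift_span[OF pol_shift_span[OF y(1) shift_span.base[of n 1]]] by simp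
  then obtain q where "\<And>i. star (shift_vec n b_cut) * (y i * shift_vec n b_cut) = pact (q i) b b_cut" by metis
  ultimately have "(\<lambda>i. pact (q i) b b_cut) \<longlonglongrightarrow> w" by simp
  then obtain i where i: "norm (pact (q i) b b_cut - w) < norm w / 3"
    using LIMSEQ_D[of _ w "norm w / 3"] wpos by (metis divide_pos_pos order_refl zero_less_numeral)
  define p where "p = q i * [:1, -1:]"
  have p: "pact p b b = pact (q i) b b_cut" by (simp only: p_def pact_g)
  obtain s where s: "s \<in> sig b" "norm (pact p b b) = cmod (of_real s * poly p (of_real s))"
    using norm_pact_attained[OF sa_b] by blast
  have big: "norm (pact p b b) \<ge> 2 * norm w / 3"
    using i norm_triangle_ineq3[of "pact (q i) b b_cut" w] unfolding p by linarith
  then have "of_real s * poly p (of_real s) \<noteq> (0::complex)" using s wpos by auto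
  then have s01: "s \<noteq> 0" "s \<noteq> 1" by (auto simp: p_def)
  have spos: "s > 0" using s(1) sig_b_nonneg s01 by force
  define t where "t = sqrt s"
  have t: "t > 0" "t\<^sup>2 = s" using spos by (simp_all add: t_def)
  show False
  proof (rule generic_bump[OF s(1) s01])
    fix f :: "nat \<Rightarrow> real \<Rightarrow> complex"
    assume f: "\<And>j. continuous_on UNIV (f j)" "\<And>j. f j 0 = 0" "\<And>j. f j 1 = 0"
      "\<And>j. star (cfc b (f j)) = cfc b (f j)" "\<And>j. norm (cfc b (f j)) = 1"
      "(\<lambda>j. b * cfc b (f j) - of_real s *\<^sub>C cfc b (f j)) \<longlonglongrightarrow> 0"
    define h where "h j = cfc b (f j)" for j
    define v where "v = gsys t h"
    have v: "sysT t v"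
      unfolding v_def h_def by (rule sysT_gsys[OF f(1-5)]) (use f(6) t in simp_all)
    have lim: "(\<lambda>j. b * h j - of_real s *\<^sub>C h j) \<longlonglongrightarrow> 0" using f(6) by (simp add: h_def)
    have gh: "(\<lambda>j. b_cut * h j - poly [:0, 1, -1:] (of_real s) *\<^sub>C h j) \<longlonglongrightarrow> 0"
      unfolding g_mult by (rule pact_approx_eigen[OF lim])
    define \<beta> where "\<beta> = poly [:0, 1, -1:] (complex_of_real s) * (if n = 0 then of_real t else 1)"
    have dvh: "poly [:0, 1, -1:] (of_real s) *\<^sub>C shift_vec n (h j) = \<beta> *\<^sub>C v j n" for j
      using t by (cases n) (simp_all add: \<beta>_def shift_vec_def v_def gsys_def scaleC_scaleC flip: scaleC_of_real)
    have "(\<lambda>j. shift_vec n (b_cut * h j - poly [:0, 1, -1:] (of_real s) *\<^sub>C h j)) \<longlonglongrightarrow> shift_vec n 0"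
      by (rule bounded_linear.tendsto[OF bounded_linear_shift_vec gh])
    moreover have "shift_vec n (b_cut * h j - poly [:0, 1, -1:] (of_real s) *\<^sub>C h j) = shift_vec n b_cut * h j - \<beta> *\<^sub>C v j n" for j
      by (simp only: linear_diff[OF bounded_linear.linear[OF bounded_linear_shift_vec]] shift_vec_mult shift_vec_scaleC dvh)
    moreover have "shift_vec n 0 = 0" by (rule linear_0[OF bounded_linear.linear[OF bounded_linear_shift_vec]])
    ultimately have "(\<lambda>j. shift_vec n b_cut * h j - \<beta> *\<^sub>C v j n) \<longlonglongrightarrow> 0" by simp
    then have "(\<lambda>j. R * (shift_vec n b_cut * h j - \<beta> *\<^sub>C v j n) + \<beta> *\<^sub>C (R * v j n)) \<longlonglongrightarrow> 0"
      by (intro tendsto_zero_add tendsto_zero_mult_left tendsto_zero_scaleC vanish[OF v])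
    then have "(\<lambda>j. R * shift_vec n b_cut * h j) \<longlonglongrightarrow> 0"
      by (simp add: right_diff_distrib mult_scaleC_right mult.assoc)
    then have "(\<lambda>j. star (shift_vec n b_cut) * (R * shift_vec n b_cut * h j)) \<longlonglongrightarrow> 0"
      by (rule tendsto_zero_mult_left)
    then have wh: "(\<lambda>j. norm (w * h j)) \<longlonglongrightarrow> 0"
      by (intro tendsto_norm_zero) (simp add: w_def mult.assoc)
    let ?z = "of_real s * poly p (of_real s)"
    have ph: "(\<lambda>j. norm (pact p b b * h j - ?z *\<^sub>C h j)) \<longlonglongrightarrow> 0"
    proof -
      have "pact (p * [:0, 1:]) b (h j) = pact p b b * h j" for j
        by (simp only: pact_mult pact_X pact_mult_right)
      then show ?thesis
        using pact_approx_eigen[OF lim, of "p * [:0, 1:]"] by (intro tendsto_norm_zero) (simp add: mult.commute)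
    qed
    have "norm w / 3 \<le> norm (w * h j) + norm (pact p b b * h j - ?z *\<^sub>C h j)" for j
    proof -
      have nh: "norm (h j) = 1" using f(5) by (simp add: h_def)
      have "norm (pact p b b) = norm (?z *\<^sub>C h j)" by (simp add: norm_scaleC nh s(2))
      also have "?z *\<^sub>C h j = (pact p b b - w) * h j + w * h j - (pact p b b * h j - ?z *\<^sub>C h j)"
        by (simp add: left_diff_distrib)
      also have "norm \<dots> \<le> norm ((pact p b b - w) * h j) + norm (w * h j) + norm (pact p b b * h j - ?z *\<^sub>C h j)"
        by (intro order_trans[OF norm_triangle_ineq4] add_right_mono norm_triangle_ineq)
      also have "norm ((pact p b b - w) * h j) \<le> norm w / 3"
        using norm_mult_ineq[of "pact p b b - w" "h j"] i unfolding p by (simp add: nh)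
      finally show ?thesis using big by linarith
    qed
    moreover have "(\<lambda>j. norm (w * h j) + norm (pact p b b * h j - ?z *\<^sub>C h j)) \<longlonglongrightarrow> 0 + 0"
      by (intro tendsto_add wh ph)
    ultimately have "norm w / 3 \<le> 0 + 0" by (intro LIMSEQ_le_const) auto
    then show False using wpos by simp
  qed
qed

definition star_pow :: "nat \<Rightarrow> 'a \<Rightarrow> 'a" where "star_pow n u = ((*) (star X) ^^ n) u"

lemma star_pow_simps [simp]: "star_pow 0 u = u" "star_pow (Suc n) u = star X * star_pow n u"
  by (simp_all add: star_pow_def)

lemma star_pow_shift: "star_pow (Suc n) u = star_pow n (star X * u)"
  by (simp add: star_pow_def funpow_swap1)

lemma star_star_pow: "star (star_pow n R) * w = R * ((*) X ^^ n) w"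
proof (induction n arbitrary: w)
  case (Suc n)
  have "star (star_pow (Suc n) R) * w = star (star_pow n R) * (X * w)"
    by (simp add: star_mult star_star mult.assoc)
  then show ?case by (simp add: Suc funpow_swap1)
qed (simp add: saR)

lemma g_star_pow: "b_cut * star_pow n R = 0"
proof -
  have "star (star_pow n R) * b_cut = 0" using R_shift_vec[of "Suc n"] by (simp add: star_star_pow shift_vec_def)
  then have "star (star (star_pow n R) * b_cut) = 0" by simp
  then show ?thesis by (simp add: star_mult star_star star_g)
qed

lemma g_X_R: "b_cut * (X * R) = 0"
proof -
  have "R * (star X * b_cut) = 0" using R_shift_vec[of 0] by (simp add: shift_vec_def)
  then have "star (R * (star X * b_cut)) = 0" by simp
  then show ?thesis by (simp add: star_mult star_star star_g saR mult.assoc)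
qed

lemma bb_of_g: "b_cut * u = 0 \<Longrightarrow> X * (star X * (X * (star X * u))) = X * (star X * u)"
  by (simp add: b_cut_def left_diff_distrib mult.assoc)

text \<open>The square of the defect y is \<open>star u * (b^3 - 2 b^2 + b) * u\<close>, which
  vanishes when b^2 u = b u.\<close>

lemma a_star_X: assumes "b_cut * u = 0" shows "star X * (X * (star X * u)) = star X * u"
proof -
  let ?y = "star X * (X * (star X * u)) - star X * u"
  note bb = bb_of_g[OF assms]
  have "star ?y * ?y = 0"
    by (simp add: star_diff star_mult star_star left_diff_distrib right_diff_distrib mult.assoc bb)
  then show ?thesis using star_mult_zero by fastforce
qed

text \<open>X y = 0 because b is idempotent on X R, and \<open>star y\<close> has a right factor X
  once it is written out.\<close>

lemma a_a_R: "star X * (X * (star X * (X * R))) = star X * (X * R)"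
proof -
  let ?y = "star X * (X * (star X * (X * R))) - star X * (X * R)"
  have Xy: "X * ?y = 0" using bb_of_g[OF g_X_R] by (simp add: right_diff_distrib)
  have "star ?y = R * star X * X * star X * X - R * star X * X"
    by (simp add: star_diff star_mult star_star saR mult.assoc)
  then have "star ?y * ?y = (R * star X * X * star X - R * star X) * (X * ?y)"
    by (simp only: left_diff_distrib mult.assoc)
  then have "star ?y * ?y = 0" by (simp only: Xy mult_zero_right)
  then have "?y = 0" by (rule star_mult_zero)
  then show ?thesis by simp
qed

lemma a_a_star_pow: "star X * (X * (star X * (X * star_pow n R))) = star X * (X * star_pow n R)"
proof (cases n)
  case (Suc k)
  then show ?thesis using a_star_X[OF g_star_pow[of k]] by simp
qed (simp add: a_a_R)

text \<open>Let u be the n-th power of \<open>star X\<close> applied to R. A nonzero k = (a - b) u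
  would satisfy \<open>star X * k = 0\<close> and a k = k, so its images X^m k, normalised, would be
  an exact shift system with first weight 1. As R annihilates it, R X^n k = 0, that is
  \<open>star u * k = 0\<close>; but \<open>star k * k = star u * k\<close>.\<close>

lemma e_star_pow: "star X * (X * star_pow n R) = X * (star X * star_pow n R)"
proof (rule ccontr)
  assume "star X * (X * star_pow n R) \<noteq> X * (star X * star_pow n R)"
  define u where "u = star_pow n R"
  define k where "k = star X * (X * u) - X * (star X * u)"
  have knz: "k \<noteq> 0" using \<open>star X * (X * star_pow n R) \<noteq> _\<close> by (simp add: k_def u_def)
  have gu: "b_cut * u = 0" by (simp add: u_def g_star_pow)
  have k0: "star X * k = 0"
    using a_star_X[OF gu] by (simp add: k_def right_diff_distrib Xa)
  have ak: "star X * (X * k) = k"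
    using a_a_star_pow[of n] by (simp add: k_def u_def right_diff_distrib aX)
  have akn: "star X * (X * ((*) X ^^ m) k) = ((*) X ^^ m) k" for m
    by (cases m) (simp_all add: ak aX)
  have kX: "star k * (X * w) = 0" for w
  proof -
    have "star (star X * k) = 0" using k0 by simp
    then have "star k * X = 0" by (simp add: star_mult star_star)
    then show ?thesis by (simp add: mult.assoc[symmetric])
  qed
  have orth: "star (((*) X ^^ m) k) * ((*) X ^^ i) k = (if m = i then star k * k else 0)" for m i
  proof (induction m arbitrary: i)
    case 0
    then show ?case by (cases i) (simp_all add: kX)
  next
    case (Suc m)
    show ?case
    proof (cases i)
      case 0
      then show ?thesis by (simp add: star_mult mult.assoc k0)
    next
      case (Suc i')
      then show ?thesis using Suc.IH[of i'] by (simp add: star_mult mult.assoc akn)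
    qed
  qed
  define r where "r = 1 / norm k"
  have r: "r * r * (norm k)\<^sup>2 = 1" "r \<noteq> 0" using knz by (simp_all add: r_def power2_eq_square)
  define v where "v j m = r *\<^sub>R ((*) X ^^ m) k" for j m :: nat
  have "sysT 1 v"
    unfolding sysT_def
  proof (intro conjI allI exI[of _ "\<lambda>_. (r * r) *\<^sub>R (star k * k)"])
    show "star ((r * r) *\<^sub>R (star k * k)) = (r * r) *\<^sub>R (star k * k)"
      by (simp add: star_scaleR star_mult star_star)
    show "norm ((r * r) *\<^sub>R (star k * k)) = 1"
      using r(1) by (simp add: cstar_identity abs_mult)
    show "(\<lambda>j. star (v j m) * v j i - (if m = i then (r * r) *\<^sub>R (star k * k) else 0)) \<longlonglongrightarrow> 0" for m i
      by (cases "m = i") (simp_all add: v_def star_scaleR orth)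
  qed (simp_all add: v_def k0 akn)
  from vanish[OF this, of n] have "(\<lambda>j. R * (r *\<^sub>R ((*) X ^^ n) k)) \<longlonglongrightarrow> 0"
    by (simp add: v_def)
  then have "r *\<^sub>R (R * ((*) X ^^ n) k) = 0" by (simp add: LIMSEQ_const_iff)
  then have "star u * k = 0" using r(2) by (simp add: u_def star_star_pow)
  moreover have "star k * k = star u * k"
  proof -
    have "star k * k = star u * (star X * (X * k)) - star u * (X * (star X * k))"
      by (simp add: k_def star_diff star_mult star_star left_diff_distrib mult.assoc)
    then show ?thesis by (simp add: ak k0)
  qed
  ultimately have "star k * k = 0" by simp
  then show False using knz star_mult_zero by blast
qed

text \<open>The elements on which \<open>X\<close> acts as a unitary.\<close>

definition unitary_part :: "'a set" where
  "unitary_part = {u. star X * (X * u) = u \<and> (\<forall>n. X * (star X * star_pow n u) = star_pow n u)}"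

lemma unitary_partD: "u \<in> unitary_part \<Longrightarrow> star X * (X * u) = u" "u \<in> unitary_part \<Longrightarrow> X * (star X * u) = u"
  unfolding unitary_part_def by (auto dest: spec[of _ 0])

lemma unitary_part_X: "u \<in> unitary_part \<Longrightarrow> X * u \<in> unitary_part"
proof -
  assume u: "u \<in> unitary_part"
  have "X * (star X * star_pow n (X * u)) = star_pow n (X * u)" for n
  proof (cases n)
    case 0
    then show ?thesis using unitary_partD(1)[OF u] by simp
  next
    case (Suc m)
    then have "star_pow n (X * u) = star_pow m u" using unitary_partD(1)[OF u] by (simp only: star_pow_shift)
    then show ?thesis using u by (simp add: unitary_part_def)
  qed
  then show ?thesis by (simp add: unitary_part_def aX)
qed

lemma unitary_part_star_X: "u \<in> unitary_part \<Longrightarrow> star X * u \<in> unitary_part"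
proof -
  assume u: "u \<in> unitary_part"
  have "X * (star X * star_pow n (star X * u)) = star_pow n (star X * u)" for n
    using u unfolding star_pow_shift[symmetric] by (simp only: unitary_part_def mem_Collect_eq)
  moreover have "star X * (X * (star X * u)) = star X * u" by (simp add: unitary_partD(2)[OF u])
  ultimately show ?thesis by (simp add: unitary_part_def)
qed

lemma star_pow_linear: "star_pow n (u + w) = star_pow n u + star_pow n w" "star_pow n (c *\<^sub>C u) = c *\<^sub>C star_pow n u"
  by (induction n) (simp_all add: distrib_left mult_scaleC_right)

lemma unitary_part_add: "u \<in> unitary_part \<Longrightarrow> w \<in> unitary_part \<Longrightarrow> u + w \<in> unitary_part"
  by (simp add: unitary_part_def star_pow_linear distrib_left)

lemma unitary_part_scale: "u \<in> unitary_part \<Longrightarrow> c *\<^sub>C u \<in> unitary_part"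
  by (simp add: unitary_part_def star_pow_linear mult_scaleC_right)

lemma closed_unitary_part: "closed unitary_part"
proof -
  have c: "continuous_on UNIV (star_pow n)" for n
    unfolding star_pow_def by (rule linear_continuous_on[OF bounded_linear_funpow_mult])
  have "unitary_part = {u. star X * (X * u) = u} \<inter> (\<Inter>n. {u. X * (star X * star_pow n u) = star_pow n u})"
    unfolding unitary_part_def by auto
  moreover have "closed {u. X * (star X * star_pow n u) = star_pow n u}" for n
    by (intro closed_Collect_eq continuous_intros c)
  moreover have "closed {u. star X * (X * u) = u}"
    by (intro closed_Collect_eq continuous_intros)
  ultimately show ?thesis by (simp only:) (intro closed_Int closed_INT ballI)
qed

lemma b_star_pow_Suc: "X * (star X * star_pow (Suc n) R) = star_pow (Suc n) R"
  using e_star_pow[of "Suc n"] a_star_X[OF g_star_pow[of n]] by simp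

lemma X_R_unitary_part: "X * R \<in> unitary_part"
proof -
  have XaR: "X * (star X * (X * R)) = X * R"
  proof -
    let ?y = "X * (star X * (X * R)) - X * R"
    have "star ?y * ?y = 0"
      by (simp add: star_diff star_mult star_star saR left_diff_distrib right_diff_distrib mult.assoc a_a_R)
    then show ?thesis using star_mult_zero by fastforce
  qed
  have aR: "star X * (X * R) = X * (star X * R)" using e_star_pow[of 0] by simp
  have "X * (star X * star_pow n (X * R)) = star_pow n (X * R)" for n
  proof -
    consider "n = 0" | "n = 1" | i where "n = Suc (Suc i)" by (metis One_nat_def not0_implies_Suc)
    then show ?thesis
    proof cases
      case 2
      have "X * (star X * (star X * (X * R))) = X * (star X * R)" by (simp add: Xa)
      then show ?thesis using 2 by (simp add: aR)
    next
      case (3 i)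
      have "star_pow n (X * R) = star_pow i (star X * (star X * (X * R)))" unfolding 3 by (simp only: star_pow_shift)
      also have "\<dots> = star_pow (Suc i) R" by (simp only: Xa star_pow_shift)
      finally show ?thesis using b_star_pow_Suc[of i] by simp
    qed (simp add: XaR)
  qed
  then show ?thesis by (simp add: unitary_part_def aX)
qed

lemma star_X_R_unitary_part: "star X * R \<in> unitary_part"
proof -
  have "X * (star X * star_pow n (star X * R)) = star_pow n (star X * R)" for n
    unfolding star_pow_shift[symmetric] by (rule b_star_pow_Suc)
  moreover have "star X * (X * (star X * R)) = star X * R" using a_star_X[OF g_star_pow[of 0]] by simp
  ultimately show ?thesis by (simp add: unitary_part_def)
qed

text \<open>The induction over \<open>pol\<close> starts from X R and \<open>star X * R\<close>,
  which are already known to belong; R = R R is reached as a limit of y R.\<close>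

lemma R_unitary_part: "R \<in> unitary_part"
proof -
  have pR: "y * R \<in> unitary_part" if "y \<in> pol" for y
    using that
    by (induction rule: pol.induct)
      (simp_all add: X_R_unitary_part star_X_R_unitary_part mult.assoc distrib_right mult_scaleC_left unitary_part_X unitary_part_star_X unitary_part_add unitary_part_scale)
  obtain y where y: "\<And>i::nat. y i \<in> pol" "y \<longlonglongrightarrow> R" using R_sequence by blast
  have "(\<lambda>i. y i * R) \<longlonglongrightarrow> R * R" by (intro tendsto_intros y)
  then have "R * R \<in> unitary_part" by (rule closed_sequentially[OF closed_unitary_part, rotated]) (rule pR[OF y(1)])
  then show ?thesis by (simp add: RR)
qed

text \<open>On this part X and \<open>star X\<close> are mutually inverse, so they commute with each
  other and hence with every element of \<open>pol\<close>.\<close>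

lemma pol_unitary_part:
  assumes "y \<in> pol" "u \<in> unitary_part"
  shows "y * u \<in> unitary_part" "X * (y * u) = y * (X * u)" "star X * (y * u) = y * (star X * u)"
proof -
  have "\<forall>u\<in>unitary_part. y * u \<in> unitary_part \<and> X * (y * u) = y * (X * u) \<and> star X * (y * u) = y * (star X * u)"
    using assms(1)
    by (induction rule: pol.induct)
      (simp_all add: mult.assoc distrib_right distrib_left mult_scaleC_left mult_scaleC_right unitary_part_X unitary_part_star_X
        unitary_part_add unitary_part_scale unitary_partD)
  then show "y * u \<in> unitary_part" "X * (y * u) = y * (X * u)" "star X * (y * u) = y * (star X * u)"
    using assms(2) by auto
qed

lemma R_commute: "X * R = R * (X * R)" "star X * R = R * (star X * R)"
proof -
  obtain y where y: "\<And>i::nat. y i \<in> pol" "y \<longlonglongrightarrow> R" using R_sequence by blast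
  have "(\<lambda>i. X * (y i * R)) \<longlonglongrightarrow> X * (R * R)" "(\<lambda>i. y i * (X * R)) \<longlonglongrightarrow> R * (X * R)"
    "(\<lambda>i. star X * (y i * R)) \<longlonglongrightarrow> star X * (R * R)" "(\<lambda>i. y i * (star X * R)) \<longlonglongrightarrow> R * (star X * R)"
    by (intro tendsto_intros y)+
  then show "X * R = R * (X * R)" "star X * R = R * (star X * R)"
    unfolding pol_unitary_part(2,3)[OF y(1) R_unitary_part] RR using LIMSEQ_unique by blast+
qed

section \<open>Scalar systems in the range of the projection\<close>

text \<open>On vectors fixed by R a polynomial y near R acts nearly as the identity, yet also nearly
  as its symbol, which is at most 1/10.\<close>

lemma sysC_R_null:
  assumes x: "sysC z x" and Rx: "\<And>j. R * x j = x j"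
  shows "x \<longlonglongrightarrow> 0"
proof -
  obtain y where y: "y \<in> pol" "star y = y" "norm (y - R) \<le> 1/10"
    using self_adjoint_approx[OF RA saR, of "1/10"] by auto
  obtain F c N where r: "represents y F c N" using pol_represents[OF y(1)] by blast
  have q: "cmod (symb c N z) \<le> 1/10"
    by (rule projection_symbol_small[OF full r y(2) RR saR y(3)]) (use x in \<open>auto simp: sysC_def\<close>)
  show ?thesis
  proof (rule null_of_bounded_below[OF representsD(2)[OF r x], of "1/2"])
    fix j
    have "norm ((y - R) * x j) \<le> 1/10 * norm (x j)"
      by (rule order_trans[OF norm_mult_ineq mult_right_mono[OF y(3) norm_ge_zero]])
    moreover have "norm (symb c N z *\<^sub>C x j) \<le> 1/10 * norm (x j)"
      unfolding norm_scaleC by (rule mult_right_mono[OF q norm_ge_zero])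
    moreover have "norm (x j) \<le> norm (y * x j - symb c N z *\<^sub>C x j) + (norm ((y - R) * x j) + norm (symb c N z *\<^sub>C x j))"
    proof -
      have "x j = (y * x j - symb c N z *\<^sub>C x j) - ((y - R) * x j - symb c N z *\<^sub>C x j)"
        by (simp add: left_diff_distrib Rx)
      then have "norm (x j) = norm ((y * x j - symb c N z *\<^sub>C x j) - ((y - R) * x j - symb c N z *\<^sub>C x j))"
        by (rule arg_cong)
      also have "\<dots> \<le> norm (y * x j - symb c N z *\<^sub>C x j) + norm ((y - R) * x j - symb c N z *\<^sub>C x j)"
        by (rule norm_triangle_ineq4)
      also have "norm ((y - R) * x j - symb c N z *\<^sub>C x j) \<le> norm ((y - R) * x j) + norm (symb c N z *\<^sub>C x j)"
        by (rule norm_triangle_ineq4)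
      finally show ?thesis by simp
    qed
    ultimately show "1/2 * norm (x j) \<le> norm (y * x j - symb c N z *\<^sub>C x j)"
      using norm_ge_zero[of "x j"] by linarith
  qed simp
qed

text \<open>If R is nonzero, the self-adjoint \<open>c0 = (X + star X) R\<close> has approximate
  eigenvectors h in the range of R, where X is unitary. Since (X - z)(X - cnj z) = X (c0 - s) there,
  either (X - cnj z) h or h itself is a non-null scalar system in the range of R, which is
  impossible.\<close>

lemma R_zero: "R = 0"
proof (rule ccontr)
  assume nz: "R \<noteq> 0"
  have nR: "norm R = 1"
  proof -
    have "norm R = (norm R)\<^sup>2" using cstar_identity[of R] by (simp add: saR RR)
    then show ?thesis using nz by (simp add: power2_eq_square)
  qed
  define c0 where "c0 = X * R + star X * R"
  have RX: "R * X = X * R" "R * star X = star X * R"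
  proof -
    have "star (star X * R) = star (R * (star X * R))" using R_commute(2) by simp
    then show "R * X = X * R" using R_commute(1) by (simp add: star_mult star_star saR mult.assoc)
    have "star (X * R) = star (R * (X * R))" using R_commute(1) by simp
    then show "R * star X = star X * R" using R_commute(2) by (simp add: star_mult saR mult.assoc)
  qed
  have sac: "star c0 = c0" by (simp add: c0_def star_add star_mult star_star saR RX add.commute)
  have Rc0: "R * c0 = c0" by (simp add: c0_def distrib_left R_commute[symmetric])
  have Rc0u: "R * (c0 * u) = c0 * u" for u by (simp add: Rc0 mult.assoc[symmetric])
  have nc0: "norm c0 \<le> 2"
  proof -
    have "star (X * R) * (X * R) = R" by (simp add: star_mult saR mult.assoc unitary_partD[OF R_unitary_part] RR)
    moreover have "star (star X * R) * (star X * R) = R"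
      by (simp add: star_mult star_star saR mult.assoc unitary_partD[OF R_unitary_part] RR)
    ultimately have "norm (X * R) = 1" "norm (star X * R) = 1"
      using cstar_norm_sqrt[of "X * R"] cstar_norm_sqrt[of "star X * R"] nR by simp_all
    then show ?thesis using norm_triangle_ineq[of "X * R" "star X * R"] by (simp add: c0_def)
  qed
  have "\<exists>s h. \<bar>s\<bar> \<le> 2 \<and> (\<forall>j::nat. norm (h j) = 1 \<and> R * h j = h j) \<and> (\<lambda>j. c0 * h j - of_real s *\<^sub>C h j) \<longlonglongrightarrow> 0"
  proof -
    obtain s where s: "s \<in> sig c0" "norm (pact 1 c0 c0) = cmod (of_real s * poly 1 (of_real s))"
      using norm_pact_attained[OF sac] by blast
    then have ns: "norm c0 = \<bar>s\<bar>" by simp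
    show ?thesis
    proof (cases "s = 0")
      case True
      then have "c0 = 0" using ns by simp
      then show ?thesis by (intro exI[of _ 0] exI[of _ "\<lambda>_. R"]) (simp add: nR RR)
    next
      case False
      show ?thesis
      proof (rule bump_sequence[OF sac s(1) False less_numeral_extra(1)])
        fix f :: "nat \<Rightarrow> real \<Rightarrow> complex"
        assume f: "\<And>j. continuous_on UNIV (f j)" "\<And>j. f j 0 = 0" "\<And>j. norm (cfc c0 (f j)) = 1"
          "(\<lambda>j. c0 * cfc c0 (f j) - of_real s *\<^sub>C cfc c0 (f j)) \<longlonglongrightarrow> 0"
        have "cfc c0 (f j) \<in> {h. R * h = h}" for j
          by (rule cfc_left_induct[OF sac f(1,2)])
            (auto simp: Rc0 Rc0u distrib_left mult_scaleC_right intro!: closed_Collect_eq continuous_intros)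
        then show ?thesis using f(3,4) ns nc0 by (intro exI[of _ s] exI[of _ "\<lambda>j. cfc c0 (f j)"]) simp
      qed
    qed
  qed
  then obtain s h where s: "\<bar>s\<bar> \<le> 2" and h: "\<And>j::nat. norm (h j) = 1" "\<And>j. R * h j = h j"
    and lim: "(\<lambda>j. c0 * h j - of_real s *\<^sub>C h j) \<longlonglongrightarrow> 0" by blast
  have ah: "star X * (X * h j) = h j" and bh: "X * (star X * h j) = h j" for j
  proof -
    have "star X * (X * (R * h j)) = star X * (X * R) * h j" "X * (star X * (R * h j)) = X * (star X * R) * h j"
      by (simp_all only: mult.assoc)
    then show "star X * (X * h j) = h j" "X * (star X * h j) = h j"
      by (simp_all add: unitary_partD[OF R_unitary_part] h)
  qed
  have RXh: "R * (X * h j) = X * h j" for j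
  proof -
    have "R * (X * h j) = X * (R * h j)" by (simp only: mult.assoc[symmetric] RX)
    then show ?thesis by (simp add: h)
  qed
  have c0h: "c0 * h j = X * h j + star X * h j" for j
    by (simp add: c0_def distrib_right mult.assoc h)
  \<comment> \<open>The point of the unit circle with real part s/2, so that z + cnj z = s; it
    exists because c0 has norm at most 2.\<close>
  define z where "z = Complex (s / 2) (sqrt (1 - (s / 2)\<^sup>2))"
  have s2: "(s / 2)\<^sup>2 \<le> 1" using s by (simp add: abs_square_le_1)
  have z1: "cmod z = 1" by (simp add: z_def cmod_def s2)
  have zs: "z + cnj z = of_real s" by (simp add: z_def complex_eq_iff)
  have zz: "z * cnj z = 1" "cnj z * z = 1" using z1 by (simp_all add: complex_norm_square[symmetric] mult.commute)
  define x where "x j = X * h j - cnj z *\<^sub>C h j" for j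
  have Xx: "X * x j - z *\<^sub>C x j = X * (c0 * h j - of_real s *\<^sub>C h j)" for j
    by (simp add: x_def c0h zs[symmetric] right_diff_distrib distrib_left scaleC.diff_right mult_scaleC_right
        scaleC_scaleC zz bh scaleC_add_left)
  have ax: "star X * (X * x j) = x j" for j
    by (simp add: x_def right_diff_distrib mult_scaleC_right aX ah)
  have l1: "(\<lambda>j. X * x j - z *\<^sub>C x j) \<longlonglongrightarrow> 0" unfolding Xx by (rule tendsto_zero_mult_left[OF lim])
  have "(\<lambda>j. (- cnj z) *\<^sub>C (star X * (X * x j - z *\<^sub>C x j))) \<longlonglongrightarrow> 0"
    by (intro tendsto_zero_scaleC tendsto_zero_mult_left l1)
  moreover have "(- cnj z) *\<^sub>C (star X * (X * x j - z *\<^sub>C x j)) = star X * x j - cnj z *\<^sub>C x j" for j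
    by (simp add: right_diff_distrib mult_scaleC_right ax scaleC.diff_right scaleC_scaleC scaleC.minus_left zz)
  ultimately have "sysC z x" using z1 l1 by (simp add: sysC_def)
  then have x0: "x \<longlonglongrightarrow> 0"
    by (rule sysC_R_null) (simp add: x_def right_diff_distrib mult_scaleC_right RXh h)
  have "(\<lambda>j. (- z) *\<^sub>C (star X * x j)) \<longlonglongrightarrow> 0"
    by (intro tendsto_zero_scaleC tendsto_zero_mult_left x0)
  moreover have "(- z) *\<^sub>C (star X * x j) = star X * h j - z *\<^sub>C h j" for j
    by (simp add: x_def right_diff_distrib mult_scaleC_right ah scaleC.diff_right scaleC_scaleC scaleC.minus_left zz)
  moreover have "(\<lambda>j. X * h j - cnj z *\<^sub>C h j) \<longlonglongrightarrow> 0" using x0 unfolding x_def[abs_def] .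
  ultimately have "sysC (cnj z) h" using z1 by (simp add: sysC_def)
  then have "h \<longlonglongrightarrow> 0" by (rule sysC_R_null) (rule h)
  from tendsto_norm[OF this] show False by (simp add: h LIMSEQ_const_iff)
qed

end

lemma no_infinite_projection:
  assumes full: "\<And>t. 0 < t \<Longrightarrow> t < 1 \<Longrightarrow> t\<^sup>2 \<in> sig b"
  shows "\<not> infinite_projection (Cstar X) P"
proof
  assume inf: "infinite_projection (Cstar X) P"
  note A = cstar_subalgebra_Cstar[of X]
  from inf have Pp: "projection (Cstar X) P" by (simp add: infinite_projection_def)
  then have P: "P \<in> Cstar X" "P * P = P" "star P = P" by (simp_all add: projection_def)
  from inf obtain U where U: "U \<in> Cstar X" "star U * U = P" "cstar_le (Cstar X) (U * star U) P" "U * star U \<noteq> P"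
    unfolding infinite_projection_def by blast
  have QQ: "U * star U * (U * star U) = U * star U"
  proof -
    let ?y = "U * P - U"
    have "U * star U * U = U * P" by (simp add: mult.assoc U)
    have "star ?y * ?y = P * (star U * U) * P - P * (star U * U) - (star U * U) * P + star U * U"
      by (simp add: star_diff star_mult P left_diff_distrib right_diff_distrib mult.assoc)
    then have "star ?y * ?y = 0" by (simp add: U P)
    then have "?y = 0" by (rule star_mult_zero)
    then have UP: "U * P = U" by simp
    have "U * star U * (U * star U) = U * (star U * U) * star U" by (simp add: mult.assoc)
    then show ?thesis by (simp add: U UP)
  qed
  have saQ: "star (U * star U) = U * star U" by (simp add: star_mult star_star)
  have QA: "U * star U \<in> Cstar X" using U(1) A by (intro cstar_subalgebraD)
  have "projection (Cstar X) (U * star U)" using QQ saQ QA by (simp add: projection_def)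
  then have PQ: "P * (U * star U) = U * star U" by (rule projection_le_imp_mult[OF A Pp _ U(3)])
  then have "star (P * (U * star U)) = star (U * star U)" by simp
  then have QP: "U * star U * P = U * star U" by (simp only: star_mult[of P] saQ P)
  have "P - U * star U = 0"
  proof (rule R_zero[OF full])
    show "P - U * star U \<in> Cstar X" by (rule cstar_subalgebra_diff[OF A P(1) QA])
    show "(P - U * star U) * (P - U * star U) = P - U * star U"
      by (simp only: left_diff_distrib right_diff_distrib P PQ QP QQ) simp
    show "star (P - U * star U) = P - U * star U" by (simp add: star_diff saQ P)
    show "(\<lambda>j. (P - U * star U) * v j n) \<longlonglongrightarrow> 0" if "sysT t v" for t v n
      by (rule isometry_defect_vanishes[OF full P(1) U(1) P(2,3) U(2) PQ that])
  qed
  with U(4) show False by simp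
qed

end

theorem theoremE:
  fixes X :: "'a::cstar_algebra"
  assumes "scaling_element X"
  shows "(\<exists>P. infinite_projection (Cstar X) P) \<longleftrightarrow>
         complex_of_real ` {0..1} - spectrum (Cstar X) (cstar_abs (Cstar X) (star X)) \<noteq> {}"
proof -
  interpret scaling X by unfold_locales (rule assms)
  have "(\<exists>P. infinite_projection (Cstar X) P) \<longleftrightarrow> (\<exists>t. 0 < t \<and> t < 1 \<and> t\<^sup>2 \<notin> sig (X * star X))"
  proof
    assume "\<exists>P. infinite_projection (Cstar X) P"
    then show "\<exists>t. 0 < t \<and> t < 1 \<and> t\<^sup>2 \<notin> sig (X * star X)"
      using no_infinite_projection by blast
  next
    assume "\<exists>t. 0 < t \<and> t < 1 \<and> t\<^sup>2 \<notin> sig (X * star X)"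
    then obtain t where "0 < t" "t < 1" "t\<^sup>2 \<notin> sig (X * star X)" by blast
    then show "\<exists>P. infinite_projection (Cstar X) P"
      by (intro gap_imp_infinite_projection[of "t\<^sup>2"]) (auto simp: power_less_one_iff)
  qed
  then show ?thesis by (simp only: gap_iff)
qed

end
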